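(* Let $(X,d,m)$ be a countably infinite homogeneous ultrametric measure space, $L$ a homogeneous hierarchical Laplacian on it, $(a_i)_{i\ge1}$ a sequence of distinct points of $X$, and $(\sigma_i)_{i\ge1}$ real numbers with $\alpha<\sigma_i<\beta$ for all $i$ and some $\alpha,\beta>0$. Let $V=-\sum_{i=1}^\infty\sigma_i\delta_{a_i}$ and $H=L+V$. Assume that $$\lim_{N\to\infty}\ \sup_{i\ge N}\ \sum_{j\ge N,\ j\ne i}\frac1{d(a_i,a_j)}=0.$$ Then $$\mathrm{Spec}_{ess}(H)=\mathrm{Spec}(L)\cup\mathcal{R}^{-1}(1/\Sigma_* ).$$
   Context: Countably infinite homogeneous ultrametric measure space: $X$ is a countably infinite set with an ultrametric $d$ ($d(x,y)\le\max\{d(x,z),d(z,y)\}$) whose balls $B_r(x)=\{y:d(x,y)\le r\}$ are all finite and whose isometry group acts transitively; $m$ is the counting measure, and $d$ is normalized so that $m(B)=\mathrm{diam}(B)$ for every non-singleton ball (so $d(x,y)$, $x\ne y$, is the measure of the minimal ball containing $x$ and $y$). $\mathcal{B}$ is the family of all balls of positive radius (singletons included), $\mathcal{B}(x)$ the family of those containing $x$. Homogeneous hierarchical Laplacian: let $C:\mathcal{B}\to(0,\infty)$ satisfy $C(A)=C(B)$ whenever $A,B$ have the same diameter, and $\sum_{T\in\mathcal{B},\,B\subseteq T}C(T)<\infty$ for all $B$. Then $$Lf(x)=\sum_{B\in\mathcal{B}(x)}C(B)\Big(f(x)-\frac1{m(B)}\int_B f\,dm\Big),$$ a bounded self-adjoint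 operator on $L^2(X,m)$. $\delta_a$ is the function equal to $1$ at $a$ and $0$ elsewhere. For $\lambda\notin\mathrm{Spec}(L)$, $\mathcal{R}(\lambda,x,y)$ is the integral kernel of $(L-\lambda\mathrm{I})^{-1}$; $\mathcal{R}(\lambda,a,a)$ does not depend on $a\in X$. $\Sigma_*$ is the set of limit points (subsequential limits) of the sequence $(\sigma_i)$; $1/\Sigma_*=\{1/\sigma_*:\sigma_*\in\Sigma_*\}$; $\mathcal{R}^{-1}(1/\Sigma_* )=\{\lambda\in\mathbb{R}\setminus\mathrm{Spec}(L):\mathcal{R}(\lambda,a,a)\in1/\Sigma_*\}$. $\mathrm{Spec}_{ess}$ denotes the essential spectrum. The section's standing assumption that $\min_{i,j\ge n,\,i\ne j}d(a_i,a_j)\to\infty$ as $n\to\infty$ is implied by the displayed condition. *)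

theory Defs
  imports "HOL-Analysis.Analysis"
begin

text \<open>Bounded operators on the complex Hilbert space \<open>L\<^sup>2\<close> of the counting measure on a type. An operator
  is a total map on functions; only its values on \<open>l2\<close> matter below.\<close>

definition l2 :: "('a \<Rightarrow> complex) set" where
  "l2 = {f. (\<lambda>x. (cmod (f x))\<^sup>2) summable_on UNIV}"

definition l2_norm :: "('a \<Rightarrow> complex) \<Rightarrow> real" where
  "l2_norm f = sqrt (\<Sum>\<^sub>\<infinity>x. (cmod (f x))\<^sup>2)"

definition bounded_operator :: "(('a \<Rightarrow> complex) \<Rightarrow> 'a \<Rightarrow> complex) \<Rightarrow> bool" where
  "bounded_operator T \<longleftrightarrow>
     (\<forall>f\<in>l2. T f \<in> l2) \<and>
     (\<forall>f\<in>l2. \<forall>g\<in>l2. T (\<lambda>x. f x + g x) = (\<lambda>x. T f x + T g x)) \<and>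
     (\<forall>c. \<forall>f\<in>l2. T (\<lambda>x. c * f x) = (\<lambda>x. c * T f x)) \<and>
     (\<exists>K. \<forall>f\<in>l2. l2_norm (T f) \<le> K * l2_norm f)"

definition shifted :: "(('a \<Rightarrow> complex) \<Rightarrow> 'a \<Rightarrow> complex) \<Rightarrow> complex \<Rightarrow> ('a \<Rightarrow> complex) \<Rightarrow> 'a \<Rightarrow> complex" where
  "shifted T z f = (\<lambda>x. T f x - z * f x)"

definition resolvent :: "(('a \<Rightarrow> complex) \<Rightarrow> 'a \<Rightarrow> complex) \<Rightarrow> complex \<Rightarrow> ('a \<Rightarrow> complex) \<Rightarrow> 'a \<Rightarrow> complex" where
  "resolvent T z = inv_into l2 (shifted T z)"

definition Spec :: "(('a \<Rightarrow> complex) \<Rightarrow> 'a \<Rightarrow> complex) \<Rightarrow> complex set" where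
  "Spec T = {z. \<not> (bij_betw (shifted T z) l2 l2 \<and> bounded_operator (resolvent T z))}"

definition eigenspace :: "(('a \<Rightarrow> complex) \<Rightarrow> 'a \<Rightarrow> complex) \<Rightarrow> complex \<Rightarrow> ('a \<Rightarrow> complex) set" where
  "eigenspace T z = {f \<in> l2. T f = (\<lambda>x. z * f x)}"

definition finite_dimensional :: "('a \<Rightarrow> complex) set \<Rightarrow> bool" where
  "finite_dimensional E \<longleftrightarrow>
     (\<exists>(n::nat) b. \<forall>f\<in>E. \<exists>c. f = (\<lambda>x. \<Sum>i<n. c i * b i x))"

text \<open>The discrete spectrum of a self-adjoint operator consists of the isolated eigenvalues of finite
  multiplicity. Geometric multiplicity is used, which is the right notion only because the operators are
  self-adjoint.\<close>

definition Spec_disc :: "(('a \<Rightarrow> complex) \<Rightarrow> 'a \<Rightarrow> complex) \<Rightarrow> complex set" where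
  "Spec_disc T =
     {z. z isolated_in Spec T \<and> eigenspace T z \<noteq> {\<lambda>x. 0} \<and> finite_dimensional (eigenspace T z)}"

definition Spec_ess :: "(('a \<Rightarrow> complex) \<Rightarrow> 'a \<Rightarrow> complex) \<Rightarrow> complex set" where
  "Spec_ess T = Spec T - Spec_disc T"

text \<open>The sum over \<open>y\<close> is the integral against the counting measure. For a bounded operator such a kernel
  exists by the Riesz representation theorem and is unique (test with point masses).\<close>

definition integral_kernel :: "(('a \<Rightarrow> complex) \<Rightarrow> 'a \<Rightarrow> complex) \<Rightarrow> 'a \<Rightarrow> 'a \<Rightarrow> complex" where
  "integral_kernel T = (THE K. \<forall>f\<in>l2. \<forall>x. ((\<lambda>y. K x y * f y) has_sum T f x) UNIV)"

definition balls :: "'a::metric_space set set" where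
  "balls = {cball x r | x r. 0 < r}"

definition homogeneous_choice_function :: "('a::metric_space set \<Rightarrow> real) \<Rightarrow> bool" where
  "homogeneous_choice_function C \<longleftrightarrow>
     (\<forall>B\<in>balls. 0 < C B) \<and>
     (\<forall>A\<in>balls. \<forall>B\<in>balls. diameter A = diameter B \<longrightarrow> C A = C B) \<and>
     (\<forall>B\<in>balls. C summable_on {T \<in> balls. B \<subseteq> T})"

definition hierarchical_laplacian ::
    "('a::metric_space set \<Rightarrow> real) \<Rightarrow> ('a \<Rightarrow> complex) \<Rightarrow> 'a \<Rightarrow> complex" where
  "hierarchical_laplacian C f x =
     (\<Sum>\<^sub>\<infinity>B\<in>{B \<in> balls. x \<in> B}. of_real (C B) * (f x - (\<Sum>y\<in>B. f y) / of_nat (card B)))"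

definition limit_points :: "(nat \<Rightarrow> real) \<Rightarrow> real set" where
  "limit_points \<sigma> = {s. \<exists>r. strict_mono r \<and> (\<sigma> \<circ> r) \<longlonglongrightarrow> s}"

end

theory Submission
  imports Defs
begin

text \<open>Let \<open>\<lambda>\<close> be real and outside \<open>Spec L\<close>, let \<open>R\<close> be the resolvent of \<open>L\<close> at \<open>\<lambda>\<close> with kernel \<open>R(x, y)\<close>,
and put \<open>u = - V f\<close>. Then \<open>(H - \<lambda>) f = g\<close> says \<open>f = R g + R u\<close>, which at the well \<open>a\<^sub>i\<close> reads
\<open>(1/\<sigma>\<^sub>i - R(a\<^sub>i, a\<^sub>i)) u(a\<^sub>i) - (\<Sum>j\<noteq>i. R(a\<^sub>i, a\<^sub>j) u(a\<^sub>j)) = (R g)(a\<^sub>i)\<close>.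
Ultrametricity gives \<open>\<bar>R(x, y)\<bar> \<le> const / d(x, y)\<close>, so by sparseness the off-diagonal part has arbitrarily
small norm once finitely many wells are set aside (Schur test). The diagonal decides:

\<^item> If \<open>R(a, a)\<close> is not a limit point of \<open>1/\<sigma>\<^sub>i\<close>, then \<open>f\<close> is controlled by \<open>(H - \<lambda>) f\<close> and finitely many
  values of \<open>f\<close> (\<open>resolvent_estimate\<close>). Such an estimate confines \<open>\<lambda>\<close> to the discrete spectrum or the
  resolvent set (\<open>finite_rank_estimate_imp_Spec_disc\<close>).
\<^item> If \<open>1/\<sigma>\<^sub>i\<close> tends to \<open>R(a, a)\<close> along a subsequence, the functions \<open>R \<delta>\<^bsub>a\<^sub>i\<^esub>\<close> form a Weyl sequence
  for \<open>H\<close> (\<open>resonance_imp_Spec_ess\<close>).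

Points of \<open>Spec L\<close> survive because wells are too sparse to meet every ball of a given size: eigenfunctions
of \<open>L\<close> on free balls are eigenfunctions of \<open>H\<close> (\<open>Spec_L_subset_Spec_ess_H\<close>).

The spectral theory behind this is elementary. A symmetric bounded operator is invertible iff it is bounded
below, and near an isolated point of the spectrum every approximate eigenvector is close to an exact one
(\<open>approximate_kernel\<close>); this yields Weyl's criterion \<open>Weyl_sequence_imp_Spec_ess\<close> without a spectral
theorem. On the side of \<open>L\<close>, a functional calculus of averages over balls gives the spectrum and the
resolvent explicitly.\<close>

section \<open>Bounded symmetric operators on a real Hilbert space\<close>

definition bounded_below :: "('h::real_normed_vector \<Rightarrow> 'h) \<Rightarrow> bool" where
  "bounded_below S \<longleftrightarrow> (\<exists>c>0. \<forall>f. c * norm f \<le> norm (S f))"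

definition symmetric :: "('h::real_inner \<Rightarrow> 'h) \<Rightarrow> bool" where
  "symmetric S \<longleftrightarrow> (\<forall>f g. inner (S f) g = inner f (S g))"

lemma norm_diff_scaleR_squared:
  fixes x y :: "'h::real_inner"
  shows "(norm (x - t *\<^sub>R y))\<^sup>2 = (norm x)\<^sup>2 - 2 * t * inner y x + t\<^sup>2 * (norm y)\<^sup>2"
  unfolding power2_norm_eq_inner
  by (simp add: inner_diff_left inner_diff_right inner_commute algebra_simps power2_eq_square[of t])

lemma bounded_below_inj:
  assumes "bounded_linear S" "bounded_below S"
  shows "inj S"
proof -
  interpret bounded_linear S by fact
  have "f = 0" if "S f = 0" for f
    using assms(2) that unfolding bounded_below_def
    by (metis mult_le_0_iff norm_le_zero_iff norm_zero not_le)
  then show ?thesis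
    by (simp add: linear_injective_0 linear_axioms)
qed

lemma not_bounded_belowD:
  assumes "\<not> bounded_below S" "0 < e"
  obtains f where "norm (S f) < e * norm f"
  using assms unfolding bounded_below_def by (meson not_le)

text \<open>This is the Lax-Milgram lemma: for small \<open>t\<close> the map \<open>f \<mapsto> f - t (B f - g)\<close> is a contraction, and its
fixed point solves \<open>B f = g\<close>.\<close>

lemma coercive_imp_bij:
  fixes B :: "'h::{real_inner,banach} \<Rightarrow> 'h"
  assumes B: "bounded_linear B" and c: "0 < c"
    and coercive: "\<And>f. c * (norm f)\<^sup>2 \<le> inner (B f) f"
  shows "bij B"
proof -
  interpret bounded_linear B by fact
  obtain K0 where K0: "\<And>f. norm (B f) \<le> norm f * K0" using bounded by blast
  define K where "K = max K0 c"
  have K: "norm (B f) \<le> K * norm f" "0 < K" "c \<le> K" for f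
    using K0[of f] c mult_left_mono[of K0 K "norm f"] by (auto simp: K_def mult.commute)
  \<comment> \<open>This step size minimises the contraction constant \<open>1 - 2 t c + t\<^sup>2 K\<^sup>2\<close>.\<close>
  define t where "t = c / K\<^sup>2"
  define q where "q = sqrt (1 - c\<^sup>2 / K\<^sup>2)"
  have cK: "c\<^sup>2 / K\<^sup>2 \<le> 1" "0 < c\<^sup>2 / K\<^sup>2"
    using c K by (auto simp: power_mono divide_le_eq)
  have q: "0 \<le> q" "q < 1" "q\<^sup>2 = 1 - c\<^sup>2 / K\<^sup>2"
    using cK by (auto simp: q_def)
  have contr: "norm (f - t *\<^sub>R B f) \<le> q * norm f" for f
  proof (rule power2_le_imp_le)
    have "(norm (f - t *\<^sub>R B f))\<^sup>2 = (norm f)\<^sup>2 - 2 * t * inner (B f) f + t\<^sup>2 * (norm (B f))\<^sup>2"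
      by (rule norm_diff_scaleR_squared)
    also have "\<dots> \<le> (norm f)\<^sup>2 - 2 * t * (c * (norm f)\<^sup>2) + t\<^sup>2 * (K * norm f)\<^sup>2"
    proof -
      have "2 * t * (c * (norm f)\<^sup>2) \<le> 2 * t * inner (B f) f"
        using coercive[of f] c by (intro mult_left_mono) (auto simp: t_def)
      moreover have "t\<^sup>2 * (norm (B f))\<^sup>2 \<le> t\<^sup>2 * (K * norm f)\<^sup>2"
        using K(1)[of f] by (intro mult_left_mono power_mono) auto
      ultimately show ?thesis by linarith
    qed
    also have "\<dots> = (q * norm f)\<^sup>2"
      using K(2) unfolding power_mult_distrib q(3) by (simp add: t_def field_simps power2_eq_square)
    finally show "(norm (f - t *\<^sub>R B f))\<^sup>2 \<le> (q * norm f)\<^sup>2" .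
  qed (use q in auto)
  have t: "0 < t" using c K by (simp add: t_def)
  have "\<exists>f. B f = g" for g
  proof -
    define \<phi> where "\<phi> f = f - t *\<^sub>R (B f - g)" for f
    have "dist (\<phi> x) (\<phi> y) \<le> q * dist x y" for x y
    proof -
      have "\<phi> x - \<phi> y = (x - y) - t *\<^sub>R B (x - y)"
        by (simp add: \<phi>_def diff algebra_simps)
      then show ?thesis using contr[of "x - y"] by (simp add: dist_norm)
    qed
    then have "\<exists>!x. \<phi> x = x"
      using banach_fix_type[of q \<phi>] q by blast
    then obtain x where "\<phi> x = x" by blast
    then show ?thesis using t by (auto simp: \<phi>_def)
  qed
  moreover have "bounded_below B"
    unfolding bounded_below_def
  proof (intro exI[of _ c] conjI allI)
    fix f
    have "c * norm f * norm f \<le> norm (B f) * norm f"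
      using coercive[of f] norm_cauchy_schwarz[of "B f" f] by (simp add: power2_eq_square mult.assoc)
    then show "c * norm f \<le> norm (B f)"
      by (cases "f = 0") (auto simp: zero)
  qed (use c in auto)
  ultimately show ?thesis
    using bounded_below_inj[OF B] by (metis bij_def surj_def)
qed

text \<open>The square of \<open>S\<close> is coercive, since \<open>\<langle>S (S f), f\<rangle> = \<parallel>S f\<parallel>\<^sup>2\<close>, and \<open>S\<close> is onto when its square is.\<close>

lemma symmetric_bounded_below_imp_bij:
  fixes S :: "'h::{real_inner,banach} \<Rightarrow> 'h"
  assumes S: "bounded_linear S" and sym: "symmetric S" and below: "bounded_below S"
  shows "bij S"
proof -
  obtain c where c: "0 < c" "\<And>f. c * norm f \<le> norm (S f)"
    using below by (auto simp: bounded_below_def)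
  have "bij (\<lambda>f. S (S f))"
  proof (rule coercive_imp_bij[where c = "c\<^sup>2"])
    show "bounded_linear (\<lambda>f. S (S f))" by (rule bounded_linear_compose[OF S S])
    show "c\<^sup>2 * (norm f)\<^sup>2 \<le> inner (S (S f)) f" for f
    proof -
      have "(c * norm f)\<^sup>2 \<le> (norm (S f))\<^sup>2" using c by (intro power_mono) auto
      also have "\<dots> = inner (S (S f)) f" using sym by (simp add: symmetric_def power2_norm_eq_inner)
      finally show ?thesis by (simp add: power_mult_distrib)
    qed
  qed (use c in auto)
  then have "\<exists>f. g = S f" for g
    using bij_is_surj by (auto simp: surj_def)
  then have "surj S" by (auto simp: surj_def)
  then show ?thesis using bounded_below_inj[OF S below] by (simp add: bij_def)
qed

lemma symmetric_shift:
  assumes "symmetric S"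
  shows "symmetric (\<lambda>f. S f - w *\<^sub>R f)"
  unfolding symmetric_def
proof (intro allI)
  fix f g
  have "inner (S f) g = inner f (S g)" using assms by (auto simp: symmetric_def)
  then show "inner (S f - w *\<^sub>R f) g = inner f (S g - w *\<^sub>R g)"
    by (simp only: inner_diff_left inner_diff_right inner_scaleR_left inner_scaleR_right)
qed

lemma bounded_linear_shift:
  "bounded_linear S \<Longrightarrow> bounded_linear (\<lambda>f. S f - w *\<^sub>R f)"
  by (intro bounded_linear_sub bounded_linear_scaleR_right)

lemma bounded_below_compose:
  assumes "bounded_below S" "bounded_below T"
  shows "bounded_below (\<lambda>f. S (T f))"
proof -
  obtain c d where "0 < c" "\<And>f. c * norm f \<le> norm (S f)" "0 < d" "\<And>f. d * norm f \<le> norm (T f)"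
    using assms by (auto simp: bounded_below_def)
  then show ?thesis
    unfolding bounded_below_def
    by (intro exI[of _ "c * d"]) (metis mult.assoc mult_le_cancel_left_pos mult_pos_pos order_trans)
qed

text \<open>This is the bound of the resolvent by the inverse distance to the spectrum. Let \<open>c\<close> be the best lower bound
of \<open>S = T - z\<close>. If \<open>f\<close> nearly attains it and \<open>S v = f\<close>, then \<open>S (S v)\<close> is nearly \<open>c\<^sup>2 v\<close>, so
\<open>S\<^sup>2 - c\<^sup>2 = (S - c) (S + c)\<close> is not bounded below. One of \<open>z \<plusminus> c\<close> is therefore in the spectrum, and
\<open>c \<ge> r\<close>.\<close>

lemma norm_shift_ge_spectral_distance:
  fixes T :: "'h::{real_inner,banach} \<Rightarrow> 'h"
  assumes T: "bounded_linear T" and sym: "symmetric T"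
    and r: "0 < r" and free: "\<And>w. \<bar>w - z\<bar> < r \<Longrightarrow> bounded_below (\<lambda>f. T f - w *\<^sub>R f)"
  shows "r * norm f \<le> norm (T f - z *\<^sub>R f)"
proof -
  define S where "S f = T f - z *\<^sub>R f" for f
  have S: "bounded_linear S" and symS: "symmetric S"
    unfolding S_def using T sym by (simp_all add: symmetric_shift bounded_linear_shift)
  interpret S: bounded_linear S by fact
  define c where "c = Sup {c. \<forall>f. c * norm f \<le> norm (S f)}"
  let ?I = "{c. \<forall>f. c * norm f \<le> norm (S f)}"
  show ?thesis
  proof (cases "\<exists>f::'h. f \<noteq> 0")
    case False
    then have "f = 0" by blast
    then show ?thesis using S.zero by (simp add: S_def)
  next
    case True
    then obtain f0 :: 'h where f0: "f0 \<noteq> 0" by blast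
    have bdd: "bdd_above ?I"
      by (rule bdd_aboveI[of _ "norm (S f0) / norm f0"]) (use f0 in \<open>auto simp: pos_le_divide_eq\<close>)
    have bbS: "bounded_below S" using free[of z] r by (simp add: S_def[abs_def])
    then obtain c1 where c1: "0 < c1" "c1 \<in> ?I" by (auto simp: bounded_below_def)
    have cpos: "0 < c" using c1 cSup_upper[OF c1(2) bdd] by (simp add: c_def)
    have cI: "c * norm f \<le> norm (S f)" for f
    proof (cases "f = 0")
      case False
      have "c \<le> norm (S f) / norm f"
        unfolding c_def using c1 False by (intro cSup_least) (auto simp: pos_le_divide_eq)
      then show ?thesis using False by (simp add: pos_le_divide_eq)
    qed (simp add: S.zero)
    have "\<not> c < r"
    proof
      assume "c < r"
      then have b1: "bounded_below (\<lambda>f. S f - c *\<^sub>R f)" and b2: "bounded_below (\<lambda>f. S f + c *\<^sub>R f)"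
        using free[of "z + c"] free[of "z - c"] cpos
        by (simp_all add: S_def scaleR_add_left scaleR_diff_left diff_diff_eq diff_diff_eq2 diff_add_eq)
      have "bounded_below (\<lambda>f. S (S f) - (c\<^sup>2) *\<^sub>R f)"
        using bounded_below_compose[OF b1 b2]
        by (simp add: S.add S.scaleR scaleR_add_right power2_eq_square)
      then obtain b where b: "0 < b" "\<And>f. b * norm f \<le> norm (S (S f) - (c\<^sup>2) *\<^sub>R f)"
        by (auto simp: bounded_below_def)
      obtain K where K: "0 < K" "\<And>f. norm (S f) \<le> norm f * K" using S.pos_bounded by blast
      \<comment> \<open>The factor 1/2 makes the defect \<open>e \<parallel>f\<parallel>\<^sup>2\<close> smaller than \<open>(b \<parallel>v\<parallel>)\<^sup>2\<close>, a contradiction.\<close>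
      define e where "e = (b / K)\<^sup>2 / 2"
      have e: "0 < e" using b K by (simp add: e_def)
      have "sqrt (c\<^sup>2 + e) \<notin> ?I"
      proof
        assume "sqrt (c\<^sup>2 + e) \<in> ?I"
        then have "sqrt (c\<^sup>2 + e) \<le> c" unfolding c_def by (rule cSup_upper[OF _ bdd])
        moreover have "c < sqrt (c\<^sup>2 + e)" using e by (intro real_less_rsqrt) auto
        ultimately show False by simp
      qed
      then obtain f where f: "norm (S f) < sqrt (c\<^sup>2 + e) * norm f" by (auto simp: not_le)
      have fpos: "0 < norm f" using f by (cases "f = 0") (auto simp: S.zero)
      obtain v where v: "S v = f"
        using symmetric_bounded_below_imp_bij[OF S symS bbS] by (metis bij_is_surj surj_def)
      have "(b * norm v)\<^sup>2 \<le> (norm (S (S v) - (c\<^sup>2) *\<^sub>R v))\<^sup>2"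
        using b by (intro power_mono) auto
      also have "\<dots> = (norm (S f))\<^sup>2 - 2 * c\<^sup>2 * inner (S (S v)) v + (c\<^sup>2)\<^sup>2 * (norm v)\<^sup>2"
        unfolding norm_diff_scaleR_squared by (simp add: v inner_commute)
      also have "inner (S (S v)) v = (norm f)\<^sup>2"
        using symS v by (simp add: symmetric_def power2_norm_eq_inner)
      also have "(norm (S f))\<^sup>2 - 2 * c\<^sup>2 * (norm f)\<^sup>2 + (c\<^sup>2)\<^sup>2 * (norm v)\<^sup>2 \<le> e * (norm f)\<^sup>2"
      proof -
        have "(c * norm v)\<^sup>2 \<le> (norm f)\<^sup>2" using cI[of v] v cpos by (intro power_mono) auto
        then have "c\<^sup>2 * (c * norm v)\<^sup>2 \<le> c\<^sup>2 * (norm f)\<^sup>2" by (intro mult_left_mono) auto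
        then have "(c\<^sup>2)\<^sup>2 * (norm v)\<^sup>2 \<le> c\<^sup>2 * (norm f)\<^sup>2"
          by (simp add: power_mult_distrib power2_eq_square algebra_simps)
        moreover have "(norm (S f))\<^sup>2 \<le> (sqrt (c\<^sup>2 + e) * norm f)\<^sup>2"
          using f by (intro power_mono) auto
        then have "(norm (S f))\<^sup>2 \<le> (c\<^sup>2 + e) * (norm f)\<^sup>2"
          using e by (simp add: power_mult_distrib)
        ultimately show ?thesis by (simp add: algebra_simps)
      qed
      also have "e * (norm f)\<^sup>2 \<le> e * (norm v * K)\<^sup>2"
        using K(2)[of v] v e by (intro mult_left_mono power_mono) auto
      also have "\<dots> = (b * norm v)\<^sup>2 / 2"
        using K by (simp add: e_def power_mult_distrib field_simps)
      finally have "(b * norm v)\<^sup>2 \<le> 0" by simp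
      then have "v = 0" using b by simp
      then show False using v fpos by (simp add: S.zero)
    qed
    then have "r * norm f \<le> c * norm f" by (intro mult_right_mono) auto
    then show ?thesis using cI[of f] by (simp add: S_def)
  qed
qed

text \<open>Completing the square in the distance bound at \<open>\<plusminus>e/2\<close> shows that the forms of \<open>S\<^sup>2 - e S\<close> and
\<open>S\<^sup>2 + e S\<close> are nonnegative. Instead of multiplying these commuting operators, which would need square roots,
the first form is evaluated at \<open>(S\<^sup>2 + e S) h\<close> and the second at \<open>(S\<^sup>2 - e S) h\<close>; the sum is
\<open>2 (\<parallel>S\<^sup>3 h\<parallel>\<^sup>2 - e\<^sup>2 \<parallel>S\<^sup>2 h\<parallel>\<^sup>2)\<close>.\<close>

lemma spectral_gap_estimate:
  fixes S :: "'h::{real_inner,banach} \<Rightarrow> 'h"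
  assumes S: "bounded_linear S" and sym: "symmetric S"
    and e: "0 < e" and gap: "\<And>w. 0 < \<bar>w\<bar> \<Longrightarrow> \<bar>w\<bar> < e \<Longrightarrow> bounded_below (\<lambda>f. S f - w *\<^sub>R f)"
  shows "e * norm (S (S h)) \<le> norm (S (S (S h)))"
proof -
  interpret bounded_linear S by fact
  have half: "\<bar>s\<bar> = e \<Longrightarrow> s * inner (S f) f \<le> (norm (S f))\<^sup>2" for s f
  proof -
    assume s: "\<bar>s\<bar> = e"
    have "e / 2 * norm f \<le> norm (S f - (s / 2) *\<^sub>R f)"
    proof (rule norm_shift_ge_spectral_distance[OF S sym])
      show "bounded_below (\<lambda>f. S f - w *\<^sub>R f)" if "\<bar>w - s / 2\<bar> < e / 2" for w
        using that s e by (intro gap) (auto simp: abs_if split: if_splits)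
    qed (use e in auto)
    then have "(e / 2 * norm f)\<^sup>2 \<le> (norm (S f - (s / 2) *\<^sub>R f))\<^sup>2"
      using e by (intro power_mono) auto
    also have "\<dots> = (norm (S f))\<^sup>2 - s * inner (S f) f + (s / 2)\<^sup>2 * (norm f)\<^sup>2"
      unfolding norm_diff_scaleR_squared by (simp add: inner_commute)
    also have "(s / 2)\<^sup>2 * (norm f)\<^sup>2 = (e / 2 * norm f)\<^sup>2"
      using s by (auto simp: power_mult_distrib power2_eq_square)
    finally show ?thesis by simp
  qed
  define p q where "p = S (S h) - e *\<^sub>R S h" and "q = S (S h) + e *\<^sub>R S h"
  have sw: "inner (S f) g = inner f (S g)" for f g using sym by (simp add: symmetric_def)
  have "e * inner (S q) q \<le> (norm (S q))\<^sup>2" using half[of e q] e by simp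
  moreover have "- e * inner (S p) p \<le> (norm (S p))\<^sup>2" using half[of "-e" p] e by simp
  moreover have "(norm (S q))\<^sup>2 - e * inner (S q) q + ((norm (S p))\<^sup>2 + e * inner (S p) p)
     = 2 * ((norm (S (S (S h))))\<^sup>2 - e\<^sup>2 * (norm (S (S h)))\<^sup>2)"
  proof -
    define x y z where "x = S h" and "y = S (S h)" and "z = S (S (S h))"
    have Sq: "q = y + e *\<^sub>R x" "S q = z + e *\<^sub>R y" and Sp: "p = y - e *\<^sub>R x" "S p = z - e *\<^sub>R y"
      by (simp_all add: p_def q_def x_def y_def z_def add diff scaleR)
    have zx: "inner z x = inner y y" by (simp add: x_def y_def z_def sw)
    have "(norm (z + e *\<^sub>R y))\<^sup>2 - e * inner (z + e *\<^sub>R y) (y + e *\<^sub>R x)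
        + ((norm (z - e *\<^sub>R y))\<^sup>2 + e * inner (z - e *\<^sub>R y) (y - e *\<^sub>R x))
      = 2 * ((norm z)\<^sup>2 - e\<^sup>2 * (norm y)\<^sup>2)"
      unfolding power2_norm_eq_inner inner_add_left inner_add_right inner_diff_left inner_diff_right
        inner_scaleR_left inner_scaleR_right inner_commute[of y z] zx
      by (simp add: power2_eq_square algebra_simps)
    then show ?thesis unfolding Sq(2) Sp(2) unfolding Sq(1) Sp(1) unfolding y_def z_def .
  qed
  ultimately have "(e * norm (S (S h)))\<^sup>2 \<le> (norm (S (S (S h))))\<^sup>2"
    by (simp add: power_mult_distrib)
  then show ?thesis by (rule power2_le_imp_le) auto
qed

text \<open>If the spectrum of \<open>S\<close> has no points near 0 except possibly 0, an approximate solution of \<open>S g = 0\<close> is close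
to an exact one. The exact solution is the limit of the iterates \<open>(1 - S\<^sup>2/M)\<^sup>n g\<close>: their increments lie in the range
of \<open>S\<^sup>2\<close>, where the gap makes \<open>1 - S\<^sup>2/M\<close> a contraction.\<close>

lemma approximate_kernel:
  fixes S :: "'h::{real_inner,banach} \<Rightarrow> 'h"
  assumes S: "bounded_linear S" and sym: "symmetric S"
    and e: "0 < e" and gap: "\<And>w. 0 < \<bar>w\<bar> \<Longrightarrow> \<bar>w\<bar> < e \<Longrightarrow> bounded_below (\<lambda>f. S f - w *\<^sub>R f)"
  obtains D where "\<And>g. \<exists>k. S k = 0 \<and> norm (g - k) \<le> D * norm (S g)"
proof -
  interpret bounded_linear S by fact
  have sw: "inner (S f) g = inner f (S g)" for f g using sym by (simp add: symmetric_def)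
  obtain K0 where K0: "\<And>f. norm (S f) \<le> norm f * K0" using bounded by blast
  define K where "K = max K0 e"
  have K: "norm (S f) \<le> K * norm f" "0 < K" "e \<le> K" for f
    using K0[of f] e mult_left_mono[of K0 K "norm f"] by (auto simp: K_def mult.commute)
  define M where "M = K\<^sup>2"
  have M: "0 < M" using K by (simp add: M_def)
  define A where "A f = f - (1 / M) *\<^sub>R S (S f)" for f
  define q where "q = sqrt (1 - e\<^sup>2 / M)"
  have eM: "e\<^sup>2 / M \<le> 1" "0 < e\<^sup>2 / M"
    using e K by (auto simp: M_def power_mono divide_le_eq)
  have q: "0 \<le> q" "q < 1" "q\<^sup>2 = 1 - e\<^sup>2 / M"
    using eM by (auto simp: q_def)
  have contr: "norm (A (S (S h))) \<le> q * norm (S (S h))" for h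
  proof (rule power2_le_imp_le)
    let ?u = "S (S h)"
    have "(norm (A ?u))\<^sup>2 = (norm ?u)\<^sup>2 - 2 / M * inner (S (S ?u)) ?u + (norm (S (S ?u)))\<^sup>2 / M\<^sup>2"
      unfolding A_def norm_diff_scaleR_squared by (simp add: power_divide)
    also have "inner (S (S ?u)) ?u = (norm (S ?u))\<^sup>2" by (simp add: sw power2_norm_eq_inner)
    also have "(norm (S (S ?u)))\<^sup>2 / M\<^sup>2 \<le> (norm (S ?u))\<^sup>2 / M"
    proof -
      have "(norm (S (S ?u)))\<^sup>2 \<le> (K * norm (S ?u))\<^sup>2" using K by (intro power_mono) auto
      then show ?thesis using M by (simp add: M_def power_mult_distrib field_simps power2_eq_square)
    qed
    also have "(norm ?u)\<^sup>2 - 2 / M * (norm (S ?u))\<^sup>2 + (norm (S ?u))\<^sup>2 / M \<le> (q * norm ?u)\<^sup>2"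
    proof -
      have "(e * norm ?u)\<^sup>2 \<le> (norm (S ?u))\<^sup>2"
        using spectral_gap_estimate[OF S sym e gap] e by (intro power_mono) auto
      then have "(e * norm ?u)\<^sup>2 / M \<le> (norm (S ?u))\<^sup>2 / M" using M by (intro divide_right_mono) auto
      then show ?thesis using M by (simp add: power_mult_distrib q algebra_simps)
    qed
    finally show "(norm (A ?u))\<^sup>2 \<le> (q * norm ?u)\<^sup>2" by simp
  qed (use q in auto)
  have comm: "S (S (A f)) = A (S (S f))" for f by (simp add: A_def diff scaleR)
  have iter: "norm (S (S ((A ^^ n) g))) \<le> q ^ n * norm (S (S g))" for n g
  proof (induction n)
    case (Suc n)
    have "norm (S (S ((A ^^ Suc n) g))) \<le> q * norm (S (S ((A ^^ n) g)))"
      using contr[of "(A ^^ n) g"] by (simp add: comm)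
    also have "\<dots> \<le> q * (q ^ n * norm (S (S g)))" using Suc q by (intro mult_left_mono) auto
    finally show ?case by (simp add: mult.assoc)
  qed simp
  show ?thesis
  proof (rule that[of "K / M / (1 - q)"])
    fix g
    define u where "u n = (1 / M) *\<^sub>R S (S ((A ^^ n) g))" for n
    have un: "norm (u n) \<le> norm (S (S g)) / M * q ^ n" for n
      using iter[of n g] M by (simp add: u_def field_simps)
    have geo: "summable (\<lambda>n. norm (S (S g)) / M * q ^ n)"
      using q by (intro summable_mult summable_geometric) auto
    have sn: "summable (\<lambda>n. norm (u n))"
      by (rule summable_comparison_test[OF _ geo]) (use un in auto)
    have An: "(A ^^ n) g = g - (\<Sum>i<n. u i)" for n
    proof (induction n)
      case (Suc n)
      have "(A ^^ Suc n) g = (A ^^ n) g - u n" by (simp add: A_def u_def)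
      then show ?case by (simp add: Suc)
    qed simp
    define k where "k = g - suminf u"
    have lim: "(\<lambda>n. (A ^^ n) g) \<longlonglongrightarrow> k"
      unfolding An k_def by (intro tendsto_intros summable_LIMSEQ summable_norm_cancel[OF sn])
    have "(\<lambda>n. S (S ((A ^^ n) g))) \<longlonglongrightarrow> S (S k)"
      by (intro tendsto lim)
    moreover have "(\<lambda>n. S (S ((A ^^ n) g))) \<longlonglongrightarrow> 0"
    proof (rule Lim_null_comparison)
      show "\<forall>\<^sub>F n in sequentially. norm (S (S ((A ^^ n) g))) \<le> q ^ n * norm (S (S g))"
        using iter by simp
      show "(\<lambda>n. q ^ n * norm (S (S g))) \<longlonglongrightarrow> 0"
        using q by (intro tendsto_mult_left_zero LIMSEQ_power_zero) auto
    qed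
    ultimately have "S (S k) = 0" using LIMSEQ_unique by blast
    then have "inner (S k) (S k) = 0" by (simp add: sw)
    then have "S k = 0" by simp
    moreover have "norm (g - k) \<le> K / M / (1 - q) * norm (S g)"
    proof -
      have "norm (g - k) = norm (suminf u)" by (simp add: k_def)
      also have "\<dots> \<le> (\<Sum>n. norm (u n))" by (rule summable_norm[OF sn])
      also have "\<dots> \<le> (\<Sum>n. norm (S (S g)) / M * q ^ n)" by (rule suminf_le[OF un sn geo])
      also have "\<dots> = norm (S (S g)) / M / (1 - q)"
        using q by (subst suminf_mult) (auto simp: suminf_geometric summable_geometric)
      also have "\<dots> \<le> K * norm (S g) / M / (1 - q)"
        using K M q by (intro divide_right_mono) auto
      finally show ?thesis by simp
    qed
    ultimately show "\<exists>k. S k = 0 \<and> norm (g - k) \<le> K / M / (1 - q) * norm (S g)" by blast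
  qed
qed

section \<open>The Hilbert space of square-summable functions\<close>

text \<open>As a type, \<open>l2\<close> becomes an instance of the classes of real Hilbert spaces. The inner product is the real part
of the complex one; a complex-linear operator is symmetric for the one iff it is for the other.\<close>

typedef 'a ell2 = "l2 :: ('a \<Rightarrow> complex) set"
  morphisms coord Abs_ell2
  by (rule exI[of _ "\<lambda>_. 0"]) (simp add: l2_def)

lemma ell2_eqI: "(\<And>x. coord f x = coord g x) \<Longrightarrow> f = g"
  using coord_inject[of f g] by (auto intro: ext)

lemma coord_square_summable: "(\<lambda>x. (cmod (coord f x))\<^sup>2) summable_on A"
  using coord[of f] summable_on_subset_banach[of "\<lambda>x. (cmod (coord f x))\<^sup>2" UNIV A] by (simp add: l2_def)

lemma l2_bounded_sums:
  assumes "\<And>S. finite S \<Longrightarrow> (\<Sum>x\<in>S. (cmod (f x))\<^sup>2) \<le> K"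
  shows "f \<in> l2"
  unfolding l2_def mem_Collect_eq
  by (rule nonneg_bdd_above_summable_on) (use assms in \<open>auto intro!: bdd_aboveI[of _ K]\<close>)

lemma l2_dominated:
  assumes "f \<in> l2" "g \<in> l2" "\<And>x. (cmod (h x))\<^sup>2 \<le> a * (cmod (f x))\<^sup>2 + b * (cmod (g x))\<^sup>2"
  shows "h \<in> l2"
proof -
  have "(\<lambda>x. a * (cmod (f x))\<^sup>2 + b * (cmod (g x))\<^sup>2) summable_on UNIV"
    using assms(1,2) by (intro summable_on_add summable_on_cmult_right) (auto simp: l2_def)
  then have "(\<lambda>x. (cmod (h x))\<^sup>2) summable_on UNIV"
    by (rule summable_on_comparison_test) (use assms(3) in auto)
  then show ?thesis by (simp add: l2_def)
qed

lemma cmod_add_squared_le: "(cmod (a + b))\<^sup>2 \<le> 2 * (cmod a)\<^sup>2 + 2 * (cmod b)\<^sup>2"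
proof -
  have "(cmod (a + b))\<^sup>2 \<le> (cmod a + cmod b)\<^sup>2" by (intro power_mono norm_triangle_ineq) auto
  also have "\<dots> \<le> 2 * (cmod a)\<^sup>2 + 2 * (cmod b)\<^sup>2"
    using sum_squares_bound[of "cmod a" "cmod b"] by (simp add: power2_sum)
  finally show ?thesis .
qed

lemma l2_add: "f \<in> l2 \<Longrightarrow> g \<in> l2 \<Longrightarrow> (\<lambda>x. f x + g x) \<in> l2"
  by (rule l2_dominated[of f g _ 2 2]) (auto simp: cmod_add_squared_le)

lemma l2_cmult: "f \<in> l2 \<Longrightarrow> (\<lambda>x. c * f x) \<in> l2"
  by (rule l2_dominated[of f f _ "(cmod c)\<^sup>2" 0]) (auto simp: norm_mult power_mult_distrib)

lemma l2_dominated_by: "f \<in> l2 \<Longrightarrow> (\<And>x. cmod (h x) \<le> cmod (f x)) \<Longrightarrow> h \<in> l2"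
  by (rule l2_dominated[of f f _ 1 0]) (auto intro: power_mono)

instantiation ell2 :: (type) real_inner
begin

definition zero_ell2 :: "'a ell2" where "zero_ell2 = Abs_ell2 (\<lambda>_. 0)"
definition plus_ell2 :: "'a ell2 \<Rightarrow> 'a ell2 \<Rightarrow> 'a ell2" where
  "plus_ell2 f g = Abs_ell2 (\<lambda>x. coord f x + coord g x)"
definition uminus_ell2 :: "'a ell2 \<Rightarrow> 'a ell2" where "uminus_ell2 f = Abs_ell2 (\<lambda>x. - coord f x)"
definition minus_ell2 :: "'a ell2 \<Rightarrow> 'a ell2 \<Rightarrow> 'a ell2" where
  "minus_ell2 f g = Abs_ell2 (\<lambda>x. coord f x - coord g x)"
definition scaleR_ell2 :: "real \<Rightarrow> 'a ell2 \<Rightarrow> 'a ell2" where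
  "scaleR_ell2 r f = Abs_ell2 (\<lambda>x. r *\<^sub>R coord f x)"
definition inner_ell2 :: "'a ell2 \<Rightarrow> 'a ell2 \<Rightarrow> real" where
  "inner_ell2 f g = (\<Sum>\<^sub>\<infinity>x. inner (coord f x) (coord g x))"
definition norm_ell2 :: "'a ell2 \<Rightarrow> real" where "norm_ell2 f = sqrt (inner f f)"
definition dist_ell2 :: "'a ell2 \<Rightarrow> 'a ell2 \<Rightarrow> real" where "dist_ell2 f g = norm (f - g)"
definition sgn_ell2 :: "'a ell2 \<Rightarrow> 'a ell2" where "sgn_ell2 f = scaleR (inverse (norm f)) f"
definition uniformity_ell2 :: "('a ell2 \<times> 'a ell2) filter" where
  "uniformity_ell2 = (INF e\<in>{0<..}. principal {(x, y). dist x y < e})"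
definition open_ell2 :: "'a ell2 set \<Rightarrow> bool" where
  "open_ell2 U \<longleftrightarrow> (\<forall>x\<in>U. \<forall>\<^sub>F (x', y) in uniformity. x' = x \<longrightarrow> y \<in> U)"

lemma coord_zero: "coord 0 x = 0"
  by (simp add: zero_ell2_def Abs_ell2_inverse l2_def)

lemma coord_add: "coord (f + g) x = coord f x + coord g x"
  by (simp add: plus_ell2_def Abs_ell2_inverse l2_add coord)

lemma coord_minus: "coord (- f) x = - coord f x"
  using l2_cmult[OF coord, of "-1" f] by (simp add: uminus_ell2_def Abs_ell2_inverse)

lemma coord_diff: "coord (f - g) x = coord f x - coord g x"
  using l2_add[OF coord l2_cmult[OF coord, of "-1"], of f g] by (simp add: minus_ell2_def Abs_ell2_inverse)

lemma coord_scaleR: "coord (r *\<^sub>R f) x = r *\<^sub>R coord f x"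
  using l2_cmult[OF coord, of "of_real r" f] by (simp add: scaleR_ell2_def Abs_ell2_inverse scaleR_conv_of_real)

lemma inner_coord_abs_summable: "(\<lambda>x. norm (inner (coord f x) (coord g x))) summable_on UNIV"
proof (rule summable_on_comparison_test)
  show "(\<lambda>x. (cmod (coord f x))\<^sup>2 + (cmod (coord g x))\<^sup>2) summable_on UNIV"
    by (intro summable_on_add coord_square_summable)
  show "norm (inner (coord f x) (coord g x)) \<le> (cmod (coord f x))\<^sup>2 + (cmod (coord g x))\<^sup>2" for x
  proof -
    have "norm (inner (coord f x) (coord g x)) \<le> cmod (coord f x) * cmod (coord g x)"
      using Cauchy_Schwarz_ineq2[of "coord f x" "coord g x"] by simp
    also have "\<dots> \<le> (cmod (coord f x))\<^sup>2 + (cmod (coord g x))\<^sup>2"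
      using sum_squares_bound[of "cmod (coord f x)" "cmod (coord g x)"]
        mult_nonneg_nonneg[OF norm_ge_zero norm_ge_zero, of "coord f x" "coord g x"] by linarith
    finally show ?thesis .
  qed
qed auto

lemma inner_coord_summable: "(\<lambda>x. inner (coord f x) (coord g x)) summable_on UNIV"
  by (rule abs_summable_summable[OF inner_coord_abs_summable])

instance
proof
  fix f g h :: "'a ell2" and r s :: real
  show "f + g + h = f + (g + h)" "f + g = g + f" "0 + f = f" "- f + f = 0" "f - g = f + - g"
    "r *\<^sub>R (f + g) = r *\<^sub>R f + r *\<^sub>R g" "(r + s) *\<^sub>R f = r *\<^sub>R f + s *\<^sub>R f"
    "r *\<^sub>R s *\<^sub>R f = (r * s) *\<^sub>R f" "1 *\<^sub>R f = f"
    by (rule ell2_eqI; simp add: coord_zero coord_add coord_minus coord_diff coord_scaleR algebra_simps)+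
  show "dist f g = norm (f - g)" by (rule dist_ell2_def)
  show "sgn f = scaleR (inverse (norm f)) f" by (rule sgn_ell2_def)
  show "(uniformity :: ('a ell2 \<times> 'a ell2) filter) = (INF e\<in>{0<..}. principal {(x, y). dist x y < e})"
    by (rule uniformity_ell2_def)
  show "open U \<longleftrightarrow> (\<forall>x\<in>U. \<forall>\<^sub>F (x', y) in uniformity. x' = x \<longrightarrow> y \<in> U)" for U :: "'a ell2 set"
    by (rule open_ell2_def)
  show "inner f g = inner g f" by (simp add: inner_ell2_def inner_commute)
  show "inner (f + g) h = inner f h + inner g h"
    by (simp add: inner_ell2_def coord_add inner_add_left infsum_add inner_coord_summable)
  show "inner (r *\<^sub>R f) g = r * inner f g"
    by (simp add: inner_ell2_def coord_scaleR infsum_cmult_right inner_coord_summable)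
  show "0 \<le> inner f f" by (simp add: inner_ell2_def infsum_nonneg)
  show "inner f f = 0 \<longleftrightarrow> f = 0"
  proof
    assume "inner f f = 0"
    then have "inner (coord f x) (coord f x) = 0" for x
      using nonneg_infsum_le_0D[of "\<lambda>x. inner (coord f x) (coord f x)" UNIV x] inner_coord_summable[of f f]
      by (simp add: inner_ell2_def)
    then show "f = 0" by (intro ell2_eqI) (simp add: coord_zero)
  qed (simp add: inner_ell2_def coord_zero)
  show "norm f = sqrt (inner f f)" by (rule norm_ell2_def)
qed

end

lemmas coord_simps = coord_zero coord_add coord_minus coord_diff coord_scaleR

lemma norm_ell2_squared: "(norm f)\<^sup>2 = (\<Sum>\<^sub>\<infinity>x. (cmod (coord f x))\<^sup>2)"
  by (simp add: power2_norm_eq_inner inner_ell2_def)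

lemma l2_norm_coord: "l2_norm (coord f) = norm f"
  by (simp add: l2_norm_def flip: norm_ell2_squared)

lemma sum_coord_squared_le: "finite S \<Longrightarrow> (\<Sum>x\<in>S. (cmod (coord f x))\<^sup>2) \<le> (norm f)\<^sup>2"
  unfolding norm_ell2_squared by (rule finite_sum_le_infsum) (auto intro: coord_square_summable)

lemma cmod_coord_le: "cmod (coord f x) \<le> norm f"
  using sum_coord_squared_le[of "{x}" f] by (simp add: power2_le_iff_abs_le)

lemma norm_ell2_leI:
  assumes "\<And>S. finite S \<Longrightarrow> (\<Sum>x\<in>S. (cmod (coord f x))\<^sup>2) \<le> K\<^sup>2" "0 \<le> K"
  shows "norm f \<le> K"
proof -
  have "(norm f)\<^sup>2 \<le> K\<^sup>2"
    unfolding norm_ell2_squared by (rule infsum_le_finite_sums[OF coord_square_summable]) (use assms in auto)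
  then show ?thesis using assms(2) by (rule power2_le_imp_le)
qed

lemma norm_ell2_mono:
  assumes "\<And>x. cmod (coord f x) \<le> cmod (coord g x)"
  shows "norm f \<le> norm g"
proof (rule norm_ell2_leI)
  fix S :: "'a set" assume S: "finite S"
  have "(\<Sum>x\<in>S. (cmod (coord f x))\<^sup>2) \<le> (\<Sum>x\<in>S. (cmod (coord g x))\<^sup>2)"
    using assms by (intro sum_mono power_mono) auto
  then show "(\<Sum>x\<in>S. (cmod (coord f x))\<^sup>2) \<le> (norm g)\<^sup>2" using sum_coord_squared_le[OF S, of g] by simp
qed simp

lemma bounded_linear_coord: "bounded_linear (\<lambda>f. coord f x)"
  by (rule bounded_linear_intro[where K = 1]) (auto simp: coord_simps cmod_coord_le)

lemma coord_sum: "coord (\<Sum>i\<in>I. f i) x = (\<Sum>i\<in>I. coord (f i) x)"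
  using linear_sum[OF bounded_linear.linear[OF bounded_linear_coord, of x], of f I] by simp

instance ell2 :: (type) banach
proof
  fix X :: "nat \<Rightarrow> 'a ell2"
  assume X: "Cauchy X"
  have "Cauchy (\<lambda>n. coord (X n) x)" for x
    by (rule bounded_linear.Cauchy[OF bounded_linear_coord X])
  then have "\<exists>l. (\<lambda>n. coord (X n) x) \<longlonglongrightarrow> l" for x
    using Cauchy_convergent convergent_def by blast
  then obtain f where f: "\<And>x. (\<lambda>n. coord (X n) x) \<longlonglongrightarrow> f x" by metis
  obtain K where K: "\<And>n. norm (X n) \<le> K"
    using cauchy_imp_bounded[OF X] by (auto simp: bounded_iff)
  have "f \<in> l2"
  proof (rule l2_bounded_sums)
    fix S :: "'a set" assume S: "finite S"
    have "(\<lambda>n. \<Sum>x\<in>S. (cmod (coord (X n) x))\<^sup>2) \<longlonglongrightarrow> (\<Sum>x\<in>S. (cmod (f x))\<^sup>2)"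
      by (intro tendsto_intros f)
    then show "(\<Sum>x\<in>S. (cmod (f x))\<^sup>2) \<le> K\<^sup>2"
    proof (rule LIMSEQ_le_const2, intro exI allI impI)
      fix n
      have "(norm (X n))\<^sup>2 \<le> K\<^sup>2" using K by (intro power_mono) auto
      then show "(\<Sum>x\<in>S. (cmod (coord (X n) x))\<^sup>2) \<le> K\<^sup>2"
        using sum_coord_squared_le[OF S, of "X n"] by simp
    qed
  qed
  then obtain F where F: "coord F = f" by (metis Abs_ell2_inverse)
  have "X \<longlonglongrightarrow> F"
  proof (rule metric_LIMSEQ_I)
    fix e :: real assume e: "0 < e"
    obtain N where N: "\<And>m n. m \<ge> N \<Longrightarrow> n \<ge> N \<Longrightarrow> dist (X m) (X n) < e / 2"
      using X e unfolding Cauchy_def by (meson half_gt_zero)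
    have "norm (X m - F) \<le> e / 2" if m: "m \<ge> N" for m
    proof (rule norm_ell2_leI)
      fix S :: "'a set" assume S: "finite S"
      have "(\<lambda>n. \<Sum>x\<in>S. (cmod (coord (X m) x - coord (X n) x))\<^sup>2)
          \<longlonglongrightarrow> (\<Sum>x\<in>S. (cmod (coord (X m) x - f x))\<^sup>2)"
        by (intro tendsto_intros f)
      moreover have "(\<Sum>x\<in>S. (cmod (coord (X m) x - coord (X n) x))\<^sup>2) \<le> (e / 2)\<^sup>2" if "n \<ge> N" for n
      proof -
        have "(norm (X m - X n))\<^sup>2 \<le> (e / 2)\<^sup>2"
          using N[OF m that] by (intro power_mono) (auto simp: dist_norm)
        then show ?thesis using sum_coord_squared_le[OF S, of "X m - X n"] by (simp add: coord_diff)
      qed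
      ultimately have "(\<Sum>x\<in>S. (cmod (coord (X m) x - f x))\<^sup>2) \<le> (e / 2)\<^sup>2"
        by (intro LIMSEQ_le_const2) auto
      then show "(\<Sum>x\<in>S. (cmod (coord (X m - F) x))\<^sup>2) \<le> (e / 2)\<^sup>2" by (simp add: coord_diff F)
    qed (use e in auto)
    then show "\<exists>N. \<forall>n\<ge>N. dist (X n) F < e"
      using e by (intro exI[of _ N]) (force simp: dist_norm)
  qed
  then show "convergent X" by (auto simp: convergent_def)
qed

definition cscale :: "complex \<Rightarrow> 'a ell2 \<Rightarrow> 'a ell2" where
  "cscale c f = Abs_ell2 (\<lambda>x. c * coord f x)"

lemma coord_cscale: "coord (cscale c f) x = c * coord f x"
  by (simp add: cscale_def Abs_ell2_inverse l2_cmult coord)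

lemma cscale_of_real: "cscale (of_real r) f = r *\<^sub>R f"
  by (rule ell2_eqI) (simp add: coord_simps coord_cscale scaleR_conv_of_real)

lemma norm_cscale: "norm (cscale c f) = cmod c * norm f"
proof -
  have "(norm (cscale c f))\<^sup>2 = (cmod c * norm f)\<^sup>2"
    unfolding norm_ell2_squared power_mult_distrib
    by (simp add: coord_cscale norm_mult power_mult_distrib infsum_cmult_right')
  then show ?thesis by (simp add: power2_eq_iff_nonneg)
qed

lemma bounded_linear_cscale: "bounded_linear (cscale c)"
  by (rule bounded_linear_intro[where K = "cmod c"])
    (auto intro!: ell2_eqI simp: coord_simps coord_cscale norm_cscale algebra_simps)

definition delta :: "'a \<Rightarrow> 'a ell2" where
  "delta a = Abs_ell2 (\<lambda>x. if x = a then 1 else 0)"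

definition restrict_to :: "'a set \<Rightarrow> 'a ell2 \<Rightarrow> 'a ell2" where
  "restrict_to A f = Abs_ell2 (\<lambda>x. if x \<in> A then coord f x else 0)"

lemma coord_restrict_to: "coord (restrict_to A f) x = (if x \<in> A then coord f x else 0)"
  unfolding restrict_to_def by (subst Abs_ell2_inverse) (auto intro!: l2_dominated_by[OF coord[of f]])

lemma coord_delta: "coord (delta a) x = (if x = a then 1 else 0)"
proof -
  have "(\<lambda>x. if x = a then 1 else 0 :: complex) \<in> l2"
    unfolding l2_def mem_Collect_eq
    by (rule finite_nonzero_values_imp_summable_on) (rule finite_subset[of _ "{a}"], auto)
  then show ?thesis by (simp add: delta_def Abs_ell2_inverse)
qed

text \<open>The partial sums truncate \<open>f\<close> to finite sets. Applied under a bounded operator, the expansion gives the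
operator its integral kernel.\<close>

lemma delta_expansion: "((\<lambda>y. cscale (coord f y) (delta y)) has_sum f) UNIV"
proof -
  have part: "(\<Sum>y\<in>S. cscale (coord f y) (delta y)) = restrict_to S f" if "finite S" for S
    by (rule ell2_eqI) (simp add: coord_sum coord_cscale coord_delta coord_restrict_to that if_distrib[of "(*) _"] cong: if_cong)
  have nrm: "(norm (f - restrict_to S f))\<^sup>2 = (norm f)\<^sup>2 - (\<Sum>y\<in>S. (cmod (coord f y))\<^sup>2)" if "finite S" for S
  proof -
    have "(norm (f - restrict_to S f))\<^sup>2 = (\<Sum>\<^sub>\<infinity>y\<in>-S. (cmod (coord f y))\<^sup>2)"
      unfolding norm_ell2_squared
      by (rule infsum_cong_neutral) (auto simp: coord_simps coord_restrict_to)
    moreover have "(norm f)\<^sup>2 = (\<Sum>\<^sub>\<infinity>y\<in>S \<union> -S. (cmod (coord f y))\<^sup>2)"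
      by (simp add: norm_ell2_squared)
    moreover have "\<dots> = (\<Sum>\<^sub>\<infinity>y\<in>S. (cmod (coord f y))\<^sup>2) + (\<Sum>\<^sub>\<infinity>y\<in>-S. (cmod (coord f y))\<^sup>2)"
      by (rule infsum_Un_disjoint) (auto intro: coord_square_summable)
    ultimately show ?thesis using that by simp
  qed
  let ?F = "finite_subsets_at_top UNIV" and ?d = "\<lambda>S. (norm f)\<^sup>2 - (\<Sum>y\<in>S. (cmod (coord f y))\<^sup>2)"
  have "((\<lambda>y. (cmod (coord f y))\<^sup>2) has_sum (norm f)\<^sup>2) UNIV"
    unfolding norm_ell2_squared by (rule has_sum_infsum) (rule coord_square_summable)
  then have "(?d \<longlongrightarrow> (norm f)\<^sup>2 - (norm f)\<^sup>2) ?F"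
    unfolding has_sum_def by (intro tendsto_intros)
  then have "(?d \<longlongrightarrow> 0) ?F" by simp
  then have "((\<lambda>S. sqrt (?d S)) \<longlongrightarrow> 0) ?F"
    using tendsto_real_sqrt by fastforce
  then have "((\<lambda>S. norm ((\<Sum>y\<in>S. cscale (coord f y) (delta y)) - f)) \<longlongrightarrow> 0) ?F"
  proof (rule Lim_transform_eventually)
    show "\<forall>\<^sub>F S in ?F. sqrt (?d S)
        = norm ((\<Sum>y\<in>S. cscale (coord f y) (delta y)) - f)"
    proof (rule eventually_finite_subsets_at_top_weakI)
      fix S :: "'a set" assume S: "finite S"
      show "sqrt (?d S) = norm ((\<Sum>y\<in>S. cscale (coord f y) (delta y)) - f)"
        unfolding part[OF S] nrm[OF S, symmetric] by (simp add: norm_minus_commute)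
    qed
  qed
  then show ?thesis
    unfolding has_sum_def by (subst LIM_zero_iff[symmetric]) (rule tendsto_norm_zero_cancel)
qed

lemma inner_delta: "inner f (delta a) = Re (coord f a)"
proof -
  have "inner f (delta a) = (\<Sum>\<^sub>\<infinity>x\<in>{a}. inner (coord f x) (coord (delta a) x))"
    unfolding inner_ell2_def by (rule infsum_cong_neutral) (auto simp: coord_delta)
  then show ?thesis by (simp add: coord_delta inner_complex_def)
qed

lemma norm_delta: "norm (delta a) = 1"
proof -
  have "(norm (delta a))\<^sup>2 = 1" unfolding power2_norm_eq_inner inner_delta by (simp add: coord_delta)
  then show ?thesis using power2_eq_iff_nonneg[of "norm (delta a)" 1] by simp
qed

text \<open>The Cauchy-Schwarz inequality with weight \<open>\<bar>k\<bar>\<close> bounds the square of the inner sum, and after exchanging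
the sums the row bound is used again, now for columns. All this is done for finite sets, so that
only the inner sum needs a limit.\<close>

lemma Schur_test:
  fixes k :: "'a \<Rightarrow> 'a \<Rightarrow> real"
  assumes row: "\<And>x S. finite S \<Longrightarrow> (\<Sum>y\<in>S. \<bar>k x y\<bar>) \<le> \<kappa>"
    and sym: "\<And>x y. k x y = k y x"
  shows "(\<lambda>y. of_real (k x y) * coord f y) summable_on UNIV"
    and "\<exists>g. norm g \<le> \<kappa> * norm f \<and> (\<forall>x. coord g x = (\<Sum>\<^sub>\<infinity>y. of_real (k x y) * coord f y))"
proof -
  have \<kappa>: "0 \<le> \<kappa>" using row[of "{}"] by simp
  let ?m = "\<lambda>x Y. \<Sum>y\<in>Y. \<bar>k x y\<bar> * cmod (coord f y)" and ?h = "\<lambda>x Y. \<Sum>y\<in>Y. of_real (k x y) * coord f y"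
  have CS: "(?m x Y)\<^sup>2 \<le> \<kappa> * (\<Sum>y\<in>Y. \<bar>k x y\<bar> * (cmod (coord f y))\<^sup>2)"
    if "finite Y" for x Y
  proof -
    have "(?m x Y)\<^sup>2
        = (\<Sum>y\<in>Y. sqrt \<bar>k x y\<bar> * (sqrt \<bar>k x y\<bar> * cmod (coord f y)))\<^sup>2"
      by (simp add: mult.assoc[symmetric, of "sqrt _" "sqrt _"])
    also have "\<dots> \<le> (\<Sum>y\<in>Y. (sqrt \<bar>k x y\<bar>)\<^sup>2) * (\<Sum>y\<in>Y. (sqrt \<bar>k x y\<bar> * cmod (coord f y))\<^sup>2)"
      by (rule Cauchy_Schwarz_ineq_sum)
    also have "\<dots> \<le> \<kappa> * (\<Sum>y\<in>Y. \<bar>k x y\<bar> * (cmod (coord f y))\<^sup>2)"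
      using row[OF that, of x] by (simp add: power_mult_distrib mult_right_mono sum_nonneg)
    finally show ?thesis .
  qed
  have fin: "(\<Sum>x\<in>X. (?m x Y)\<^sup>2) \<le> (\<kappa> * norm f)\<^sup>2"
    if X: "finite X" and Y: "finite Y" for X Y
  proof -
    have "(\<Sum>x\<in>X. (?m x Y)\<^sup>2)
        \<le> (\<Sum>x\<in>X. \<kappa> * (\<Sum>y\<in>Y. \<bar>k x y\<bar> * (cmod (coord f y))\<^sup>2))"
      by (intro sum_mono CS Y)
    also have "\<dots> = \<kappa> * (\<Sum>y\<in>Y. (\<Sum>x\<in>X. \<bar>k y x\<bar>) * (cmod (coord f y))\<^sup>2)"
    proof -
      have "(\<Sum>x\<in>X. \<Sum>y\<in>Y. \<bar>k x y\<bar> * (cmod (coord f y))\<^sup>2)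
          = (\<Sum>y\<in>Y. \<Sum>x\<in>X. \<bar>k y x\<bar> * (cmod (coord f y))\<^sup>2)"
        by (subst sum.swap, subst sym, rule refl)
      then show ?thesis by (simp add: sum_distrib_left[symmetric] sum_distrib_right[symmetric])
    qed
    also have "\<dots> \<le> \<kappa> * (\<Sum>y\<in>Y. \<kappa> * (cmod (coord f y))\<^sup>2)"
      using \<kappa> row[OF X] by (intro mult_left_mono sum_mono mult_right_mono) auto
    also have "\<dots> = \<kappa>\<^sup>2 * (\<Sum>y\<in>Y. (cmod (coord f y))\<^sup>2)"
      by (simp add: sum_distrib_left[symmetric] power2_eq_square)
    also have "\<dots> \<le> \<kappa>\<^sup>2 * (norm f)\<^sup>2" by (intro mult_left_mono sum_coord_squared_le Y) auto
    finally show ?thesis by (simp add: power_mult_distrib)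
  qed
  have "(\<lambda>y. norm (of_real (k x y) * coord f y)) summable_on UNIV" for x
  proof (rule nonneg_bdd_above_summable_on)
    have "(?m x Y) \<le> \<kappa> * norm f" if "finite Y" for Y
      
      by (rule power2_le_imp_le) (use fin[of "{x}" Y] that \<kappa> in auto)
    then show "bdd_above (sum (\<lambda>y. norm (of_real (k x y) * coord f y)) ` {F. F \<subseteq> UNIV \<and> finite F})"
      by (intro bdd_aboveI[of _ "\<kappa> * norm f"]) (auto simp: norm_mult)
  qed auto
  then have sm: "(\<lambda>y. of_real (k x y) * coord f y) summable_on UNIV" for x
    by (rule abs_summable_summable)
  then show "(\<lambda>y. of_real (k x y) * coord f y) summable_on UNIV" .
  define h where "h x = (\<Sum>\<^sub>\<infinity>y. of_real (k x y) * coord f y)" for x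
  have hs: "(\<Sum>x\<in>X. (cmod (h x))\<^sup>2) \<le> (\<kappa> * norm f)\<^sup>2" if X: "finite X" for X
  proof -
    have "((\<lambda>Y. \<Sum>x\<in>X. (cmod (?h x Y))\<^sup>2) \<longlongrightarrow> (\<Sum>x\<in>X. (cmod (h x))\<^sup>2))
        (finite_subsets_at_top UNIV)"
      unfolding h_def by (intro tendsto_intros infsum_tendsto sm)
    then show ?thesis
    proof (rule tendsto_upperbound)
      show "\<forall>\<^sub>F Y in finite_subsets_at_top UNIV. (\<Sum>x\<in>X. (cmod (?h x Y))\<^sup>2) \<le> (\<kappa> * norm f)\<^sup>2"
      proof (rule eventually_finite_subsets_at_top_weakI)
        fix Y :: "'a set" assume Y: "finite Y"
        have "cmod (?h x Y) \<le> (?m x Y)" for x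
          by (rule order_trans[OF norm_sum]) (simp add: norm_mult)
        then have "(\<Sum>x\<in>X. (cmod (?h x Y))\<^sup>2)
            \<le> (\<Sum>x\<in>X. (?m x Y)\<^sup>2)"
          by (intro sum_mono power_mono) auto
        then show "(\<Sum>x\<in>X. (cmod (?h x Y))\<^sup>2) \<le> (\<kappa> * norm f)\<^sup>2"
          using fin[OF X Y] by simp
      qed
    qed simp
  qed
  then have "h \<in> l2" by (rule l2_bounded_sums)
  then obtain g where g: "coord g = h" by (metis Abs_ell2_inverse)
  have "norm g \<le> \<kappa> * norm f" by (rule norm_ell2_leI) (use hs g \<kappa> in auto)
  moreover have "coord g x = (\<Sum>\<^sub>\<infinity>y. of_real (k x y) * coord f y)" for x
    by (simp add: g h_def)
  ultimately show "\<exists>g. norm g \<le> \<kappa> * norm f \<and> (\<forall>x. coord g x = (\<Sum>\<^sub>\<infinity>y. of_real (k x y) * coord f y))"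
    by blast
qed

section \<open>Spectrum of a self-adjoint operator on square-summable functions\<close>

text \<open>The \<open>e x\<close> reproduce the elements of \<open>E\<close> from their values on \<open>F\<close>. One point is eliminated at a time, by means
of an \<open>f0\<close> that does not vanish there. Since the \<open>e x\<close> lie in \<open>E\<close>, they also
control norms in \<open>E\<close> by finitely many values.\<close>

lemma determined_on_finite_imp_spanned:
  fixes E :: "('a \<Rightarrow> complex) set"
  assumes "finite F" and zero: "(\<lambda>_. 0) \<in> E"
    and closed: "\<And>f g c. f \<in> E \<Longrightarrow> g \<in> E \<Longrightarrow> (\<lambda>z. f z + c * g z) \<in> E"
    and determined: "\<And>f. f \<in> E \<Longrightarrow> \<forall>x\<in>F. f x = 0 \<Longrightarrow> f = (\<lambda>_. 0)"
  shows "\<exists>e. (\<forall>x\<in>F. e x \<in> E) \<and> (\<forall>f\<in>E. f = (\<lambda>z. \<Sum>x\<in>F. f x * e x z))"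
  using assms
proof (induction F arbitrary: E rule: finite_induct)
    case empty
    then show ?case by simp
  next
    case (insert x F)
    note closed = insert.prems(2)
    show ?case
    proof (cases "\<exists>f\<in>E. f x \<noteq> 0")
      case False
      have "\<exists>e. (\<forall>y\<in>F. e y \<in> E) \<and> (\<forall>f\<in>E. f = (\<lambda>z. \<Sum>y\<in>F. f y * e y z))"
      proof (rule insert.IH[OF insert.prems(1) closed])
        fix f assume "f \<in> E" "\<forall>y\<in>F. f y = 0"
        then show "f = (\<lambda>_. 0)" using insert.prems(3)[of f] False by blast
      qed
      then obtain e where e: "\<forall>y\<in>F. e y \<in> E" "\<forall>f\<in>E. f = (\<lambda>z. \<Sum>y\<in>F. f y * e y z)" by blast
      have "f = (\<lambda>z. \<Sum>y\<in>insert x F. f y * (e(x := \<lambda>_. 0)) y z)" if "f \<in> E" for f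
      proof -
        have "f = (\<lambda>z. \<Sum>y\<in>F. f y * e y z)" using e that by blast
        also have "\<dots> = (\<lambda>z. \<Sum>y\<in>insert x F. f y * (e(x := \<lambda>_. 0)) y z)"
          using insert.hyps by (auto intro!: ext sum.cong)
        finally show ?thesis .
      qed
      moreover have "\<forall>y\<in>insert x F. (e(x := \<lambda>_. 0)) y \<in> E" using e(1) insert.prems(1) by simp
      ultimately show ?thesis by blast
    next
      case True
      then obtain f0 where f0: "f0 \<in> E" "f0 x \<noteq> 0" by blast
      have "\<exists>e. (\<forall>y\<in>F. e y \<in> {f \<in> E. f x = 0}) \<and> (\<forall>f\<in>{f \<in> E. f x = 0}. f = (\<lambda>z. \<Sum>y\<in>F. f y * e y z))"
      proof (rule insert.IH)
        show "(\<lambda>_. 0) \<in> {f \<in> E. f x = 0}" using insert.prems(1) by simp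
        show "(\<lambda>z. f z + c * g z) \<in> {f \<in> E. f x = 0}"
          if "f \<in> {f \<in> E. f x = 0}" "g \<in> {f \<in> E. f x = 0}" for f g c
          using that closed by simp
        show "f = (\<lambda>_. 0)" if "f \<in> {f \<in> E. f x = 0}" "\<forall>y\<in>F. f y = 0" for f
          using that insert.prems(3)[of f] by blast
      qed
      then obtain e where e: "\<forall>y\<in>F. e y \<in> E" "\<forall>f\<in>E. f x = 0 \<longrightarrow> f = (\<lambda>z. \<Sum>y\<in>F. f y * e y z)"
        by blast
      define e1 where "e1 z = (f0 z - (\<Sum>y\<in>F. f0 y * e y z)) / f0 x" for z
      have comb: "(\<lambda>z. g z + (\<Sum>y\<in>G. a y * e y z)) \<in> E" if "finite G" "G \<subseteq> F" "g \<in> E" for g a G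
        using that
      proof (induction G rule: finite_induct)
        case (insert y G)
        then show ?case
          using closed[of "\<lambda>z. g z + (\<Sum>y\<in>G. a y * e y z)" "e y" "a y"] e(1) by (simp add: algebra_simps)
      qed simp
      have "(\<lambda>z. f0 z + (\<Sum>y\<in>F. - f0 y * e y z)) \<in> E"
        by (rule comb[OF insert.hyps(1) subset_refl f0(1)])
      then have "(\<lambda>z. 0 + 1 / f0 x * (f0 z + (\<Sum>y\<in>F. - f0 y * e y z))) \<in> E"
        by (rule closed[OF insert.prems(1)])
      then have e1: "e1 \<in> E"
        by (simp add: e1_def[abs_def] sum_negf divide_inverse mult.commute)
      have "f = (\<lambda>z. \<Sum>y\<in>insert x F. f y * (e(x := e1)) y z)" if f: "f \<in> E" for f
      proof
        fix z
        define r where "r = f x / f0 x"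
        define g where "g z = f z + (- r) * f0 z" for z
        have "g \<in> E" unfolding g_def by (rule closed[OF f f0(1)])
        moreover have "g x = 0" using f0 by (simp add: g_def r_def)
        ultimately have "g = (\<lambda>z. \<Sum>y\<in>F. g y * e y z)" using e by blast
        then have "g z = (\<Sum>y\<in>F. g y * e y z)" by (rule fun_cong)
        moreover have "(\<Sum>y\<in>F. g y * e y z) = (\<Sum>y\<in>F. f y * e y z - r * (f0 y * e y z))"
          by (rule sum.cong) (simp_all add: g_def algebra_simps)
        moreover have "f x * e1 z = r * f0 z - r * (\<Sum>y\<in>F. f0 y * e y z)"
          by (simp add: e1_def r_def diff_divide_distrib right_diff_distrib)
        moreover have "f z = r * f0 z + g z" by (simp add: g_def)
        ultimately have "f z = f x * e1 z + (\<Sum>y\<in>F. f y * e y z)"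
          by (simp add: sum_subtractf sum_distrib_left)
        also have "\<dots> = (\<Sum>y\<in>insert x F. f y * (e(x := e1)) y z)"
          using insert.hyps by (auto intro!: sum.cong)
        finally show "f z = (\<Sum>y\<in>insert x F. f y * (e(x := e1)) y z)" .
      qed
      moreover have "\<forall>y\<in>insert x F. (e(x := e1)) y \<in> E" using e(1) e1 by simp
      ultimately show ?thesis by blast
    qed
  qed

text \<open>Gaussian elimination: a point where the last function does not vanish serves as pivot.\<close>

lemma span_determined_on_finite:
  fixes b :: "nat \<Rightarrow> 'a \<Rightarrow> complex"
  shows "\<exists>F. finite F \<and> (\<forall>c. (\<forall>x\<in>F. (\<Sum>i<n. c i * b i x) = 0) \<longrightarrow> (\<forall>x. (\<Sum>i<n. c i * b i x) = 0))"
proof (induction n arbitrary: b)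
  case (Suc n)
  show ?case
  proof (cases "\<forall>x. b n x = 0")
    case True
    then show ?thesis using Suc[of b] by simp
  next
    case False
    then obtain x0 where x0: "b n x0 \<noteq> 0" by blast
    define b' where "b' i x = b i x - b i x0 / b n x0 * b n x" for i x
    obtain F where F: "finite F" "\<And>c. \<forall>x\<in>F. (\<Sum>i<n. c i * b' i x) = 0 \<Longrightarrow> \<forall>x. (\<Sum>i<n. c i * b' i x) = 0"
      using Suc[of b'] by blast
    have "\<forall>x. (\<Sum>i<Suc n. c i * b i x) = 0" if c: "\<forall>x\<in>insert x0 F. (\<Sum>i<Suc n. c i * b i x) = 0" for c
    proof -
      have "(\<Sum>i<n. c i * b i x0) + c n * b n x0 = 0" using c by simp
      then have "c n * b n x0 = - (\<Sum>i<n. c i * b i x0)" by (subst eq_neg_iff_add_eq_0) (simp only: add.commute)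
      then have cn: "c n = - (\<Sum>i<n. c i * b i x0) / b n x0"
        using x0 by (simp only: nonzero_eq_divide_eq not_False_eq_True)
      have eq: "(\<Sum>i<Suc n. c i * b i x) = (\<Sum>i<n. c i * b' i x)" for x
      proof -
        have "(\<Sum>i<n. c i * b' i x) = (\<Sum>i<n. c i * b i x - (c i * b i x0) * (b n x / b n x0))"
          by (rule sum.cong[OF refl]) (simp add: b'_def right_diff_distrib)
        also have "\<dots> = (\<Sum>i<n. c i * b i x) - (\<Sum>i<n. c i * b i x0) * (b n x / b n x0)"
          by (simp only: sum_subtractf sum_distrib_right)
        finally show ?thesis unfolding sum.lessThan_Suc cn by simp
      qed
      have "(\<Sum>i<n. c i * b' i x) = 0" if "x \<in> F" for x
        unfolding eq[symmetric] using c that by blast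
      then have "\<forall>x. (\<Sum>i<n. c i * b' i x) = 0" using F(2) by blast
      then show ?thesis unfolding eq .
    qed
    then show ?thesis using F(1) by (intro exI[of _ "insert x0 F"]) blast
  qed
qed auto

lemma finite_dimensional_iff_determined_on_finite:
  fixes E :: "('a \<Rightarrow> complex) set"
  assumes zero: "(\<lambda>_. 0) \<in> E"
    and closed: "\<And>f g c. f \<in> E \<Longrightarrow> g \<in> E \<Longrightarrow> (\<lambda>z. f z + c * g z) \<in> E"
  shows "finite_dimensional E \<longleftrightarrow> (\<exists>F. finite F \<and> (\<forall>f\<in>E. (\<forall>x\<in>F. f x = 0) \<longrightarrow> f = (\<lambda>_. 0)))"
proof
  assume "finite_dimensional E"
  then obtain n b where b: "\<forall>f\<in>E. \<exists>c. f = (\<lambda>x. \<Sum>i<(n::nat). c i * b i x)"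
    unfolding finite_dimensional_def by blast
  obtain F where F: "finite F"
    "\<And>c. \<forall>x\<in>F. (\<Sum>i<n. c i * b i x) = 0 \<Longrightarrow> \<forall>x. (\<Sum>i<n. c i * b i x) = 0"
    using span_determined_on_finite[where n = n and b = b] by blast
  show "\<exists>F. finite F \<and> (\<forall>f\<in>E. (\<forall>x\<in>F. f x = 0) \<longrightarrow> f = (\<lambda>_. 0))"
  proof (intro exI conjI ballI impI)
    fix f assume f: "f \<in> E" "\<forall>x\<in>F. f x = 0"
    obtain c where c: "f = (\<lambda>x. \<Sum>i<n. c i * b i x)" using bspec[OF b f(1)] by (rule exE)
    have "\<forall>x\<in>F. (\<Sum>i<n. c i * b i x) = 0" using f(2) unfolding c .
    then have "\<forall>x. (\<Sum>i<n. c i * b i x) = 0" by (rule F(2))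
    then show "f = (\<lambda>_. 0)" unfolding c by simp
  qed (rule F(1))
next
  assume "\<exists>F. finite F \<and> (\<forall>f\<in>E. (\<forall>x\<in>F. f x = 0) \<longrightarrow> f = (\<lambda>_. 0))"
  then obtain F where F: "finite F" "\<And>f. f \<in> E \<Longrightarrow> \<forall>x\<in>F. f x = 0 \<Longrightarrow> f = (\<lambda>_. 0)" by blast
  obtain e where e: "\<forall>f\<in>E. f = (\<lambda>z. \<Sum>x\<in>F. f x * e x z)"
    using determined_on_finite_imp_spanned[OF F(1) zero closed F(2)] by blast
  obtain h where h: "bij_betw h {..<card F} F"
    using ex_bij_betw_nat_finite[OF F(1)] by (auto simp: atLeast0LessThan)
  have "f = (\<lambda>z. \<Sum>i<card F. f (h i) * e (h i) z)" if "f \<in> E" for f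
  proof -
    have "f = (\<lambda>z. \<Sum>x\<in>F. f x * e x z)" by (rule bspec[OF e that])
    also have "\<dots> = (\<lambda>z. \<Sum>i<card F. f (h i) * e (h i) z)"
      by (rule ext) (rule sum.reindex_bij_betw[OF h, symmetric])
    finally show ?thesis .
  qed
  then have "\<exists>c. f = (\<lambda>z. \<Sum>i<card F. c i * e (h i) z)" if "f \<in> E" for f
    using that by (intro exI[of _ "\<lambda>i. f (h i)"])
  then have "\<forall>f\<in>E. \<exists>c. f = (\<lambda>z. \<Sum>i<card F. c i * e (h i) z)" ..
  then show "finite_dimensional E"
    unfolding finite_dimensional_def by (rule exI[of _ "card F", OF exI[of _ "\<lambda>i. e (h i)"]])
qed

lemma coord_in_l2: "coord f \<in> l2" by (rule coord)

text \<open>Only the values of \<open>T\<close> on \<open>l2\<close> are constrained; \<open>U\<close> is the same operator on the Hilbert space, where it is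
symmetric in the real sense, and complex linear by the third condition.\<close>

locale selfadjoint_l2 =
  fixes T :: "('a \<Rightarrow> complex) \<Rightarrow> 'a \<Rightarrow> complex" and U :: "'a ell2 \<Rightarrow> 'a ell2"
  assumes bounded_linear: "bounded_linear U"
    and symmetric: "symmetric U"
    and cscale_commute: "U (cscale c f) = cscale c (U f)"
    and coord_apply: "coord (U f) = T (coord f)"
begin

sublocale U: bounded_linear U by (rule bounded_linear)

definition shift :: "complex \<Rightarrow> 'a ell2 \<Rightarrow> 'a ell2" where
  "shift z f = U f - cscale z f"

lemma bounded_linear_cshift: "bounded_linear (shift z)"
  unfolding shift_def[abs_def] by (intro bounded_linear_sub bounded_linear bounded_linear_cscale)

lemma shifted_coord: "shifted T z (coord f) = coord (shift z f)"
  by (auto simp: shift_def shifted_def coord_diff coord_cscale coord_apply)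

lemma l2_obtain: assumes "f \<in> l2" obtains F where "f = coord F"
  using assms by (metis Abs_ell2_inverse)

lemma cscale_cscale: "cscale a (cscale b f) = cscale (a * b) f"
  by (rule ell2_eqI) (simp add: coord_cscale mult.assoc)

lemma inner_cscale_i: "inner (cscale \<i> f) g = - inner f (cscale \<i> g)"
  unfolding inner_ell2_def infsum_uminus[symmetric]
  by (rule infsum_cong) (simp add: coord_cscale inner_complex_def)

lemma inner_i_shift: "inner (cscale \<i> (shift z f)) f = Im z * (norm f)\<^sup>2"
proof -
  have "inner (cscale \<i> (U f)) f = - inner (U f) (cscale \<i> f)" by (rule inner_cscale_i)
  also have "inner (U f) (cscale \<i> f) = inner f (cscale \<i> (U f))"
    using symmetric by (auto simp: symmetric_def cscale_commute[symmetric])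
  finally have 1: "inner (cscale \<i> (U f)) f = 0" by (simp add: inner_commute)
  have "cscale (\<i> * z) f = - Im z *\<^sub>R f + Re z *\<^sub>R cscale \<i> f"
    by (rule ell2_eqI) (simp add: coord_simps coord_cscale complex_eq_iff algebra_simps)
  moreover have "inner (cscale \<i> f) f = 0"
    using inner_cscale_i[of f f] by (simp add: inner_commute)
  ultimately have "inner (cscale (\<i> * z) f) f = - Im z * (norm f)\<^sup>2"
    by (simp add: inner_add_left inner_diff_left power2_norm_eq_inner)
  moreover have "cscale \<i> (shift z f) = cscale \<i> (U f) - cscale (\<i> * z) f"
    by (simp add: shift_def linear_diff[OF bounded_linear.linear[OF bounded_linear_cscale]] cscale_cscale)
  ultimately show ?thesis using 1 by (simp add: inner_diff_left)
qed

text \<open>For real \<open>z\<close> the shift is symmetric. For other \<open>z\<close> the operator \<open>\<i> (U - z)\<close> is coercive up to sign, because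
\<open>\<langle>\<i> U f, f\<rangle>\<close> has real part 0.\<close>

lemma bij_shift:
  assumes "bounded_below (shift z) \<or> Im z \<noteq> 0"
  shows "bij (shift z)" "bounded_below (shift z)"
proof -
  have "bij (shift z) \<and> bounded_below (shift z)"
  proof (cases "Im z = 0")
    case True
    then have "z = of_real (Re z)" by (simp add: complex_eq_iff)
    then have eq: "shift z = (\<lambda>f. U f - Re z *\<^sub>R f)"
      by (metis cscale_of_real shift_def)
    have "bounded_below (shift z)" using assms True by blast
    then show ?thesis
      using symmetric_bounded_below_imp_bij[OF bounded_linear_shift[OF bounded_linear] symmetric_shift[OF symmetric], of "Re z"]
      by (simp add: eq)
  next
    case False
    define B where "B f = sgn (Im z) *\<^sub>R cscale \<i> (shift z f)" for f
    have co: "\<bar>Im z\<bar> * (norm f)\<^sup>2 \<le> inner (B f) f" for f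
      by (simp add: B_def inner_i_shift abs_sgn mult.commute mult.left_commute mult.assoc[symmetric])
    have "bij B"
    proof (rule coercive_imp_bij[OF _ _ co])
      show "bounded_linear B"
        unfolding B_def
        by (intro bounded_linear_const_scaleR bounded_linear_compose[OF bounded_linear_cscale] bounded_linear_cshift)
    qed (use False in auto)
    have below: "bounded_below (shift z)"
      unfolding bounded_below_def
    proof (intro exI[of _ "\<bar>Im z\<bar>"] conjI allI)
      fix f
      have nB: "norm (B f) = norm (shift z f)" using False by (simp add: B_def norm_cscale sgn_real_def)
      have "\<bar>Im z\<bar> * norm f * norm f \<le> norm (B f) * norm f"
        using co[of f] norm_cauchy_schwarz[of "B f" f] by (simp add: power2_eq_square mult.assoc)
      then show "\<bar>Im z\<bar> * norm f \<le> norm (shift z f)"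
        unfolding nB by (cases "f = 0") auto
    qed (use False in auto)
    have "\<exists>f. g = shift z f" for g
    proof -
      obtain f where f: "B f = sgn (Im z) *\<^sub>R cscale \<i> g" using bij_is_surj[OF \<open>bij B\<close>] by (metis surjD)
      then have "cscale \<i> (shift z f) = cscale \<i> g" using False by (simp add: B_def sgn_real_def split: if_splits)
      then have "cscale (-\<i>) (cscale \<i> (shift z f)) = cscale (-\<i>) (cscale \<i> g)" by simp
      then have "shift z f = g" unfolding cscale_cscale by (simp add: cscale_of_real[of 1, simplified])
      then show ?thesis by blast
    qed
    then have "surj (shift z)" by (auto simp: surj_def)
    then show ?thesis using below bounded_below_inj[OF bounded_linear_cshift below] by (simp add: bij_def)
  qed
  then show "bij (shift z)" "bounded_below (shift z)" by auto
qed

lemma bij_betw_shifted: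
  assumes "bij (shift z)"
  shows "bij_betw (shifted T z) l2 l2"
proof (rule bij_betw_imageI)
  have inj: "shift z F = shift z G \<longleftrightarrow> F = G" for F G
    using assms by (auto simp: bij_def inj_eq)
  show "inj_on (shifted T z) l2"
  proof (rule inj_onI)
    fix f g assume "f \<in> l2" "g \<in> l2" and eq: "shifted T z f = shifted T z g"
    then obtain F G where "f = coord F" "g = coord G" using l2_obtain by metis
    then show "f = g" using eq inj by (simp add: shifted_coord coord_inject)
  qed
  show "shifted T z ` l2 = l2"
  proof (intro equalityI subsetI)
    fix g assume "g \<in> shifted T z ` l2"
    then obtain f where "f \<in> l2" "g = shifted T z f" by blast
    moreover obtain F where "f = coord F" by (rule l2_obtain[OF \<open>f \<in> l2\<close>])
    ultimately show "g \<in> l2" by (simp add: shifted_coord coord_in_l2)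
  next
    fix g :: "'a \<Rightarrow> complex" assume "g \<in> l2"
    then obtain G where G: "g = coord G" by (rule l2_obtain)
    obtain F where "shift z F = G" using bij_is_surj[OF assms] by (metis surjD)
    then have "g = shifted T z (coord F)" by (simp add: shifted_coord G)
    then show "g \<in> shifted T z ` l2" using coord_in_l2 by blast
  qed
qed

lemma resolvent_coord:
  assumes "bij (shift z)" "shift z g = f"
  shows "resolvent T z (coord f) = coord g"
  unfolding resolvent_def
proof (rule inv_into_f_eq)
  show "inj_on (shifted T z) l2" using bij_betw_shifted[OF assms(1)] by (simp add: bij_betw_def)
  show "shifted T z (coord g) = coord f" using assms(2) by (simp add: shifted_coord)
qed (rule coord_in_l2)

lemma bounded_operator_resolvent:
  assumes bij: "bij (shift z)" and below: "bounded_below (shift z)"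
  shows "bounded_operator (resolvent T z)"
proof -
  obtain c where c: "0 < c" "\<And>f. c * norm f \<le> norm (shift z f)"
    using below by (auto simp: bounded_below_def)
  have pre: "\<exists>F G. f = coord F \<and> shift z G = F" if f: "f \<in> l2" for f
  proof -
    obtain F where "f = coord F" by (rule l2_obtain[OF f])
    moreover obtain G where "shift z G = F" using bij_is_surj[OF bij] by (metis surjD)
    ultimately show ?thesis by blast
  qed
  interpret S: bounded_linear "shift z" by (rule bounded_linear_cshift)
  show ?thesis
    unfolding bounded_operator_def
  proof (intro conjI ballI allI)
    show "resolvent T z f \<in> l2" if "f \<in> l2" for f
      using pre[OF that] resolvent_coord[OF bij] coord_in_l2 by fastforce
    show "resolvent T z (\<lambda>x. f x + g x) = (\<lambda>x. resolvent T z f x + resolvent T z g x)"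
      if fg: "f \<in> l2" "g \<in> l2" for f g
    proof -
      obtain F F' G G' where F: "f = coord F" "shift z F' = F" and G: "g = coord G" "shift z G' = G"
        using pre fg by metis
      have s: "shift z (F' + G') = F + G" using F G S.add by auto
      have "(\<lambda>x. f x + g x) = coord (F + G)" using F G by (auto simp: coord_add)
      then have "resolvent T z (\<lambda>x. f x + g x) = coord (F' + G')"
        using resolvent_coord[OF bij s] by simp
      also have "\<dots> = (\<lambda>x. coord F' x + coord G' x)" by (auto simp: coord_add)
      finally show ?thesis
        using resolvent_coord[OF bij F(2)] resolvent_coord[OF bij G(2)] F G by simp
    qed
    show "resolvent T z (\<lambda>x. a * f x) = (\<lambda>x. a * resolvent T z f x)" if f: "f \<in> l2" for a f
    proof -
      obtain F F' where F: "f = coord F" "shift z F' = F" using pre f by metis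
      have s: "shift z (cscale a F') = cscale a F"
        unfolding F(2)[symmetric]
        by (simp add: shift_def cscale_commute linear_diff[OF bounded_linear.linear[OF bounded_linear_cscale]] cscale_cscale mult.commute)
      have "(\<lambda>x. a * f x) = coord (cscale a F)" using F by (auto simp: coord_cscale)
      then have "resolvent T z (\<lambda>x. a * f x) = coord (cscale a F')"
        using resolvent_coord[OF bij s] by simp
      also have "\<dots> = (\<lambda>x. a * coord F' x)" by (auto simp: coord_cscale)
      finally show ?thesis using resolvent_coord[OF bij F(2)] F by simp
    qed
    show "\<exists>K. \<forall>f\<in>l2. l2_norm (resolvent T z f) \<le> K * l2_norm f"
    proof (intro exI[of _ "1 / c"] ballI)
      fix f :: "'a \<Rightarrow> complex" assume "f \<in> l2"
      then obtain F F' where F: "f = coord F" "shift z F' = F" using pre by metis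
      have "c * norm F' \<le> norm F" using c(2)[of F'] F(2) by simp
      then show "l2_norm (resolvent T z f) \<le> 1 / c * l2_norm f"
        using resolvent_coord[OF bij F(2)] F(1) c(1) by (simp add: l2_norm_coord field_simps)
    qed
  qed
qed

lemma not_in_Spec_iff: "z \<notin> Spec T \<longleftrightarrow> bounded_below (shift z)"
proof
  assume "bounded_below (shift z)"
  then show "z \<notin> Spec T"
    using bij_shift[of z] bij_betw_shifted[of z] bounded_operator_resolvent[of z] by (auto simp: Spec_def)
next
  assume "z \<notin> Spec T"
  then have bij: "bij_betw (shifted T z) l2 l2" and "bounded_operator (resolvent T z)"
    by (auto simp: Spec_def)
  then obtain K where K: "\<And>f. f \<in> l2 \<Longrightarrow> l2_norm (resolvent T z f) \<le> K * l2_norm f"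
    unfolding bounded_operator_def by blast
  show "bounded_below (shift z)"
    unfolding bounded_below_def
  proof (intro exI[of _ "1 / (\<bar>K\<bar> + 1)"] conjI allI)
    fix f
    have "resolvent T z (shifted T z (coord f)) = coord f"
      unfolding resolvent_def using bij by (intro inv_into_f_f) (auto simp: bij_betw_def coord_in_l2)
    then have "norm f \<le> K * norm (shift z f)"
      using K[OF coord_in_l2, of "shift z f"] by (simp add: shifted_coord l2_norm_coord)
    also have "\<dots> \<le> (\<bar>K\<bar> + 1) * norm (shift z f)" by (intro mult_right_mono) auto
    finally show "1 / (\<bar>K\<bar> + 1) * norm f \<le> norm (shift z f)" by (simp add: field_simps)
  qed auto
qed

lemma Spec_real: "z \<in> Spec T \<Longrightarrow> z = of_real (Re z)"
  using bij_shift(2)[of z] not_in_Spec_iff[of z] by (auto simp: complex_eq_iff)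

lemma of_real_not_in_Spec_iff: "of_real l \<notin> Spec T \<longleftrightarrow> bounded_below (\<lambda>f. U f - l *\<^sub>R f)"
  by (simp add: not_in_Spec_iff shift_def[abs_def] cscale_of_real)

lemma eigenspace_coord: "coord f \<in> eigenspace T (of_real l) \<longleftrightarrow> U f = l *\<^sub>R f"
proof -
  have "T (coord f) = (\<lambda>x. of_real l * coord f x) \<longleftrightarrow> coord (U f) = coord (l *\<^sub>R f)"
    by (simp add: coord_apply coord_scaleR fun_eq_iff scaleR_conv_of_real)
  then show ?thesis by (simp add: eigenspace_def coord_in_l2 coord_inject)
qed

lemma eigenspace_cases:
  assumes "g \<in> eigenspace T (of_real l)"
  obtains f where "g = coord f" "U f = l *\<^sub>R f"
  using assms eigenspace_coord l2_obtain unfolding eigenspace_def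
  by (metis (mono_tags, lifting) assms mem_Collect_eq)

lemma eigenspace_zero: "(\<lambda>_. 0) \<in> eigenspace T (of_real l)"
proof -
  have "coord (0 :: 'a ell2) = (\<lambda>_. 0)" by (auto simp: coord_zero)
  then show ?thesis using eigenspace_coord[of 0 l] by (simp add: U.zero)
qed

lemma eigenspace_closed:
  assumes "f \<in> eigenspace T (of_real l)" "g \<in> eigenspace T (of_real l)"
  shows "(\<lambda>z. f z + c * g z) \<in> eigenspace T (of_real l)"
proof -
  obtain F G where F: "f = coord F" "U F = l *\<^sub>R F" and G: "g = coord G" "U G = l *\<^sub>R G"
    using assms eigenspace_cases by metis
  have "U (F + cscale c G) = l *\<^sub>R (F + cscale c G)"
    by (simp add: U.add cscale_commute F G scaleR_add_right linear_cmul[OF bounded_linear.linear[OF bounded_linear_cscale]])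
  then have "coord (F + cscale c G) \<in> eigenspace T (of_real l)" by (simp add: eigenspace_coord)
  moreover have "coord (F + cscale c G) = (\<lambda>z. f z + c * g z)" by (auto simp: coord_simps coord_cscale F G)
  ultimately show ?thesis by simp
qed

lemma finite_dimensional_eigenspace_iff:
  "finite_dimensional (eigenspace T (of_real l)) \<longleftrightarrow>
    (\<exists>F. finite F \<and> (\<forall>f\<in>eigenspace T (of_real l). (\<forall>x\<in>F. f x = 0) \<longrightarrow> f = (\<lambda>_. 0)))"
  by (rule finite_dimensional_iff_determined_on_finite) (simp_all add: eigenspace_zero eigenspace_closed)

text \<open>Were \<open>l\<close> in the discrete spectrum, it would be isolated, so the \<open>X n\<close> would be close to exact eigenvectors
\<open>k n\<close>. These tend to 0 pointwise, hence in norm, as the eigenspace is finite-dimensional; but the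
norms of the \<open>X n\<close> stay away from 0.\<close>

lemma Weyl_sequence_imp_Spec_ess:
  assumes pointwise: "\<And>x. (\<lambda>n. coord (X n) x) \<longlonglongrightarrow> 0"
    and c: "0 < c" "\<And>n. c \<le> norm (X n)"
    and approx: "(\<lambda>n. U (X n) - l *\<^sub>R X n) \<longlonglongrightarrow> 0"
  shows "of_real l \<in> Spec_ess T"
proof -
  let ?E = "eigenspace T (of_real l)"
  define S where "S f = U f - l *\<^sub>R f" for f
  have S: "bounded_linear S" "symmetric S"
    unfolding S_def by (rule bounded_linear_shift[OF bounded_linear], rule symmetric_shift[OF symmetric])
  have SX: "(\<lambda>n. norm (S (X n))) \<longlonglongrightarrow> 0"
    using tendsto_norm[OF approx] by (simp add: S_def)
  have "\<not> bounded_below S"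
  proof
    assume "bounded_below S"
    then obtain b where b: "0 < b" "\<And>f. b * norm f \<le> norm (S f)" by (auto simp: bounded_below_def)
    have "b * c \<le> norm (S (X n))" for n
      using b(2)[of "X n"] mult_left_mono[OF c(2)[of n], of b] b(1) by linarith
    then have "b * c \<le> 0" by (intro LIMSEQ_le_const[OF SX]) auto
    then show False using b c by (simp add: mult_le_0_iff)
  qed
  then have in_Spec: "of_real l \<in> Spec T" using of_real_not_in_Spec_iff by (auto simp: S_def[abs_def])
  have "of_real l \<notin> Spec_disc T"
  proof
    assume "of_real l \<in> Spec_disc T"
    then have iso: "of_real l isolated_in Spec T" and fd: "finite_dimensional (?E)"
      by (auto simp: Spec_disc_def)
    obtain e where e: "0 < e" "\<And>z. z \<in> Spec T \<Longrightarrow> dist (of_real l) z < e \<Longrightarrow> z = of_real l"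
      using iso unfolding isolated_in_dist_Ex_iff by blast
    have gap: "bounded_below (\<lambda>f. S f - w *\<^sub>R f)" if "0 < \<bar>w\<bar>" "\<bar>w\<bar> < e" for w
    proof -
      have "dist (of_real l :: complex) (of_real (l + w)) < e"
        unfolding dist_of_real using that by (simp add: dist_real_def)
      moreover have "(of_real (l + w) :: complex) \<noteq> of_real l" using that unfolding of_real_eq_iff by auto
      ultimately have "of_real (l + w) \<notin> Spec T" using e(2) by blast
      then have "bounded_below (\<lambda>f. U f - (l + w) *\<^sub>R f)" by (simp only: of_real_not_in_Spec_iff)
      then show ?thesis by (simp add: S_def scaleR_add_left diff_diff_eq)
    qed
    obtain D where D: "\<And>g. \<exists>k. S k = 0 \<and> norm (g - k) \<le> D * norm (S g)"
      using approximate_kernel[OF S e(1) gap] by blast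
    have "\<forall>n. \<exists>k. S k = 0 \<and> norm (X n - k) \<le> D * norm (S (X n))" using D by blast
    from choice[OF this] obtain k where "\<forall>n. S (k n) = 0 \<and> norm (X n - k n) \<le> D * norm (S (X n))"
      by blast
    then have k: "S (k n) = 0" "norm (X n - k n) \<le> D * norm (S (X n))" for n by auto
    have Xk: "(\<lambda>n. X n - k n) \<longlonglongrightarrow> 0"
      by (rule Lim_null_comparison[OF always_eventually tendsto_mult_right_zero[OF SX, of D]]) (use k in auto)
    have kx: "(\<lambda>n. coord (k n) x) \<longlonglongrightarrow> 0" for x
      using tendsto_diff[OF pointwise[of x] bounded_linear.tendsto_zero[OF bounded_linear_coord Xk, of x]]
      by (simp add: coord_diff)
    have kE: "coord (k n) \<in> ?E" for n
      using k(1)[of n] by (simp add: eigenspace_coord S_def)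
    from fd[unfolded finite_dimensional_eigenspace_iff]
    obtain F where F: "finite F" "\<And>f. f \<in> ?E \<Longrightarrow> \<forall>x\<in>F. f x = 0 \<Longrightarrow> f = (\<lambda>_. 0)"
      by blast
    obtain e where e: "\<forall>x\<in>F. e x \<in> ?E"
        "\<forall>f\<in>?E. f = (\<lambda>z. \<Sum>x\<in>F. f x * e x z)"
    proof -
      have "\<exists>e. (\<forall>x\<in>F. e x \<in> ?E)
          \<and> (\<forall>f\<in>?E. f = (\<lambda>z. \<Sum>x\<in>F. f x * e x z))"
        by (rule determined_on_finite_imp_spanned)
          (simp_all add: F(1) eigenspace_zero eigenspace_closed, rule F(2))
      then show ?thesis using that by blast
    qed
    have "\<forall>x\<in>F. \<exists>E. e x = coord E" using e(1) by (blast elim: eigenspace_cases)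
    from bchoice[OF this] obtain E where E: "\<forall>x\<in>F. e x = coord (E x)" by blast
    have keq: "k n = (\<Sum>x\<in>F. cscale (coord (k n) x) (E x))" for n
    proof (rule ell2_eqI)
      fix z
      have "coord (k n) z = (\<Sum>x\<in>F. coord (k n) x * e x z)" using fun_cong[OF bspec[OF e(2) kE]] .
      then show "coord (k n) z = coord (\<Sum>x\<in>F. cscale (coord (k n) x) (E x)) z"
        by (simp add: coord_sum coord_cscale E)
    qed
    have "(\<lambda>n. cscale (coord (k n) x) (E x)) \<longlonglongrightarrow> 0" for x
      by (rule tendsto_norm_zero_cancel) (auto simp: norm_cscale intro!: tendsto_mult_left_zero tendsto_norm_zero kx)
    then have "(\<lambda>n. \<Sum>x\<in>F. cscale (coord (k n) x) (E x)) \<longlonglongrightarrow> 0" by (rule tendsto_null_sum)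
    then have "k \<longlonglongrightarrow> 0" unfolding keq[symmetric] .
    from tendsto_add[OF Xk this] have "X \<longlonglongrightarrow> 0" by simp
    then have "(\<lambda>n. norm (X n)) \<longlonglongrightarrow> 0" by (rule tendsto_norm_zero)
    then have "c \<le> 0" by (rule LIMSEQ_le_const) (use c(2) in auto)
    then show False using c(1) by simp
  qed
  then show ?thesis using in_Spec by (simp add: Spec_ess_def)
qed

text \<open>The values on \<open>F\<close> converge along a subsequence by compactness, and the estimate, applied to differences, makes
this subsequence Cauchy.\<close>

lemma eigenvector_of_approximate_eigenvectors:
  assumes F: "finite F"
    and est: "\<And>f. norm f \<le> D * (norm (U f - l *\<^sub>R f) + (\<Sum>x\<in>F. cmod (coord f x)))"
    and unit: "\<And>n. norm (X n) = 1"
    and approx: "(\<lambda>n. U (X n) - l *\<^sub>R X n) \<longlonglongrightarrow> 0"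
  obtains r f where "strict_mono r" "(X \<circ> r) \<longlonglongrightarrow> f" "norm f = 1" "U f = l *\<^sub>R f"
proof -
  define S where "S f = U f - l *\<^sub>R f" for f
  interpret S: bounded_linear S
    unfolding S_def by (rule bounded_linear_shift[OF bounded_linear])
  have "\<exists>r :: nat \<Rightarrow> nat. strict_mono r \<and> (\<forall>x\<in>F. convergent (\<lambda>n. coord (X (r n)) x))"
    using F
  proof (induction F rule: finite_induct)
    case empty
    show ?case by (intro exI[of _ id]) (auto simp: strict_mono_def)
  next
    case (insert x F)
    then obtain r :: "nat \<Rightarrow> nat" where r: "strict_mono r" "\<forall>x\<in>F. convergent (\<lambda>n. coord (X (r n)) x)" by blast
    have mem: "\<forall>n. coord (X (r n)) x \<in> cball 0 1"
    proof
      fix n show "coord (X (r n)) x \<in> cball 0 1"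
        using cmod_coord_le[of "X (r n)" x] unit[of "r n"] by simp
    qed
    obtain a q where q: "a \<in> cball 0 1" "strict_mono q" "((\<lambda>n. coord (X (r n)) x) \<circ> q) \<longlonglongrightarrow> a"
      by (rule seq_compactE[OF compact_imp_seq_compact[OF compact_cball] mem])
    have "convergent (\<lambda>n. coord (X ((r \<circ> q) n)) y)" if "y \<in> insert x F" for y
    proof (cases "y = x")
      case True
      then show ?thesis using q(3) by (auto simp: convergent_def o_def)
    next
      case False
      then have "convergent (\<lambda>n. coord (X (r n)) y)" using r(2) that by blast
      then have "convergent ((\<lambda>n. coord (X (r n)) y) \<circ> q)" by (rule convergent_subseq_convergent[OF _ q(2)])
      then show ?thesis by (simp add: o_def)
    qed
    then show ?case using strict_mono_o[OF r(1) q(2)] by blast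
  qed
  then obtain r :: "nat \<Rightarrow> nat" where r: "strict_mono r" and conv: "\<forall>x\<in>F. convergent (\<lambda>n. coord (X (r n)) x)"
    by blast
  have "\<forall>x\<in>F. \<exists>a. (\<lambda>n. coord (X (r n)) x) \<longlonglongrightarrow> a" using conv by (simp add: convergent_def)
  from bchoice[OF this] obtain a where a: "\<forall>x\<in>F. (\<lambda>n. coord (X (r n)) x) \<longlonglongrightarrow> a x" by blast
  have Sr: "(\<lambda>n. S (X (r n))) \<longlonglongrightarrow> 0"
    using LIMSEQ_subseq_LIMSEQ[OF approx r] by (simp add: S_def o_def)
  define t where "t n = norm (S (X (r n))) + (\<Sum>x\<in>F. cmod (coord (X (r n)) x - a x))" for n
  have "t \<longlonglongrightarrow> 0"
  proof -
    have "(\<lambda>n. cmod (coord (X (r n)) x - a x)) \<longlonglongrightarrow> 0" if "x \<in> F" for x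
      by (rule tendsto_norm_zero[OF LIM_zero[OF bspec[OF a that]]])
    then have "(\<lambda>n. \<Sum>x\<in>F. cmod (coord (X (r n)) x - a x)) \<longlonglongrightarrow> 0" by (rule tendsto_null_sum)
    from tendsto_add[OF tendsto_norm_zero[OF Sr] this] show ?thesis unfolding t_def by simp
  qed
  define K where "K = max D 1"
  have diff: "norm (X (r m) - X (r n)) \<le> K * (t m + t n)" for m n
  proof -
    let ?Q = "norm (S (X (r m) - X (r n))) + (\<Sum>x\<in>F. cmod (coord (X (r m) - X (r n)) x))"
    have "?Q \<le> t m + t n"
    proof -
      have "norm (S (X (r m) - X (r n))) \<le> norm (S (X (r m))) + norm (S (X (r n)))"
        unfolding S.diff by (rule norm_triangle_ineq4)
      moreover have "cmod (coord (X (r m) - X (r n)) x)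
          \<le> cmod (coord (X (r m)) x - a x) + cmod (coord (X (r n)) x - a x)" for x
        using norm_triangle_ineq4[of "coord (X (r m)) x - a x" "coord (X (r n)) x - a x"] by (simp add: coord_diff)
      then have "(\<Sum>x\<in>F. cmod (coord (X (r m) - X (r n)) x))
          \<le> (\<Sum>x\<in>F. cmod (coord (X (r m)) x - a x)) + (\<Sum>x\<in>F. cmod (coord (X (r n)) x - a x))"
        unfolding sum.distrib[symmetric] by (rule sum_mono)
      ultimately show ?thesis by (simp add: t_def)
    qed
    then have "K * ?Q \<le> K * (t m + t n)"
      by (rule mult_left_mono) (simp add: K_def)
    moreover have "D * ?Q \<le> K * ?Q"
      by (rule mult_right_mono) (simp_all add: K_def sum_nonneg)
    ultimately show ?thesis using est[of "X (r m) - X (r n)", folded S_def] by linarith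
  qed
  have "Cauchy (\<lambda>n. X (r n))"
  proof (rule metric_CauchyI)
    fix e :: real assume e: "0 < e"
    have K: "0 < K" by (simp add: K_def)
    obtain N where N: "\<And>n. n \<ge> N \<Longrightarrow> t n < e / (2 * K)"
      using order_tendstoD(2)[OF \<open>t \<longlonglongrightarrow> 0\<close>, of "e / (2 * K)"] e K by (auto simp: eventually_sequentially)
    have "dist (X (r m)) (X (r n)) < e" if "m \<ge> N" "n \<ge> N" for m n
    proof -
      have "K * (t m + t n) < K * (e / (2 * K) + e / (2 * K))"
        using N[OF that(1)] N[OF that(2)] K by (intro mult_strict_left_mono) auto
      also have "\<dots> = e" using K by simp
      finally show ?thesis using diff[of m n] by (simp add: dist_norm)
    qed
    then show "\<exists>N. \<forall>m\<ge>N. \<forall>n\<ge>N. dist (X (r m)) (X (r n)) < e" by blast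
  qed
  then obtain f where f: "(\<lambda>n. X (r n)) \<longlonglongrightarrow> f" using Cauchy_convergent convergent_def by blast
  have "(\<lambda>n. norm (X (r n))) \<longlonglongrightarrow> 1" using unit by simp
  then have "norm f = 1" by (rule LIMSEQ_unique[OF tendsto_norm[OF f]])
  moreover have "S f = 0"
    using LIMSEQ_unique[OF S.tendsto[OF f] Sr] .
  ultimately show ?thesis using that[OF r, of f] f by (simp add: o_def S_def)
qed

text \<open>All three properties of a discrete point follow from the estimate: an eigenvector is a limit of approximate
ones, an eigenfunction vanishing on \<open>F\<close> is 0, and points of the spectrum accumulating at \<open>l\<close> would produce
unit vectors that converge to an eigenvector of \<open>l\<close> while being almost orthogonal to it.\<close>

lemma finite_rank_estimate_imp_Spec_disc:
  assumes F: "finite F"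
    and est: "\<And>f. norm f \<le> D * (norm (U f - l *\<^sub>R f) + (\<Sum>x\<in>F. cmod (coord f x)))"
    and in_Spec: "of_real l \<in> Spec T"
  shows "of_real l \<in> Spec_disc T"
proof -
  have almost: "\<exists>f. norm f = 1 \<and> norm (U f - w *\<^sub>R f) < e" if w: "of_real w \<in> Spec T" and e: "0 < e" for w e
  proof -
    have "\<not> bounded_below (\<lambda>f. U f - w *\<^sub>R f)" using of_real_not_in_Spec_iff w by blast
    then obtain f where f: "norm (U f - w *\<^sub>R f) < e * norm f" using not_bounded_belowD[OF _ e] by blast
    then have pos: "0 < norm f" by (cases "f = 0") (auto simp: U.zero)
    let ?f = "(1 / norm f) *\<^sub>R f"
    have "U ?f - w *\<^sub>R ?f = (1 / norm f) *\<^sub>R (U f - w *\<^sub>R f)"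
      by (simp add: U.scaleR scaleR_diff_right)
    then have "norm (U ?f - w *\<^sub>R ?f) = norm (U f - w *\<^sub>R f) / norm f" by (simp only: norm_scaleR) simp
    also have "\<dots> < e" using f pos by (simp add: pos_divide_less_eq)
    finally have "norm (U ?f - w *\<^sub>R ?f) < e" .
    then show ?thesis using pos by (intro exI[of _ ?f]) simp
  qed
  have "eigenspace T (of_real l) \<noteq> {\<lambda>_. 0}"
  proof -
    have "\<forall>n. \<exists>f. norm f = 1 \<and> norm (U f - l *\<^sub>R f) < 1 / real (Suc n)" using almost[OF in_Spec] by simp
    then obtain X where X: "\<And>n. norm (X n) = 1" "\<And>n. norm (U (X n) - l *\<^sub>R X n) < 1 / real (Suc n)"
      using choice[of "\<lambda>n f. norm f = 1 \<and> norm (U f - l *\<^sub>R f) < 1 / real (Suc n)"] by blast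
    have lim: "(\<lambda>n. U (X n) - l *\<^sub>R X n) \<longlonglongrightarrow> 0"
      by (rule Lim_null_comparison[OF _ LIMSEQ_inverse_real_of_nat])
        (use X(2) in \<open>auto simp: inverse_eq_divide intro!: always_eventually less_imp_le\<close>)
    obtain r f where f: "norm f = 1" "U f = l *\<^sub>R f"
      using eigenvector_of_approximate_eigenvectors[OF F est X(1) lim] by metis
    have "coord f \<in> eigenspace T (of_real l)" using f(2) eigenspace_coord by blast
    moreover have "coord f \<noteq> (\<lambda>_. 0)"
    proof
      assume "coord f = (\<lambda>_. 0)"
      then have "f = 0" by (intro ell2_eqI) (simp add: coord_zero)
      then show False using f(1) by simp
    qed
    ultimately show ?thesis by blast
  qed
  moreover have "finite_dimensional (eigenspace T (of_real l))"
    unfolding finite_dimensional_eigenspace_iff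
  proof (intro exI conjI ballI impI)
    fix g assume g: "g \<in> eigenspace T (of_real l)" "\<forall>x\<in>F. g x = 0"
    obtain f where f: "g = coord f" "U f = l *\<^sub>R f" using g(1) by (rule eigenspace_cases)
    have "norm f \<le> 0" using est[of f] f g(2) by simp
    then show "g = (\<lambda>_. 0)" using f by (auto simp: coord_zero)
  qed (rule F)
  moreover have "of_real l isolated_in Spec T"
  proof (rule ccontr)
    assume "\<not> of_real l isolated_in Spec T"
    then have acc: "\<exists>z\<in>Spec T. dist (of_real l) z < e \<and> z \<noteq> of_real l" if "0 < e" for e
      using in_Spec that unfolding isolated_in_dist_Ex_iff by blast
    define P where "P n p \<longleftrightarrow> fst p \<noteq> l \<and> \<bar>fst p - l\<bar> < 1 / real (Suc n) \<and> norm (snd p) = 1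
        \<and> norm (U (snd p) - fst p *\<^sub>R snd p) < \<bar>fst p - l\<bar> / real (Suc n)" for n p
    have "\<exists>p. P n p" for n
    proof -
      obtain z where z: "z \<in> Spec T" "dist (of_real l) z < 1 / real (Suc n)" "z \<noteq> of_real l"
        using acc[of "1 / real (Suc n)"] by auto
      define w where "w = Re z"
      have zw: "z = of_real w" using Spec_real[OF z(1)] by (simp add: w_def)
      have w: "w \<noteq> l" "\<bar>w - l\<bar> < 1 / real (Suc n)" "of_real w \<in> Spec T"
        using z unfolding zw dist_of_real by (auto simp: dist_real_def abs_minus_commute)
      then obtain f where "norm f = 1" "norm (U f - w *\<^sub>R f) < \<bar>w - l\<bar> / real (Suc n)"
        using almost[OF w(3), of "\<bar>w - l\<bar> / real (Suc n)"] by auto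
      then have "P n (w, f)" using w by (simp add: P_def)
      then show ?thesis ..
    qed
    then have "\<forall>n. \<exists>p. P n p" ..
    from choice[OF this] obtain p where p: "\<forall>n. P n (p n)" ..
    define w X where "w n = fst (p n)" and "X n = snd (p n)" for n
    have w: "w n \<noteq> l" "\<bar>w n - l\<bar> < 1 / real (Suc n)" and X: "norm (X n) = 1"
        and wX: "norm (U (X n) - w n *\<^sub>R X n) < \<bar>w n - l\<bar> / real (Suc n)" for n
      using p by (simp_all add: P_def w_def X_def)
    have lim: "(\<lambda>n. U (X n) - l *\<^sub>R X n) \<longlonglongrightarrow> 0"
    proof (rule Lim_null_comparison)
      show "(\<lambda>n. 2 * inverse (real (Suc n))) \<longlonglongrightarrow> 0"
        by (rule tendsto_mult_right_zero[OF LIMSEQ_inverse_real_of_nat])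
      have "norm (U (X n) - l *\<^sub>R X n) \<le> 2 * inverse (real (Suc n))" for n
      proof -
        have "U (X n) - l *\<^sub>R X n = (U (X n) - w n *\<^sub>R X n) + (w n - l) *\<^sub>R X n"
          by (simp add: scaleR_diff_left)
        then have "norm (U (X n) - l *\<^sub>R X n) \<le> norm (U (X n) - w n *\<^sub>R X n) + \<bar>w n - l\<bar>"
          using norm_triangle_ineq[of "U (X n) - w n *\<^sub>R X n" "(w n - l) *\<^sub>R X n"] X[of n] by (simp only: norm_scaleR) simp
        moreover have "\<bar>w n - l\<bar> / real (Suc n) \<le> \<bar>w n - l\<bar>"
          by (simp add: divide_le_eq mult_left_le algebra_simps)
        ultimately show ?thesis using w(2)[of n] wX[of n] by (simp add: inverse_eq_divide)
      qed
      then show "\<forall>\<^sub>F n in sequentially. norm (U (X n) - l *\<^sub>R X n) \<le> 2 * inverse (real (Suc n))" by simp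
    qed
    obtain r f where r: "strict_mono r" and Xf: "(X \<circ> r) \<longlonglongrightarrow> f" and f: "norm f = 1" "U f = l *\<^sub>R f"
      by (rule eigenvector_of_approximate_eigenvectors[OF F est X lim])
    \<comment> \<open>Eigenvectors of a symmetric operator for different eigenvalues are orthogonal, approximately so here.\<close>
    have orth: "\<bar>inner (X n) f\<bar> \<le> inverse (real (Suc n))" for n
    proof -
      have "(l - w n) * inner (X n) f = inner (U (X n) - w n *\<^sub>R X n) f"
        using symmetric f(2) by (simp add: inner_diff_left symmetric_def left_diff_distrib)
      then have "\<bar>l - w n\<bar> * \<bar>inner (X n) f\<bar> = \<bar>inner (U (X n) - w n *\<^sub>R X n) f\<bar>" by (simp flip: abs_mult)
      also have "\<dots> \<le> norm (U (X n) - w n *\<^sub>R X n) * norm f" by (rule Cauchy_Schwarz_ineq2)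
      also have "\<dots> \<le> \<bar>l - w n\<bar> * inverse (real (Suc n))"
        using wX[of n] f(1) by (simp add: divide_inverse abs_minus_commute)
      finally show ?thesis using w(1)[of n] by simp
    qed
    have "(\<lambda>n. inner (X n) f) \<longlonglongrightarrow> 0"
      by (rule Lim_null_comparison[OF _ LIMSEQ_inverse_real_of_nat]) (use orth in auto)
    then have "(\<lambda>n. inner ((X \<circ> r) n) f) \<longlonglongrightarrow> 0" using LIMSEQ_subseq_LIMSEQ[OF _ r] by (fastforce simp: o_def)
    moreover have "(\<lambda>n. inner ((X \<circ> r) n) f) \<longlonglongrightarrow> inner f f" by (intro tendsto_intros Xf)
    ultimately have "inner f f = 0" using LIMSEQ_unique by blast
    then show False using f(1) by simp
  qed
  ultimately show ?thesis by (simp add: Spec_disc_def)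
qed

end

section \<open>Averages over a hierarchy of partitions\<close>

text \<open>If \<open>u\<close> in the range and \<open>v\<close> in the kernel were not orthogonal, some \<open>u - t v\<close> would be shorter than \<open>u\<close>,
its image under \<open>P\<close>.\<close>

lemma idempotent_contraction_imp_symmetric:
  fixes P :: "'h::real_inner \<Rightarrow> 'h"
  assumes P: "linear P" and idem: "\<And>f. P (P f) = P f" and contr: "\<And>f. norm (P f) \<le> norm f"
  shows "symmetric P"
proof -
  have orth: "inner u v = 0" if u: "P u = u" and v: "P v = 0" for u v
  proof (rule ccontr)
    assume ne: "inner u v \<noteq> 0"
    then have vpos: "0 < (norm v)\<^sup>2" by auto
    define t where "t = inner u v / (norm v)\<^sup>2"
    have "P (u - t *\<^sub>R v) = u" by (simp add: linear_diff[OF P] linear_cmul[OF P] u v)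
    then have "norm u \<le> norm (u - t *\<^sub>R v)" using contr[of "u - t *\<^sub>R v"] by simp
    then have "(norm u)\<^sup>2 \<le> (norm (u - t *\<^sub>R v))\<^sup>2" by (intro power_mono) auto
    then have "2 * t * inner v u \<le> t\<^sup>2 * (norm v)\<^sup>2" by (simp add: norm_diff_scaleR_squared)
    moreover have "t\<^sup>2 * (norm v)\<^sup>2 = t * inner v u"
      using vpos by (simp add: t_def power2_eq_square inner_commute)
    moreover have "t * inner v u = (inner u v)\<^sup>2 / (norm v)\<^sup>2"
      by (simp add: t_def power2_eq_square inner_commute)
    then have "0 < t * inner v u" using ne vpos by simp
    ultimately show False by simp
  qed
  have "inner (P f) (g - P g) = 0" for f g
    by (rule orth) (simp_all add: idem linear_diff[OF P])
  then have "inner (P f) g = inner (P f) (P g)" for f g by (simp add: inner_diff_right)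
  then show ?thesis unfolding symmetric_def by (metis inner_commute)
qed

text \<open>The cells \<open>B k x\<close> of level \<open>k\<close> partition the space and grow with \<open>k\<close>; balls of an ultrametric space are the
model.\<close>

locale homogeneous_partitions =
  fixes B :: "nat \<Rightarrow> 'a \<Rightarrow> 'a set" and n :: "nat \<Rightarrow> nat"
  assumes finite_B: "finite (B k x)"
    and mem_B: "x \<in> B k x"
    and B_eq: "y \<in> B k x \<Longrightarrow> B k y = B k x"
    and B_mono: "j \<le> k \<Longrightarrow> B j x \<subseteq> B k x"
    and B_0: "B 0 x = {x}"
    and card_B: "card (B k x) = n k"
    and strict_mono_n: "strict_mono n"
begin

lemma B_sym: "y \<in> B k x \<longleftrightarrow> x \<in> B k y"
  using B_eq mem_B by blast

lemma n_pos: "0 < n k"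
proof -
  have "B k undefined \<noteq> {}" using mem_B by blast
  then show ?thesis using card_B[of k undefined] finite_B[of k undefined] by (metis card_gt_0_iff)
qed

lemma n_0: "n 0 = 1"
  using card_B[of 0] by (simp add: B_0)

definition average_kernel :: "nat \<Rightarrow> 'a \<Rightarrow> 'a \<Rightarrow> real" where
  "average_kernel k x y = (if y \<in> B k x then 1 / real (n k) else 0)"

lemma average_kernel_sym: "average_kernel k x y = average_kernel k y x"
  by (simp add: average_kernel_def B_sym[of y k x])

definition average :: "nat \<Rightarrow> 'a ell2 \<Rightarrow> 'a ell2" where
  "average k f = Abs_ell2 (\<lambda>x. (\<Sum>y\<in>B k x. coord f y) / of_nat (n k))"

lemma average_exists:
  "\<exists>g. norm g \<le> norm f \<and> (\<forall>x. coord g x = (\<Sum>y\<in>B k x. coord f y) / of_nat (n k))"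
proof -
  have "(\<Sum>y\<in>S. \<bar>average_kernel k x y\<bar>) \<le> 1" if "finite S" for x S
  proof -
    have "(\<Sum>y\<in>S. \<bar>average_kernel k x y\<bar>) = (\<Sum>y\<in>S \<inter> B k x. 1 / real (n k))"
      by (rule sum.mono_neutral_cong_right[OF that]) (auto simp: average_kernel_def)
    also have "\<dots> \<le> real (card (B k x)) * (1 / real (n k))"
      using card_mono[OF finite_B, of "S \<inter> B k x" k x] by (simp add: divide_right_mono)
    finally show ?thesis using n_pos[of k] by (simp add: card_B)
  qed
  from Schur_test(2)[OF this average_kernel_sym, of f]
  obtain g where g: "norm g \<le> 1 * norm f"
      "\<forall>x. coord g x = (\<Sum>\<^sub>\<infinity>y. of_real (average_kernel k x y) * coord f y)"
    by blast
  moreover have "(\<Sum>\<^sub>\<infinity>y. of_real (average_kernel k x y) * coord f y) = (\<Sum>y\<in>B k x. coord f y) / of_nat (n k)" for x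
  proof -
    have "(\<Sum>\<^sub>\<infinity>y. of_real (average_kernel k x y) * coord f y) = (\<Sum>\<^sub>\<infinity>y\<in>B k x. coord f y / of_nat (n k))"
      by (rule infsum_cong_neutral) (auto simp: average_kernel_def)
    then show ?thesis by (simp add: infsum_finite[OF finite_B] sum_divide_distrib)
  qed
  ultimately show ?thesis by auto
qed

lemma coord_average: "coord (average k f) x = (\<Sum>y\<in>B k x. coord f y) / of_nat (n k)"
  and norm_average_le: "norm (average k f) \<le> norm f"
proof -
  obtain g where g: "norm g \<le> norm f" "coord g = (\<lambda>x. (\<Sum>y\<in>B k x. coord f y) / of_nat (n k))"
    using average_exists[of f k] by (auto simp: fun_eq_iff)
  have "average k f = g" unfolding average_def g(2)[symmetric] by (rule coord_inverse)
  then show "coord (average k f) x = (\<Sum>y\<in>B k x. coord f y) / of_nat (n k)" "norm (average k f) \<le> norm f"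
    using g by auto
qed

lemma bounded_linear_average: "bounded_linear (average k)"
proof (rule bounded_linear_intro[where K = 1])
  show "average k (f + g) = average k f + average k g" for f g
    by (rule ell2_eqI) (simp add: coord_simps coord_average sum.distrib add_divide_distrib)
  show "average k (r *\<^sub>R f) = r *\<^sub>R average k f" for r f
    by (rule ell2_eqI) (simp add: coord_simps coord_average scaleR_conv_of_real sum_distrib_left)
qed (simp add: norm_average_le)

lemma average_cscale: "average k (cscale c f) = cscale c (average k f)"
  by (rule ell2_eqI) (simp add: coord_cscale coord_average sum_distrib_left[symmetric])

lemma average_0: "average 0 f = f"
  by (rule ell2_eqI) (simp add: coord_average B_0 n_0)

lemma average_cong: "y \<in> B k x \<Longrightarrow> coord (average k f) y = coord (average k f) x"
  by (simp add: coord_average B_eq)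

lemma average_average_le: "j \<le> k \<Longrightarrow> average j (average k f) = average k f"
proof (rule ell2_eqI)
  fix x assume "j \<le> k"
  then have "coord (average k f) y = coord (average k f) x" if "y \<in> B j x" for y
    using average_cong[of y k x f] B_mono[of j k x] that by blast
  then have "(\<Sum>y\<in>B j x. coord (average k f) y) = of_nat (n j) * coord (average k f) x"
    by (simp add: card_B)
  then show "coord (average j (average k f)) x = coord (average k f) x"
    using n_pos[of j] by (simp add: coord_average[of j])
qed

lemma symmetric_average: "symmetric (average k)"
  by (rule idempotent_contraction_imp_symmetric)
    (auto simp: norm_average_le average_average_le bounded_linear.linear[OF bounded_linear_average])

lemma average_average: "average j (average k f) = average (max j k) f"
proof (cases "j \<le> k")
  case True
  then show ?thesis by (simp add: average_average_le max_def)
next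
  case False
  have sw: "inner (average i f) g = inner f (average i g)" for i f g
    using symmetric_average[of i] by (simp add: symmetric_def)
  have "inner (average j (average k f)) g = inner (average j f) g" for g
    using False by (simp add: sw average_average_le)
  then have "inner (average j (average k f) - average j f) g = 0" for g by (simp add: inner_diff_left)
  then have "average j (average k f) - average j f = 0" by (metis all_zero_iff)
  then show ?thesis using False by (simp add: max_def)
qed

lemma average_tendsto_0: "(\<lambda>k. coord (average k f) x) \<longlonglongrightarrow> 0"
proof (rule Lim_null_comparison)
  have n_top: "filterlim (\<lambda>k. real (n k)) at_top sequentially"
    by (rule filterlim_compose[OF filterlim_real_sequentially filterlim_subseq[OF strict_mono_n]])
  show "(\<lambda>k. norm f / sqrt (real (n k))) \<longlonglongrightarrow> 0"
    by (rule real_tendsto_divide_at_top[OF tendsto_const filterlim_compose[OF sqrt_at_top n_top]])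
  show "\<forall>\<^sub>F k in sequentially. norm (coord (average k f) x) \<le> norm f / sqrt (real (n k))"
  proof (rule always_eventually, rule allI)
    fix k
    have "(\<Sum>y\<in>B k x. (cmod (coord (average k f) y))\<^sup>2) = (\<Sum>y\<in>B k x. (cmod (coord (average k f) x))\<^sup>2)"
      by (rule sum.cong[OF refl]) (simp add: average_cong)
    then have "real (n k) * (cmod (coord (average k f) x))\<^sup>2 = (\<Sum>y\<in>B k x. (cmod (coord (average k f) y))\<^sup>2)"
      by (simp add: card_B)
    also have "\<dots> \<le> (norm (average k f))\<^sup>2" by (rule sum_coord_squared_le[OF finite_B])
    also have "\<dots> \<le> (norm f)\<^sup>2" by (intro power_mono norm_average_le) auto
    finally have "(cmod (coord (average k f) x))\<^sup>2 \<le> (norm f / sqrt (real (n k)))\<^sup>2"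
      using n_pos[of k] by (simp add: power_divide pos_le_divide_eq mult.commute)
    then show "norm (coord (average k f) x) \<le> norm f / sqrt (real (n k))"
      by (rule power2_le_imp_le) simp
  qed
qed

definition increment :: "(nat \<Rightarrow> real) \<Rightarrow> nat \<Rightarrow> real" where
  "increment \<gamma> k = (case k of 0 \<Rightarrow> \<gamma> 0 | Suc j \<Rightarrow> \<gamma> (Suc j) - \<gamma> j)"

definition bounded_variation :: "(nat \<Rightarrow> real) \<Rightarrow> bool" where
  "bounded_variation \<gamma> \<longleftrightarrow> summable (\<lambda>k. \<bar>increment \<gamma> k\<bar>)"

definition variation :: "(nat \<Rightarrow> real) \<Rightarrow> real" where
  "variation \<gamma> = (\<Sum>k. \<bar>increment \<gamma> k\<bar>)"

text \<open>On the range of \<open>average m - average (Suc m)\<close> this operator is multiplication by \<open>\<gamma> m\<close>. Summation by parts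
turns that description into the present series, which converges absolutely.\<close>

definition multiplier :: "(nat \<Rightarrow> real) \<Rightarrow> 'a ell2 \<Rightarrow> 'a ell2" where
  "multiplier \<gamma> f = (\<Sum>k. increment \<gamma> k *\<^sub>R average k f)"

lemma sum_increment: "(\<Sum>k\<le>m. increment \<gamma> k) = \<gamma> m"
  by (induction m) (simp_all add: increment_def)

lemma variation_nonneg: "bounded_variation \<gamma> \<Longrightarrow> 0 \<le> variation \<gamma>"
  unfolding variation_def bounded_variation_def by (rule suminf_nonneg) auto

lemma abs_le_variation: "bounded_variation \<gamma> \<Longrightarrow> \<bar>\<gamma> m\<bar> \<le> variation \<gamma>"
proof -
  assume bv: "bounded_variation \<gamma>"
  have "\<bar>\<gamma> m\<bar> \<le> (\<Sum>k\<le>m. \<bar>increment \<gamma> k\<bar>)"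
    unfolding sum_increment[of \<gamma> m, symmetric] by (rule sum_abs)
  also have "\<dots> \<le> variation \<gamma>"
    unfolding variation_def using bv by (intro sum_le_suminf) (auto simp: bounded_variation_def)
  finally show ?thesis .
qed

lemma multiplier_norm_summable:
  assumes "bounded_variation \<gamma>"
  shows "summable (\<lambda>k. norm (increment \<gamma> k *\<^sub>R average k f))"
proof (rule summable_comparison_test)
  show "summable (\<lambda>k. \<bar>increment \<gamma> k\<bar> * norm f)"
    using assms unfolding bounded_variation_def by (rule summable_mult2)
  show "\<exists>N. \<forall>k\<ge>N. norm (norm (increment \<gamma> k *\<^sub>R average k f)) \<le> \<bar>increment \<gamma> k\<bar> * norm f"
    by (auto intro!: mult_left_mono norm_average_le)
qed

lemma multiplier_sums:
  assumes "bounded_variation \<gamma>"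
  shows "(\<lambda>k. increment \<gamma> k *\<^sub>R average k f) sums multiplier \<gamma> f"
  unfolding multiplier_def by (rule summable_sums[OF summable_norm_cancel[OF multiplier_norm_summable[OF assms]]])

lemma norm_multiplier_le:
  assumes bv: "bounded_variation \<gamma>"
  shows "norm (multiplier \<gamma> f) \<le> variation \<gamma> * norm f"
proof -
  have "norm (multiplier \<gamma> f) \<le> (\<Sum>k. norm (increment \<gamma> k *\<^sub>R average k f))"
    unfolding multiplier_def by (rule summable_norm[OF multiplier_norm_summable[OF bv]])
  also have "\<dots> \<le> (\<Sum>k. \<bar>increment \<gamma> k\<bar> * norm f)"
  proof (rule suminf_le)
    show "norm (increment \<gamma> k *\<^sub>R average k f) \<le> \<bar>increment \<gamma> k\<bar> * norm f" for k
      by (auto intro!: mult_left_mono norm_average_le)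
    show "summable (\<lambda>k. \<bar>increment \<gamma> k\<bar> * norm f)"
      using bv unfolding bounded_variation_def by (rule summable_mult2)
  qed (rule multiplier_norm_summable[OF bv])
  also have "\<dots> = variation \<gamma> * norm f"
    unfolding variation_def by (rule suminf_mult2[symmetric]) (use bv in \<open>simp add: bounded_variation_def\<close>)
  finally show ?thesis .
qed

lemma bounded_linear_multiplier:
  assumes bv: "bounded_variation \<gamma>"
  shows "bounded_linear (multiplier \<gamma>)"
proof (rule bounded_linear_intro)
  note lin = bounded_linear.linear[OF bounded_linear_average]
  show "multiplier \<gamma> (f + g) = multiplier \<gamma> f + multiplier \<gamma> g" for f g
    by (rule sums_unique2[OF multiplier_sums[OF bv]])
      (use sums_add[OF multiplier_sums[OF bv, of f] multiplier_sums[OF bv, of g]] in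
        \<open>simp add: linear_add[OF lin] scaleR_add_right\<close>)
  show "multiplier \<gamma> (r *\<^sub>R f) = r *\<^sub>R multiplier \<gamma> f" for r f
    by (rule sums_unique2[OF multiplier_sums[OF bv]])
      (use sums_scaleR_right[OF multiplier_sums[OF bv, of f], of r] in
        \<open>simp add: linear_cmul[OF lin] mult.commute\<close>)
  show "norm (multiplier \<gamma> f) \<le> norm f * variation \<gamma>" for f
    using norm_multiplier_le[OF bv, of f] by (simp add: mult.commute)
qed

lemma multiplier_cscale:
  assumes bv: "bounded_variation \<gamma>"
  shows "multiplier \<gamma> (cscale c f) = cscale c (multiplier \<gamma> f)"
  by (rule sums_unique2[OF multiplier_sums[OF bv]])
    (use bounded_linear.sums[OF bounded_linear_cscale multiplier_sums[OF bv, of f], of c] in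
      \<open>simp add: average_cscale linear_cmul[OF bounded_linear.linear[OF bounded_linear_cscale]]\<close>)

lemma symmetric_multiplier:
  assumes bv: "bounded_variation \<gamma>"
  shows "symmetric (multiplier \<gamma>)"
  unfolding symmetric_def
proof (intro allI)
  fix f g
  have "(\<lambda>k. inner (increment \<gamma> k *\<^sub>R average k f) g) sums inner (multiplier \<gamma> f) g"
    by (rule bounded_linear.sums[OF bounded_linear_inner_left multiplier_sums[OF bv]])
  moreover have "(\<lambda>k. inner f (increment \<gamma> k *\<^sub>R average k g)) sums inner f (multiplier \<gamma> g)"
    by (rule bounded_linear.sums[OF bounded_linear_inner_right multiplier_sums[OF bv]])
  moreover have "inner (increment \<gamma> k *\<^sub>R average k f) g = inner f (increment \<gamma> k *\<^sub>R average k g)" for k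
    using symmetric_average[of k] by (simp add: symmetric_def)
  ultimately show "inner (multiplier \<gamma> f) g = inner f (multiplier \<gamma> g)"
    using sums_unique2 by (metis (no_types, lifting) sums_cong)
qed

lemma coord_multiplier_sums:
  assumes "bounded_variation \<gamma>"
  shows "(\<lambda>k. increment \<gamma> k *\<^sub>R coord (average k f) x) sums coord (multiplier \<gamma> f) x"
  using bounded_linear.sums[OF bounded_linear_coord multiplier_sums[OF assms, of f], of x] by (simp add: coord_scaleR)

text \<open>Averaging commutes with the series, and the terms of index above \<open>m\<close> are the same for both levels; what
remains adds up to \<open>\<gamma> m\<close>.\<close>

lemma average_multiplier_diff:
  assumes bv: "bounded_variation \<gamma>"
  shows "average m (multiplier \<gamma> f) - average (Suc m) (multiplier \<gamma> f)
    = \<gamma> m *\<^sub>R (average m f - average (Suc m) f)"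
proof -
  note lin = bounded_linear.linear[OF bounded_linear_average]
  let ?d = "\<lambda>k. increment \<gamma> k *\<^sub>R (average (max m k) f - average (max (Suc m) k) f)"
  have "(\<lambda>k. average m (increment \<gamma> k *\<^sub>R average k f) - average (Suc m) (increment \<gamma> k *\<^sub>R average k f))
      sums (average m (multiplier \<gamma> f) - average (Suc m) (multiplier \<gamma> f))"
    by (intro sums_diff bounded_linear.sums[OF bounded_linear_average multiplier_sums[OF bv]])
  then have "?d sums (average m (multiplier \<gamma> f) - average (Suc m) (multiplier \<gamma> f))"
    by (simp add: linear_cmul[OF lin] average_average scaleR_diff_right)
  moreover have "?d sums (\<Sum>k\<in>{..m}. ?d k)"
    by (rule sums_finite) (auto simp: max_def)
  ultimately have "average m (multiplier \<gamma> f) - average (Suc m) (multiplier \<gamma> f) = (\<Sum>k\<in>{..m}. ?d k)"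
    by (rule sums_unique2)
  also have "(\<Sum>k\<in>{..m}. ?d k) = (\<Sum>k\<in>{..m}. increment \<gamma> k *\<^sub>R (average m f - average (Suc m) f))"
    by (rule sum.cong) (auto simp: max_def)
  also have "\<dots> = \<gamma> m *\<^sub>R (average m f - average (Suc m) f)"
    unfolding scaleR_sum_left[symmetric] sum_increment ..
  finally show ?thesis .
qed

lemma coord_multiplier_Abel:
  assumes bv: "bounded_variation \<gamma>"
  shows "(\<lambda>m. \<gamma> m *\<^sub>R (coord (average m f) x - coord (average (Suc m) f) x)) sums coord (multiplier \<gamma> f) x"
proof -
  define e where "e m = coord (average m f) x" for m
  have Abel: "(\<Sum>k\<le>M. increment \<gamma> k *\<^sub>R e k) = (\<Sum>m<M. \<gamma> m *\<^sub>R (e m - e (Suc m))) + \<gamma> M *\<^sub>R e M" for M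
    by (induction M) (simp_all add: increment_def algebra_simps)
  have "(\<lambda>M. \<Sum>k\<le>M. increment \<gamma> k *\<^sub>R e k) \<longlonglongrightarrow> coord (multiplier \<gamma> f) x"
    using coord_multiplier_sums[OF bv, of f x] unfolding e_def sums_def_le .
  moreover have "(\<lambda>M. \<gamma> M *\<^sub>R e M) \<longlonglongrightarrow> 0"
  proof (rule Lim_null_comparison)
    show "(\<lambda>M. variation \<gamma> * norm (e M)) \<longlonglongrightarrow> 0"
      unfolding e_def by (rule tendsto_mult_right_zero[OF tendsto_norm_zero[OF average_tendsto_0]])
    show "\<forall>\<^sub>F M in sequentially. norm (\<gamma> M *\<^sub>R e M) \<le> variation \<gamma> * norm (e M)"
      by (rule always_eventually) (auto intro!: mult_right_mono abs_le_variation[OF bv])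
  qed
  ultimately have "(\<lambda>M. (\<Sum>k\<le>M. increment \<gamma> k *\<^sub>R e k) - \<gamma> M *\<^sub>R e M) \<longlonglongrightarrow> coord (multiplier \<gamma> f) x - 0"
    by (rule tendsto_diff)
  moreover have "(\<Sum>k\<le>M. increment \<gamma> k *\<^sub>R e k) - \<gamma> M *\<^sub>R e M = (\<Sum>m<M. \<gamma> m *\<^sub>R (e m - e (Suc m)))" for M
    by (simp add: Abel)
  ultimately show ?thesis unfolding sums_def e_def by simp
qed

text \<open>Multipliers compose by multiplying symbols: Abel summation writes the composition as a sum over the levels
\<open>m\<close>, and the product 1 leaves a telescoping series.\<close>

lemma multiplier_inverse:
  assumes bv: "bounded_variation \<gamma>" "bounded_variation \<delta>" and inv: "\<And>m. \<gamma> m * \<delta> m = 1"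
  shows "multiplier \<gamma> (multiplier \<delta> f) = f"
proof (rule ell2_eqI)
  fix x
  have diff: "coord (average m (multiplier \<delta> f)) x - coord (average (Suc m) (multiplier \<delta> f)) x
      = \<delta> m *\<^sub>R (coord (average m f) x - coord (average (Suc m) f) x)" for m
    using arg_cong[OF average_multiplier_diff[OF bv(2), of m f], of "\<lambda>g. coord g x"] by (simp only: coord_simps)
  have "(\<lambda>m. coord (average m f) x - coord (average (Suc m) f) x) sums coord (multiplier \<gamma> (multiplier \<delta> f)) x"
    using coord_multiplier_Abel[OF bv(1), of "multiplier \<delta> f" x] unfolding diff by (simp add: inv)
  moreover have "(\<lambda>m. coord (average m f) x - coord (average (Suc m) f) x) sums (coord (average 0 f) x - 0)"
    by (rule telescope_sums'[OF average_tendsto_0])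
  ultimately have "coord (multiplier \<gamma> (multiplier \<delta> f)) x = coord (average 0 f) x - 0" by (rule sums_unique2)
  then show "coord (multiplier \<gamma> (multiplier \<delta> f)) x = coord f x" by (simp add: average_0)
qed

lemma multiplier_eigenvector:
  assumes bv: "bounded_variation \<gamma>" and f: "average m f = f" "average (Suc m) f = 0"
  shows "multiplier \<gamma> f = \<gamma> m *\<^sub>R f"
proof -
  have low: "average k f = f" if "k \<le> m" for k
    using average_average_le[OF that, of f] f(1) by simp
  have high: "average k f = 0" if "\<not> k \<le> m" for k
  proof -
    have "max k (Suc m) = k" using that by simp
    then show ?thesis
      using average_average[of k "Suc m" f] f(2)
      by (simp add: linear_0[OF bounded_linear.linear[OF bounded_linear_average]])
  qed
  have "(\<lambda>k. increment \<gamma> k *\<^sub>R average k f) sums (\<Sum>k\<in>{..m}. increment \<gamma> k *\<^sub>R average k f)"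
    by (rule sums_finite) (auto simp: high)
  then have "multiplier \<gamma> f = (\<Sum>k\<in>{..m}. increment \<gamma> k *\<^sub>R average k f)"
    by (rule sums_unique2[OF multiplier_sums[OF bv]])
  also have "\<dots> = (\<Sum>k\<in>{..m}. increment \<gamma> k *\<^sub>R f)" by (rule sum.cong) (auto simp: low)
  also have "\<dots> = \<gamma> m *\<^sub>R f" unfolding scaleR_sum_left[symmetric] sum_increment ..
  finally show ?thesis .
qed

lemma multiplier_diff_const:
  assumes bv: "bounded_variation \<gamma>"
  shows "bounded_variation (\<lambda>m. \<gamma> m - l)" "multiplier (\<lambda>m. \<gamma> m - l) f = multiplier \<gamma> f - l *\<^sub>R f"
proof -
  have inc: "increment (\<lambda>m. \<gamma> m - l) k = increment \<gamma> k - (if k = 0 then l else 0)" for k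
    by (simp add: increment_def split: nat.split)
  have "summable (\<lambda>k. \<bar>increment \<gamma> k\<bar>)" using bv by (simp add: bounded_variation_def)
  then show bv': "bounded_variation (\<lambda>m. \<gamma> m - l)"
    unfolding bounded_variation_def inc
    by (rule summable_comparison_test'[of _ 1]) simp
  have "(\<lambda>k. if k = 0 then l *\<^sub>R average k f else 0) sums (l *\<^sub>R average 0 f)" by (rule sums_single)
  from sums_diff[OF multiplier_sums[OF bv, of f] this]
  have "(\<lambda>k. increment \<gamma> k *\<^sub>R average k f - (if k = 0 then l *\<^sub>R average k f else 0)) sums (multiplier \<gamma> f - l *\<^sub>R f)"
    by (simp only: average_0)
  moreover have "increment (\<lambda>m. \<gamma> m - l) k *\<^sub>R average k f
      = increment \<gamma> k *\<^sub>R average k f - (if k = 0 then l *\<^sub>R average k f else 0)" for k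
    by (simp add: inc scaleR_diff_left)
  ultimately have "(\<lambda>k. increment (\<lambda>m. \<gamma> m - l) k *\<^sub>R average k f) sums (multiplier \<gamma> f - l *\<^sub>R f)"
    by (simp only:)
  then show "multiplier (\<lambda>m. \<gamma> m - l) f = multiplier \<gamma> f - l *\<^sub>R f"
    by (rule sums_unique2[OF multiplier_sums[OF bv']])
qed

definition kernel :: "(nat \<Rightarrow> real) \<Rightarrow> 'a \<Rightarrow> 'a \<Rightarrow> real" where
  "kernel \<gamma> x y = (\<Sum>k. increment \<gamma> k * average_kernel k x y)"

lemma kernel_norm_summable:
  assumes bv: "bounded_variation \<gamma>"
  shows "summable (\<lambda>k. \<bar>increment \<gamma> k * average_kernel k x y\<bar>)"
proof (rule summable_comparison_test)
  show "summable (\<lambda>k. \<bar>increment \<gamma> k\<bar>)" using bv by (simp add: bounded_variation_def)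
  have "\<bar>increment \<gamma> k * average_kernel k x y\<bar> \<le> \<bar>increment \<gamma> k\<bar>" for k
    using n_pos[of k] by (auto simp: average_kernel_def abs_mult divide_le_eq mult_left_le)
  then show "\<exists>N. \<forall>k\<ge>N. norm \<bar>increment \<gamma> k * average_kernel k x y\<bar> \<le> \<bar>increment \<gamma> k\<bar>" by simp
qed

lemma coord_average_delta: "coord (average k (delta y)) x = of_real (average_kernel k x y)"
  by (simp add: coord_average coord_delta finite_B average_kernel_def sum.delta)

lemma coord_multiplier_delta:
  assumes bv: "bounded_variation \<gamma>"
  shows "coord (multiplier \<gamma> (delta y)) x = of_real (kernel \<gamma> x y)"
proof -
  have "(\<lambda>k. increment \<gamma> k * average_kernel k x y) sums kernel \<gamma> x y"
    unfolding kernel_def by (rule summable_sums[OF summable_rabs_cancel[OF kernel_norm_summable[OF bv]]])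
  from bounded_linear.sums[OF bounded_linear_of_real this]
  have "(\<lambda>k. increment \<gamma> k *\<^sub>R coord (average k (delta y)) x) sums of_real (kernel \<gamma> x y)"
    by (simp add: coord_average_delta scaleR_conv_of_real)
  then show ?thesis by (rule sums_unique2[OF coord_multiplier_sums[OF bv]])
qed

lemma kernel_sym: "kernel \<gamma> x y = kernel \<gamma> y x"
  unfolding kernel_def by (simp only: average_kernel_sym[of _ x y])

lemma kernel_diagonal: "kernel \<gamma> x x = kernel \<gamma> y y"
  by (simp add: kernel_def average_kernel_def mem_B)

text \<open>Only the levels whose cell contains both points contribute, each with the reciprocal of its cell size.\<close>

lemma abs_kernel_le:
  assumes bv: "bounded_variation \<gamma>" and N: "0 < N" "\<And>k. y \<in> B k x \<Longrightarrow> N \<le> real (n k)"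
  shows "\<bar>kernel \<gamma> x y\<bar> \<le> variation \<gamma> / N"
proof -
  have sm: "summable (\<lambda>k. \<bar>increment \<gamma> k\<bar>)" using bv by (simp add: bounded_variation_def)
  have "\<bar>kernel \<gamma> x y\<bar> \<le> (\<Sum>k. \<bar>increment \<gamma> k * average_kernel k x y\<bar>)"
    unfolding kernel_def by (rule summable_rabs[OF kernel_norm_summable[OF bv]])
  also have "\<dots> \<le> (\<Sum>k. \<bar>increment \<gamma> k\<bar> / N)"
  proof (rule suminf_le[OF _ kernel_norm_summable[OF bv] summable_divide[OF sm]])
    fix k
    have "average_kernel k x y \<le> 1 / N" "0 \<le> average_kernel k x y"
      using N(1) N(2)[of k] by (auto simp: average_kernel_def frac_le)
    then show "\<bar>increment \<gamma> k * average_kernel k x y\<bar> \<le> \<bar>increment \<gamma> k\<bar> / N"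
      using mult_left_mono[of "average_kernel k x y" "1 / N" "\<bar>increment \<gamma> k\<bar>"] by (simp add: abs_mult)
  qed
  also have "\<dots> = variation \<gamma> / N" unfolding variation_def by (rule suminf_divide[OF sm])
  finally show ?thesis .
qed

lemma multiplier_kernel_has_sum:
  assumes bv: "bounded_variation \<gamma>"
  shows "((\<lambda>y. of_real (kernel \<gamma> x y) * coord f y) has_sum coord (multiplier \<gamma> f) x) UNIV"
proof -
  have "bounded_linear (\<lambda>f. coord (multiplier \<gamma> f) x)"
    by (rule bounded_linear_compose[OF bounded_linear_coord bounded_linear_multiplier[OF bv]])
  from has_sum_bounded_linear[OF this delta_expansion[of f]]
  show ?thesis by (simp add: o_def multiplier_cscale[OF bv] coord_cscale coord_multiplier_delta[OF bv] mult.commute)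
qed

end

section \<open>The hierarchical Laplacian\<close>

context homogeneous_partitions
begin

lemma linear_average: "linear (average k)"
  by (rule bounded_linear.linear[OF bounded_linear_average])

text \<open>Supported on a cell of level \<open>Suc m\<close>, with mean 0 there, and constant on its subcells of level \<open>m\<close>: an
eigenfunction of every multiplier.\<close>

definition wave :: "nat \<Rightarrow> 'a \<Rightarrow> 'a ell2" where
  "wave m x = average m (delta x) - average (Suc m) (delta x)"

lemma average_wave: "average m (wave m x) = wave m x" "average (Suc m) (wave m x) = 0"
  by (simp_all add: wave_def linear_diff[OF linear_average] average_average max_def)

lemma coord_wave_outside: "y \<notin> B (Suc m) x \<Longrightarrow> coord (wave m x) y = 0"
  using B_mono[of m "Suc m" x] B_sym[of y m x] B_sym[of y "Suc m" x]
  by (auto simp: wave_def coord_diff coord_average_delta average_kernel_def)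

lemma wave_nonzero: "wave m x \<noteq> 0"
proof
  assume "wave m x = 0"
  then have "coord (wave m x) x = 0" by (simp add: coord_zero)
  then have "of_real (1 / real (n m)) - of_real (1 / real (n (Suc m))) = (0 :: complex)"
    by (simp only: wave_def coord_diff coord_average_delta average_kernel_def mem_B if_True)
  then have "1 / real (n m) = 1 / real (n (Suc m))" by (simp only: of_real_diff[symmetric] of_real_eq_0_iff right_minus_eq)
  then have "n m = n (Suc m)" by simp
  then show False using strict_mono_n strict_mono_less[of n m "Suc m"] by simp
qed

end

text \<open>The \<open>c k\<close> are the values of the choice function on the balls of level \<open>k\<close>.\<close>

locale hierarchical_symbol = homogeneous_partitions B n
  for B :: "nat \<Rightarrow> 'a \<Rightarrow> 'a set" and n +
  fixes c :: "nat \<Rightarrow> real"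
  assumes c_pos: "0 < c k" and summable_c: "summable c"
begin

text \<open>These are the eigenvalues of the Laplacian: on functions that are constant on cells of level \<open>m\<close> and have mean 0
on those of level \<open>Suc m\<close>, averages are the identity up to level \<open>m\<close> and 0 from then on.\<close>

definition tail :: "nat \<Rightarrow> real" where
  "tail m = (\<Sum>k. c (k + Suc m))"

lemma tail_eq: "tail m = suminf c - (\<Sum>k<Suc m. c k)"
  unfolding tail_def by (rule suminf_minus_initial_segment[OF summable_c])

lemma tail_Suc: "tail (Suc m) = tail m - c (Suc m)"
  by (simp add: tail_eq)

lemma tail_tendsto_0: "tail \<longlonglongrightarrow> 0"
proof -
  have "(\<lambda>m. suminf c - (\<Sum>k<Suc m. c k)) \<longlonglongrightarrow> suminf c - suminf c"
    by (intro tendsto_diff tendsto_const LIMSEQ_Suc summable_LIMSEQ summable_c)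
  then show ?thesis unfolding tail_eq[abs_def] by simp
qed

lemma bounded_variation_tail: "bounded_variation tail"
proof -
  have "\<bar>increment tail (Suc k)\<bar> = c (Suc k)" for k
    using c_pos[of "Suc k"] by (simp add: increment_def tail_Suc)
  then have "summable (\<lambda>k. \<bar>increment tail (Suc k)\<bar>)"
    using summable_c by (simp only: summable_Suc_iff)
  then show ?thesis
    unfolding bounded_variation_def by (simp only: summable_Suc_iff[of "\<lambda>k. \<bar>increment tail k\<bar>"])
qed

text \<open>The increments of \<open>tail\<close> are \<open>- c (Suc k)\<close>, the coefficients of the averages in the Laplacian, and its first
value \<open>tail 0\<close> collects the weights of \<open>f x\<close> itself.\<close>

lemma laplacian_sums:
  "(\<lambda>k. c k *\<^sub>R (coord f x - coord (average k f) x)) sums coord (multiplier tail f) x"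
proof -
  let ?b = "\<lambda>k. (if k = 0 then - tail 0 else c k) *\<^sub>R coord f x"
  have "(\<lambda>k. c (Suc k)) sums tail 0"
    unfolding tail_def using summable_sums[OF summable_ignore_initial_segment[OF summable_c, of 1]] by simp
  then have "(\<lambda>k. ?b (Suc k)) sums (tail 0 *\<^sub>R coord f x)"
    using sums_scaleR_left[of "\<lambda>k. c (Suc k)" "tail 0" "coord f x"] by simp
  then have "?b sums (tail 0 *\<^sub>R coord f x + ?b 0)" by (rule sums_Suc)
  then have "?b sums 0" by simp
  from sums_add[OF this coord_multiplier_sums[OF bounded_variation_tail, of f x]]
  have "(\<lambda>k. ?b k + increment tail k *\<^sub>R coord (average k f) x) sums coord (multiplier tail f) x" by simp
  moreover have "?b k + increment tail k *\<^sub>R coord (average k f) x = c k *\<^sub>R (coord f x - coord (average k f) x)" for k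
    by (cases k) (simp_all add: increment_def tail_Suc average_0 scaleR_diff_right)
  ultimately show ?thesis by (simp only:)
qed

definition resolvent_symbol :: "real \<Rightarrow> nat \<Rightarrow> real" where
  "resolvent_symbol l m = 1 / (tail m - l)"

text \<open>The real points outside the spectrum of the Laplacian, by \<open>Spec_L_iff\<close> below; 0 is the limit of the eigenvalues.\<close>

definition regular :: "real \<Rightarrow> bool" where
  "regular l \<longleftrightarrow> l \<noteq> 0 \<and> l \<notin> range tail"

lemma bounded_variation_resolvent_symbol:
  assumes "regular l"
  shows "bounded_variation (resolvent_symbol l)"
proof -
  have l: "l \<noteq> 0" "tail m \<noteq> l" for m using assms by (auto simp: regular_def)
  have "resolvent_symbol l \<longlonglongrightarrow> 1 / (0 - l)"
    unfolding resolvent_symbol_def[abs_def] using l by (intro tendsto_divide tendsto_diff tendsto_const tail_tendsto_0) auto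
  then obtain K where K: "0 < K" "\<And>m. norm (resolvent_symbol l m) \<le> K"
    using convergent_imp_Bseq[OF convergentI] by (metis BseqE)
  have inc: "increment (resolvent_symbol l) (Suc k) = c (Suc k) * (resolvent_symbol l k * resolvent_symbol l (Suc k))" for k
    using l(2)[of k] l(2)[of "Suc k"] tail_Suc[of k]
    by (simp add: increment_def resolvent_symbol_def field_simps)
  have "summable (\<lambda>k. \<bar>increment (resolvent_symbol l) (Suc k)\<bar>)"
  proof (rule summable_comparison_test)
    show "summable (\<lambda>k. c (Suc k) * (K * K))"
      using summable_c by (intro summable_mult2) (simp only: summable_Suc_iff)
    have "\<bar>increment (resolvent_symbol l) (Suc k)\<bar> \<le> c (Suc k) * (K * K)" for k
      unfolding inc abs_mult using K(2)[of k] K(2)[of "Suc k"] c_pos[of "Suc k"] K(1)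
      by (auto intro!: mult_mono)
    then show "\<exists>N. \<forall>k\<ge>N. norm \<bar>increment (resolvent_symbol l) (Suc k)\<bar> \<le> c (Suc k) * (K * K)" by simp
  qed
  then show ?thesis
    unfolding bounded_variation_def by (simp only: summable_Suc_iff[of "\<lambda>k. \<bar>increment (resolvent_symbol l) k\<bar>"])
qed

lemma resolvent_inverse:
  assumes "regular l"
  shows "multiplier (resolvent_symbol l) (multiplier tail f - l *\<^sub>R f) = f"
    and "multiplier tail (multiplier (resolvent_symbol l) f) - l *\<^sub>R multiplier (resolvent_symbol l) f = f"
proof -
  note shift = multiplier_diff_const[OF bounded_variation_tail, of l]
  have inv: "resolvent_symbol l m * (tail m - l) = 1" "(tail m - l) * resolvent_symbol l m = 1" for m
    using assms by (auto simp: resolvent_symbol_def regular_def)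
  show "multiplier (resolvent_symbol l) (multiplier tail f - l *\<^sub>R f) = f"
    unfolding shift(2)[symmetric]
    by (rule multiplier_inverse[OF bounded_variation_resolvent_symbol[OF assms] shift(1) inv(1)])
  show "multiplier tail (multiplier (resolvent_symbol l) f) - l *\<^sub>R multiplier (resolvent_symbol l) f = f"
    unfolding shift(2)[symmetric]
    by (rule multiplier_inverse[OF shift(1) bounded_variation_resolvent_symbol[OF assms] inv(2)])
qed

lemma wave_eigenvector: "multiplier tail (wave m x) = tail m *\<^sub>R wave m x"
  by (rule multiplier_eigenvector[OF bounded_variation_tail average_wave])

end

locale hierarchical_operator = hierarchical_symbol B n c
  for B :: "nat \<Rightarrow> 'a \<Rightarrow> 'a set" and n c +
  fixes L :: "('a \<Rightarrow> complex) \<Rightarrow> 'a \<Rightarrow> complex"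
  assumes coord_L: "coord (multiplier tail f) = L (coord f)"
begin

sublocale L: selfadjoint_l2 L "multiplier tail"
  by (rule selfadjoint_l2.intro)
    (simp_all add: bounded_linear_multiplier bounded_variation_tail symmetric_multiplier multiplier_cscale coord_L)

lemma regular_bounded_below:
  assumes "regular l"
  shows "bounded_below (\<lambda>f. multiplier tail f - l *\<^sub>R f)"
  unfolding bounded_below_def
proof (intro exI[of _ "1 / (variation (resolvent_symbol l) + 1)"] conjI allI)
  let ?V = "variation (resolvent_symbol l)"
  note bv = bounded_variation_resolvent_symbol[OF assms]
  show "0 < 1 / (?V + 1)" using variation_nonneg[OF bv] by simp
  fix f
  let ?g = "multiplier tail f - l *\<^sub>R f"
  have "norm f \<le> ?V * norm ?g"
    using norm_multiplier_le[OF bv, of ?g] by (simp only: resolvent_inverse(1)[OF assms])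
  also have "\<dots> \<le> (?V + 1) * norm ?g" by (intro mult_right_mono) auto
  finally show "1 / (?V + 1) * norm f \<le> norm ?g"
    using variation_nonneg[OF bv] by (simp add: pos_divide_le_eq mult.commute)
qed

lemma wave_not_bounded_below: "\<not> bounded_below (\<lambda>f. multiplier tail f - tail m *\<^sub>R f)"
proof
  assume "bounded_below (\<lambda>f. multiplier tail f - tail m *\<^sub>R f)"
  then obtain d where "0 < d" and d: "\<And>f. d * norm f \<le> norm (multiplier tail f - tail m *\<^sub>R f)"
    by (auto simp: bounded_below_def)
  have "d * norm (wave m undefined) \<le> 0" using d[of "wave m undefined"] by (simp add: wave_eigenvector)
  then show False using \<open>0 < d\<close> wave_nonzero[of m undefined] by (simp add: mult_le_0_iff)
qed

lemma multiplier_tail_not_bounded_below: "\<not> bounded_below (multiplier tail)"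
proof
  assume "bounded_below (multiplier tail)"
  then obtain d where "0 < d" and d: "\<And>f. d * norm f \<le> norm (multiplier tail f)"
    by (auto simp: bounded_below_def)
  have "d \<le> \<bar>tail m\<bar>" for m
    using d[of "wave m undefined"] wave_nonzero[of m undefined] by (simp add: wave_eigenvector)
  then have "d \<le> \<bar>0\<bar>" by (intro LIMSEQ_le_const[OF tendsto_rabs[OF tail_tendsto_0]]) auto
  then show False using \<open>0 < d\<close> by simp
qed

lemma Spec_L_iff: "of_real l \<in> Spec L \<longleftrightarrow> \<not> regular l"
proof -
  have "of_real l \<in> Spec L" if nr: "\<not> regular l"
  proof (cases "l = 0")
    case True
    then show ?thesis using L.of_real_not_in_Spec_iff[of 0] multiplier_tail_not_bounded_below by simp
  next
    case False
    then obtain m where "l = tail m" using nr unfolding regular_def by blast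
    then show ?thesis using L.of_real_not_in_Spec_iff[of l] wave_not_bounded_below[of m] by blast
  qed
  moreover have "of_real l \<notin> Spec L" if "regular l"
    unfolding L.of_real_not_in_Spec_iff by (rule regular_bounded_below[OF that])
  ultimately show ?thesis by blast
qed

text \<open>The kernel is unique because a kernel is recovered from its action on point masses.\<close>

lemma integral_kernel_resolvent:
  assumes "regular l"
  shows "integral_kernel (resolvent L (of_real l)) x y = of_real (kernel (resolvent_symbol l) x y)"
proof -
  let ?R = "multiplier (resolvent_symbol l)" and ?T = "resolvent L (of_real l)"
  let ?k = "\<lambda>x y. of_real (kernel (resolvent_symbol l) x y) :: complex"
  note bv = bounded_variation_resolvent_symbol[OF assms]
  have "bounded_below (L.shift (of_real l))"
    using regular_bounded_below[OF assms] by (simp add: L.shift_def[abs_def] cscale_of_real)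
  then have bij: "bij (L.shift (of_real l))" by (intro L.bij_shift) blast
  have T: "?T (coord f) = coord (?R f)" for f
    by (rule L.resolvent_coord[OF bij]) (simp add: L.shift_def cscale_of_real resolvent_inverse(2)[OF assms])
  have "integral_kernel ?T = ?k"
    unfolding integral_kernel_def
  proof (rule the_equality)
    show "\<forall>f\<in>l2. \<forall>x. ((\<lambda>y. ?k x y * f y) has_sum ?T f x) UNIV"
    proof (intro ballI allI)
      fix f :: "'a \<Rightarrow> complex" and x assume "f \<in> l2"
      then obtain F where F: "f = coord F" by (rule L.l2_obtain)
      show "((\<lambda>y. ?k x y * f y) has_sum ?T f x) UNIV"
        unfolding F T by (rule multiplier_kernel_has_sum[OF bv])
    qed
  next
    fix K assume K: "\<forall>f\<in>l2. \<forall>x. ((\<lambda>y. K x y * f y) has_sum ?T f x) UNIV"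
    show "K = ?k"
    proof (intro ext)
      fix x y
      have "((\<lambda>z. K x z * coord (delta y) z) has_sum coord (?R (delta y)) x) UNIV"
        using K coord_in_l2[of "delta y"] unfolding T[symmetric] by blast
      moreover have "((\<lambda>z. K x z * coord (delta y) z) has_sum (\<Sum>z\<in>{y}. K x z * coord (delta y) z)) UNIV"
        by (rule has_sum_finite_neutralI[of "{y}"]) (auto simp: coord_delta)
      ultimately have "coord (?R (delta y)) x = (\<Sum>z\<in>{y}. K x z * coord (delta y) z)" by (rule has_sum_unique)
      then show "K x y = ?k x y"
        by (simp add: coord_delta coord_multiplier_delta[OF bv])
    qed
  qed
  then show ?thesis by simp
qed

end

section \<open>Sparse potential wells\<close>

definition multiply :: "('a \<Rightarrow> real) \<Rightarrow> 'a ell2 \<Rightarrow> 'a ell2" where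
  "multiply w f = Abs_ell2 (\<lambda>x. of_real (w x) * coord f x)"

lemma coord_multiply:
  assumes "\<And>x. \<bar>w x\<bar> \<le> K"
  shows "coord (multiply w f) x = of_real (w x) * coord f x"
proof -
  have "(\<lambda>x. of_real (w x) * coord f x) \<in> l2"
  proof (rule l2_dominated_by[OF l2_cmult[OF coord[of f], of "of_real K"]])
    show "cmod (of_real (w x) * coord f x) \<le> cmod (of_real K * coord f x)" for x
      using assms[of x] by (simp add: norm_mult mult_right_mono)
  qed
  then show ?thesis by (simp add: multiply_def Abs_ell2_inverse)
qed

lemma norm_multiply_le:
  assumes "\<And>x. \<bar>w x\<bar> \<le> K"
  shows "norm (multiply w f) \<le> K * norm f"
proof -
  have K: "0 \<le> K" using assms[of undefined] by linarith
  have "norm (multiply w f) \<le> norm (K *\<^sub>R f)"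
    by (rule norm_ell2_mono) (use assms K in \<open>simp add: coord_multiply[OF assms] coord_scaleR norm_mult mult_right_mono\<close>)
  then show ?thesis using K by simp
qed

lemma bounded_linear_multiply:
  assumes "\<And>x. \<bar>w x\<bar> \<le> K"
  shows "bounded_linear (multiply w)"
proof (rule bounded_linear_intro[where K = K])
  show "multiply w (f + g) = multiply w f + multiply w g" for f g
    by (rule ell2_eqI) (simp add: coord_simps coord_multiply[OF assms] distrib_left)
  show "multiply w (r *\<^sub>R f) = r *\<^sub>R multiply w f" for r f
    by (rule ell2_eqI) (simp add: coord_simps coord_multiply[OF assms])
  show "norm (multiply w f) \<le> norm f * K" for f
    using norm_multiply_le[OF assms, where f = f] by (simp add: mult.commute)
qed

lemma symmetric_multiply:
  assumes "\<And>x. \<bar>w x\<bar> \<le> K"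
  shows "symmetric (multiply w)"
  unfolding symmetric_def inner_ell2_def
  by (simp add: coord_multiply[OF assms] inner_mult_left inner_mult_right flip: scaleR_conv_of_real)

lemma multiply_cscale:
  assumes "\<And>x. \<bar>w x\<bar> \<le> K"
  shows "multiply w (cscale c f) = cscale c (multiply w f)"
  by (rule ell2_eqI) (simp add: coord_cscale coord_multiply[OF assms] mult.left_commute)

lemma norm_restrict_to_finite:
  assumes F: "finite F"
  shows "norm (restrict_to F f) \<le> (\<Sum>x\<in>F. cmod (coord f x))"
proof -
  have "restrict_to F f = (\<Sum>x\<in>F. cscale (coord f x) (delta x))"
    by (rule ell2_eqI)
      (simp add: coord_restrict_to coord_sum coord_cscale coord_delta F if_distrib[of "(*) _"] cong: if_cong)
  also have "norm \<dots> \<le> (\<Sum>x\<in>F. norm (cscale (coord f x) (delta x)))" by (rule norm_sum)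
  also have "\<dots> = (\<Sum>x\<in>F. cmod (coord f x))" by (simp add: norm_cscale norm_delta)
  finally show ?thesis .
qed

text \<open>Here \<open>w\<close> is the negative of the potential, and sparseness is stated with finite sums of reals, as the Schur
test uses it.\<close>

locale sparse_wells = hierarchical_operator "\<lambda>k (x :: 'a :: metric_space). cball x (real (n k))" n c L
  for n c and L :: "('a :: metric_space \<Rightarrow> complex) \<Rightarrow> 'a \<Rightarrow> complex" +
  fixes a :: "nat \<Rightarrow> 'a :: metric_space" and \<sigma> :: "nat \<Rightarrow> real" and \<alpha> \<beta> :: real
    and w :: "'a :: metric_space \<Rightarrow> real"
    and H :: "('a :: metric_space \<Rightarrow> complex) \<Rightarrow> 'a \<Rightarrow> complex"
  assumes finite_cball: "finite (cball (x :: 'a :: metric_space) r)"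
    and inj_a: "inj a"
    and \<alpha>_pos: "0 < \<alpha>"
    and \<sigma>_bounds: "\<alpha> < \<sigma> i" "\<sigma> i < \<beta>"
    and w_a: "w (a i) = \<sigma> i"
    and w_outside: "x \<notin> range a \<Longrightarrow> w x = 0"
    and H_def: "H f x = L f x - of_real (w x) * f x"
    and sparse: "0 < \<epsilon> \<Longrightarrow>
      \<exists>N. \<forall>i\<ge>N. \<forall>J. finite J \<longrightarrow> J \<subseteq> {N..} - {i} \<longrightarrow> (\<Sum>j\<in>J. 1 / dist (a i) (a j)) \<le> \<epsilon>"
begin

lemma \<beta>_pos: "0 < \<beta>"
  using \<alpha>_pos \<sigma>_bounds[of 0] by linarith

lemma \<sigma>_pos: "0 < \<sigma> i"
  using \<alpha>_pos \<sigma>_bounds(1)[of i] by linarith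

lemma w_bound: "\<bar>w x\<bar> \<le> \<beta>"
  using \<beta>_pos w_outside[of x] \<sigma>_pos \<sigma>_bounds(2) by (cases "x \<in> range a") (auto simp: w_a less_imp_le)

definition hamiltonian :: "'a ell2 \<Rightarrow> 'a ell2" where
  "hamiltonian f = multiplier tail f - multiply w f"

sublocale H: selfadjoint_l2 H hamiltonian
proof (rule selfadjoint_l2.intro)
  show "bounded_linear hamiltonian"
    unfolding hamiltonian_def[abs_def]
    by (intro bounded_linear_sub bounded_linear_multiplier bounded_variation_tail bounded_linear_multiply[OF w_bound])
  show "symmetric hamiltonian"
    using symmetric_multiplier[OF bounded_variation_tail] symmetric_multiply[OF w_bound]
    by (simp add: symmetric_def hamiltonian_def inner_diff_left inner_diff_right)
  show "hamiltonian (cscale c f) = cscale c (hamiltonian f)" for c f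
    by (simp add: hamiltonian_def multiplier_cscale[OF bounded_variation_tail] multiply_cscale[OF w_bound]
        linear_diff[OF bounded_linear.linear[OF bounded_linear_cscale]])
  show "coord (hamiltonian f) = H (coord f)" for f
    by (rule ext) (simp add: hamiltonian_def coord_diff coord_multiply[OF w_bound] coord_L H_def)
qed

lemma abs_kernel_le_dist:
  assumes "bounded_variation \<gamma>" "x \<noteq> y"
  shows "\<bar>kernel \<gamma> x y\<bar> \<le> variation \<gamma> / dist x y"
  by (rule abs_kernel_le[OF assms(1)]) (use assms(2) in auto)

lemma dist_a_at_top: "filterlim (\<lambda>i. dist x (a i)) at_top sequentially"
  unfolding filterlim_at_top
proof
  fix Z
  have "finite (a -` cball x Z)" by (rule finite_vimageI[OF finite_cball inj_a])
  then obtain M where M: "\<And>i. i \<in> a -` cball x Z \<Longrightarrow> i < M" by (metis finite_nat_set_iff_bounded)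
  have "Z \<le> dist x (a i)" if "M \<le> i" for i
    using M[of i] that by force
  then show "\<forall>\<^sub>F i in sequentially. Z \<le> dist x (a i)" by (auto simp: eventually_sequentially)
qed

lemma kernel_a_tendsto_0:
  assumes bv: "bounded_variation \<gamma>"
  shows "(\<lambda>i. kernel \<gamma> x (a i)) \<longlonglongrightarrow> 0"
proof (rule Lim_null_comparison)
  show "(\<lambda>i. variation \<gamma> / dist x (a i)) \<longlonglongrightarrow> 0"
    by (rule real_tendsto_divide_at_top[OF tendsto_const dist_a_at_top])
  have "\<forall>\<^sub>F i in sequentially. 1 \<le> dist x (a i)"
    using dist_a_at_top by (simp add: filterlim_at_top)
  then show "\<forall>\<^sub>F i in sequentially. norm (kernel \<gamma> x (a i)) \<le> variation \<gamma> / dist x (a i)"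
  proof eventually_elim
    case (elim i)
    then have "x \<noteq> a i" by auto
    then show ?case using abs_kernel_le_dist[OF bv] by simp
  qed
qed

text \<open>With \<open>u = w f\<close> and \<open>g = (H - l) f\<close>, the function \<open>f\<close> is \<open>R g + R u\<close>. Evaluating this at the wells of index at
least \<open>N\<close> gives a system for their part \<open>u1\<close> of \<open>u\<close> whose diagonal is at least \<open>\<eta>\<close> in modulus and whose
off-diagonal part \<open>k\<close> has norm at most \<open>\<eta>/2\<close>. The finitely many remaining wells form \<open>F\<close>.\<close>

lemma resolvent_estimate:
  assumes reg: "regular l" and \<eta>: "0 < \<eta>"
    and gap: "\<And>i. N0 \<le> i \<Longrightarrow> \<eta> \<le> \<bar>1 / \<sigma> i - kernel (resolvent_symbol l) p p\<bar>"
  shows "\<exists>F D. finite F \<and> (\<forall>f. norm f \<le> D * (norm (hamiltonian f - l *\<^sub>R f) + (\<Sum>x\<in>F. cmod (coord f x))))"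
proof -
  define R where "R = multiplier (resolvent_symbol l)"
  define \<rho> where "\<rho> = kernel (resolvent_symbol l) p p"
  define V where "V = variation (resolvent_symbol l)"
  note bv = bounded_variation_resolvent_symbol[OF reg]
  have V: "0 \<le> V" unfolding V_def by (rule variation_nonneg[OF bv])
  have R_lin: "bounded_linear R" unfolding R_def by (rule bounded_linear_multiplier[OF bv])
  have R_le: "norm (R f) \<le> V * norm f" for f unfolding R_def V_def by (rule norm_multiplier_le[OF bv])
  have "0 < \<eta> / (2 * (V + 1))" using \<eta> V by simp
  from sparse[OF this] obtain N1 where sparse_N1: "\<forall>i\<ge>N1. \<forall>J. finite J \<longrightarrow> J \<subseteq> {N1..} - {i} \<longrightarrow>
      (\<Sum>j\<in>J. 1 / dist (a i) (a j)) \<le> \<eta> / (2 * (V + 1))" ..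
  have N1: "(\<Sum>j\<in>J. 1 / dist (a i) (a j)) \<le> \<eta> / (2 * (V + 1))"
    if "N1 \<le> i" "finite J" "J \<subseteq> {N1..} - {i}" for i J
    using sparse_N1 that by (simp only: not_False_eq_True)
  define N where "N = max N0 N1"
  define A where "A = a ` {N..}"
  define F where "F = a ` {..<N}"
  have AF: "A \<inter> F = {}" "A \<union> F = range a"
  proof -
    show "A \<inter> F = {}" by (auto simp: A_def F_def inj_eq[OF inj_a])
    have "{N..} \<union> {..<N} = UNIV" by auto
    then show "A \<union> F = range a" unfolding A_def F_def by (simp only: image_Un[symmetric])
  qed
  have finF: "finite F" by (simp add: F_def)
  define k where "k x y = (if x \<in> A \<and> y \<in> A \<and> x \<noteq> y then kernel (resolvent_symbol l) x y else 0)" for x y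
  have k_sym: "k x y = k y x" for x y
  proof (cases "x \<in> A \<and> y \<in> A \<and> x \<noteq> y")
    case True
    moreover from this have "y \<noteq> x" by blast
    ultimately show ?thesis by (simp add: k_def kernel_sym[of _ x y])
  qed (auto simp: k_def)
  have k_row: "(\<Sum>y\<in>S. \<bar>k x y\<bar>) \<le> \<eta> / 2" if S: "finite S" for x S
  proof (cases "x \<in> A")
    case False
    then show ?thesis using \<eta> by (simp add: k_def)
  next
    case True
    then obtain i where i: "N \<le> i" "x = a i" by (auto simp: A_def)
    define J where "J = {j. N \<le> j \<and> j \<noteq> i \<and> a j \<in> S}"
    have finJ: "finite J"
      by (rule finite_subset[OF _ finite_vimageI[OF S inj_a]]) (auto simp: J_def)
    have injJ: "inj_on a J" using inj_a by (rule inj_on_subset) simp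
    have "(\<Sum>y\<in>S. \<bar>k x y\<bar>) = (\<Sum>y\<in>a ` J. \<bar>k x y\<bar>)"
      by (rule sum.mono_neutral_right[OF S]) (auto simp: J_def k_def A_def i)
    also have "\<dots> = (\<Sum>j\<in>J. \<bar>k x (a j)\<bar>)" by (simp add: sum.reindex[OF injJ])
    also have "\<dots> \<le> (\<Sum>j\<in>J. V * (1 / dist (a i) (a j)))"
    proof (rule sum_mono)
      fix j assume "j \<in> J"
      then have "a i \<noteq> a j" by (auto simp: J_def inj_eq[OF inj_a])
      then show "\<bar>k x (a j)\<bar> \<le> V * (1 / dist (a i) (a j))"
        using abs_kernel_le_dist[OF bv, of "a i" "a j"] V by (simp add: k_def i V_def)
    qed
    also have "\<dots> \<le> V * (\<eta> / (2 * (V + 1)))"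
      unfolding sum_distrib_left[symmetric]
      by (rule mult_left_mono[OF N1 V]) (use i finJ in \<open>auto simp: N_def J_def\<close>)
    also have "\<dots> \<le> \<eta> / 2"
    proof -
      have "V * (\<eta> / (2 * (V + 1))) = V / (V + 1) * (\<eta> / 2)" by simp
      also have "\<dots> \<le> 1 * (\<eta> / 2)" using V \<eta> by (intro mult_right_mono) auto
      finally show ?thesis by simp
    qed
    finally show ?thesis .
  qed
  have bound: "norm f \<le> V * (1 + 2 * V / \<eta>) * max 1 \<beta> * (norm (hamiltonian f - l *\<^sub>R f) + (\<Sum>x\<in>F. cmod (coord f x)))" for f
  proof -
    define u where "u = multiply w f"
    define u1 where "u1 = restrict_to A u"
    define u2 where "u2 = restrict_to F u"
    define g where "g = hamiltonian f - l *\<^sub>R f"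
    have u_eq: "coord u x = of_real (w x) * coord f x" for x unfolding u_def by (rule coord_multiply[OF w_bound])
    have u12: "u = u1 + u2"
    proof (rule ell2_eqI)
      fix x
      show "coord u x = coord (u1 + u2) x"
        using AF w_outside[of x] by (auto simp: u1_def u2_def coord_add coord_restrict_to u_eq)
    qed
    have "g + u = multiplier tail f - l *\<^sub>R f" by (simp add: g_def u_def hamiltonian_def)
    then have "R (g + u) = f" unfolding R_def by (simp only: resolvent_inverse(1)[OF reg])
    moreover have "R (g + u) = R g + R u1 + R u2"
      by (simp add: u12 linear_add[OF bounded_linear.linear[OF R_lin]])
    ultimately have f_eq: "f = R g + R u1 + R u2" by (rule trans[OF sym])
    obtain h where h: "norm h \<le> \<eta> / 2 * norm u1" "\<And>x. coord h x = (\<Sum>\<^sub>\<infinity>y. of_real (k x y) * coord u1 y)"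
      using Schur_test(2)[of k "\<eta> / 2" u1, OF k_row k_sym] by blast
    have diag: "coord (R u1) x = of_real \<rho> * coord u1 x + coord h x" if x: "x \<in> A" for x
    proof -
      let ?d = "\<lambda>y. if y = x then of_real \<rho> * coord u1 x else 0"
      have "((\<lambda>y. of_real (k x y) * coord u1 y) has_sum coord h x) UNIV"
        unfolding h(2) by (rule has_sum_infsum[OF Schur_test(1)[OF k_row k_sym]])
      moreover have "(?d has_sum sum ?d {x}) UNIV"
        by (rule has_sum_finite_neutralI[of "{x}"]) auto
      ultimately have "((\<lambda>y. of_real (k x y) * coord u1 y + ?d y)
          has_sum (coord h x + sum ?d {x})) UNIV"
        by (rule has_sum_add)
      moreover have "of_real (k x y) * coord u1 y + ?d y
          = of_real (kernel (resolvent_symbol l) x y) * coord u1 y" for y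
        using x by (auto simp: k_def u1_def coord_restrict_to \<rho>_def kernel_diagonal[of _ x p])
      ultimately have "((\<lambda>y. of_real (kernel (resolvent_symbol l) x y) * coord u1 y)
          has_sum (coord h x + sum ?d {x})) UNIV"
        by (simp only:)
      from has_sum_unique[OF multiplier_kernel_has_sum[OF bv] this]
      show ?thesis by (simp add: R_def add.commute)
    qed
    have "norm (\<eta> *\<^sub>R u1) \<le> norm (R g + R u2 + h)"
    proof (rule norm_ell2_mono)
      fix x
      show "cmod (coord (\<eta> *\<^sub>R u1) x) \<le> cmod (coord (R g + R u2 + h) x)"
      proof (cases "x \<in> A")
        case True
        then obtain i where i: "N \<le> i" "x = a i" by (auto simp: A_def)
        have "coord u1 x = of_real (\<sigma> i) * coord f x"
          using True by (simp add: u1_def coord_restrict_to u_eq i w_a)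
        then have "coord f x = of_real (1 / \<sigma> i) * coord u1 x" using \<sigma>_pos[of i] by simp
        moreover have "coord f x = coord (R g) x + (of_real \<rho> * coord u1 x + coord h x) + coord (R u2) x"
          unfolding diag[OF True, symmetric] coord_add[symmetric] f_eq[symmetric] ..
        ultimately have sum_eq: "coord (R g) x + (of_real \<rho> * coord u1 x + coord h x) + coord (R u2) x
            = of_real (1 / \<sigma> i) * coord u1 x" by (simp only:)
        have "coord (R g + R u2 + h) x
            = coord (R g) x + (of_real \<rho> * coord u1 x + coord h x) + coord (R u2) x - of_real \<rho> * coord u1 x"
          by (simp add: coord_add algebra_simps)
        also have "\<dots> = of_real (1 / \<sigma> i - \<rho>) * coord u1 x"
          unfolding sum_eq by (simp only: of_real_diff left_diff_distrib)
        finally have "coord (R g + R u2 + h) x = of_real (1 / \<sigma> i - \<rho>) * coord u1 x" .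
        moreover have "\<eta> \<le> \<bar>1 / \<sigma> i - \<rho>\<bar>" unfolding \<rho>_def by (rule gap) (use i in \<open>simp add: N_def\<close>)
        ultimately show ?thesis
          using \<eta> by (simp only: norm_mult norm_of_real coord_scaleR norm_scaleR) (simp add: mult_right_mono)
      qed (simp add: u1_def coord_scaleR coord_restrict_to)
    qed
    also have "\<dots> \<le> norm (R g) + norm (R u2) + norm h"
      using norm_triangle_ineq[of "R g + R u2" h] norm_triangle_ineq[of "R g" "R u2"] by linarith
    also have "\<dots> \<le> V * norm g + V * norm u2 + \<eta> / 2 * norm u1"
      by (intro add_mono R_le h(1))
    finally have "\<eta> / 2 * norm u1 \<le> V * (norm g + norm u2)" using \<eta> by (simp add: algebra_simps)
    then have u1_le: "norm u1 \<le> 2 * V / \<eta> * (norm g + norm u2)" using \<eta> by (simp add: field_simps)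
    have u2_le: "norm u2 \<le> \<beta> * (\<Sum>x\<in>F. cmod (coord f x))"
    proof -
      have "norm u2 \<le> (\<Sum>x\<in>F. cmod (coord u x))" unfolding u2_def by (rule norm_restrict_to_finite[OF finF])
      also have "\<dots> \<le> (\<Sum>x\<in>F. \<beta> * cmod (coord f x))"
        unfolding u_eq norm_mult norm_of_real by (intro sum_mono mult_right_mono w_bound) auto
      finally show ?thesis by (simp add: sum_distrib_left)
    qed
    have "norm f \<le> norm (R g) + norm (R u1) + norm (R u2)"
      using arg_cong[OF f_eq, of norm] norm_triangle_ineq[of "R g + R u1" "R u2"]
        norm_triangle_ineq[of "R g" "R u1"] by linarith
    also have "\<dots> \<le> V * norm g + V * norm u1 + V * norm u2" by (intro add_mono R_le)
    also have "\<dots> = V * (norm g + norm u2 + norm u1)" by (simp add: algebra_simps)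
    also have "\<dots> \<le> V * (norm g + norm u2 + 2 * V / \<eta> * (norm g + norm u2))"
      using V u1_le by (intro mult_left_mono add_left_mono) auto
    also have "\<dots> = V * (1 + 2 * V / \<eta>) * (norm g + norm u2)" by (simp add: algebra_simps)
    also have "\<dots> \<le> V * (1 + 2 * V / \<eta>) * (max 1 \<beta> * (norm g + (\<Sum>x\<in>F. cmod (coord f x))))"
    proof (rule mult_left_mono)
      have "norm g \<le> max 1 \<beta> * norm g" using mult_right_mono[of 1 "max 1 \<beta>" "norm g"] by simp
      moreover have "norm u2 \<le> max 1 \<beta> * (\<Sum>x\<in>F. cmod (coord f x))"
        using u2_le mult_right_mono[of \<beta> "max 1 \<beta>" "\<Sum>x\<in>F. cmod (coord f x)"] by (simp add: sum_nonneg)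
      ultimately show "norm g + norm u2 \<le> max 1 \<beta> * (norm g + (\<Sum>x\<in>F. cmod (coord f x)))"
        by (simp add: distrib_left)
    qed (use V \<eta> in simp)
    finally show ?thesis by (simp add: g_def mult.assoc)
  qed
  show ?thesis by (intro exI conjI allI, rule finF, rule bound)
qed

text \<open>\<open>H - l\<close> maps \<open>R \<delta>\<^bsub>a i\<^esub>\<close> to \<open>(1 - \<sigma> i / s) \<delta>\<^bsub>a i\<^esub>\<close> minus its values at the other wells, weighted by \<open>w\<close>.
The first term tends to 0 along \<open>r\<close>. In the second, wells of large index contribute little by sparseness, and
finitely many others are left behind as \<open>a i\<close> moves away.\<close>

lemma resonance_imp_Spec_ess:
  assumes reg: "regular l" and r: "strict_mono r" and lim: "(\<sigma> \<circ> r) \<longlonglongrightarrow> s"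
    and res: "kernel (resolvent_symbol l) p p = 1 / s"
  shows "of_real l \<in> Spec_ess H"
proof -
  define R where "R = multiplier (resolvent_symbol l)"
  define V where "V = variation (resolvent_symbol l)"
  let ?k = "kernel (resolvent_symbol l)"
  note bv = bounded_variation_resolvent_symbol[OF reg]
  have V: "0 \<le> V" unfolding V_def by (rule variation_nonneg[OF bv])
  have "\<alpha> \<le> s" by (rule LIMSEQ_le_const[OF lim]) (auto intro!: exI[of _ 0] less_imp_le \<sigma>_bounds)
  then have s: "0 < s" using \<alpha>_pos by simp
  define X where "X i = R (delta (a i))" for i
  define h where "h i = restrict_to (- {a i}) (multiply w (X i))" for i
  have coord_X: "coord (X i) x = of_real (?k x (a i))" for i x
    unfolding X_def R_def by (rule coord_multiplier_delta[OF bv])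
  have residual: "hamiltonian (X i) - l *\<^sub>R X i = (1 - \<sigma> i / s) *\<^sub>R delta (a i) - h i" for i
  proof (rule ell2_eqI)
    fix x
    have "multiplier tail (X i) - l *\<^sub>R X i = delta (a i)"
      unfolding X_def R_def by (rule resolvent_inverse(2)[OF reg])
    then have "hamiltonian (X i) - l *\<^sub>R X i = delta (a i) - multiply w (X i)"
      by (simp add: hamiltonian_def algebra_simps)
    then have "coord (hamiltonian (X i) - l *\<^sub>R X i) x = coord (delta (a i)) x - of_real (w x * ?k x (a i))"
      by (simp only: coord_diff coord_multiply[OF w_bound] coord_X of_real_mult)
    then show "coord (hamiltonian (X i) - l *\<^sub>R X i) x = coord ((1 - \<sigma> i / s) *\<^sub>R delta (a i) - h i) x"
      by (simp add: coord_simps coord_delta h_def coord_restrict_to coord_multiply[OF w_bound] coord_X w_a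
          kernel_diagonal[of _ "a i" p] res scaleR_conv_of_real)
  qed
  have h_tendsto: "(\<lambda>i. norm (h i)) \<longlonglongrightarrow> 0"
  proof (rule LIMSEQ_I)
    fix e :: real assume e: "0 < e"
    \<comment> \<open>Both groups of wells contribute at most \<open>\<beta> V e1\<close>, in total at most \<open>e/2\<close>.\<close>
    define e1 where "e1 = e / (4 * (\<beta> * (V + 1)))"
    have e1: "0 < e1" using e V \<beta>_pos by (simp add: e1_def)
    from sparse[OF e1] obtain N where N: "\<forall>i\<ge>N. \<forall>J. finite J \<longrightarrow> J \<subseteq> {N..} - {i} \<longrightarrow>
        (\<Sum>j\<in>J. 1 / dist (a i) (a j)) \<le> e1" ..
    have "(\<lambda>i. \<Sum>j<N. 1 / dist (a j) (a i)) \<longlonglongrightarrow> 0"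
      by (rule tendsto_null_sum) (rule real_tendsto_divide_at_top[OF tendsto_const dist_a_at_top])
    then have "\<forall>\<^sub>F i in sequentially. (\<Sum>j<N. 1 / dist (a j) (a i)) < e1"
      by (rule order_tendstoD(2)[OF _ e1])
    then obtain M where M: "\<And>i. M \<le> i \<Longrightarrow> (\<Sum>j<N. 1 / dist (a j) (a i)) < e1"
      by (auto simp: eventually_sequentially)
    have "norm (h i) < e" if i: "max M N \<le> i" for i
    proof -
      have "norm (h i) \<le> e / 2"
      proof (rule norm_ell2_leI)
        fix S :: "'a set" assume S: "finite S"
        define J where "J = {j. j \<noteq> i \<and> a j \<in> S}"
        have finJ: "finite J"
          by (rule finite_subset[OF _ finite_vimageI[OF S inj_a]]) (auto simp: J_def)
        have injJ: "inj_on a J" using inj_a by (rule inj_on_subset) simp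
        have h_le: "cmod (coord (h i) (a j)) \<le> \<beta> * V * (1 / dist (a i) (a j))" if "j \<in> J" for j
        proof -
          have ne: "a j \<noteq> a i" using that by (simp add: J_def inj_eq[OF inj_a])
          have "cmod (coord (h i) (a j)) = \<bar>w (a j)\<bar> * \<bar>?k (a j) (a i)\<bar>"
            using ne by (simp add: h_def coord_restrict_to coord_multiply[OF w_bound] coord_X norm_mult)
          also have "\<dots> \<le> \<beta> * (V / dist (a j) (a i))"
            unfolding V_def using \<beta>_pos by (intro mult_mono w_bound abs_kernel_le_dist[OF bv ne]) auto
          finally show ?thesis by (simp add: dist_commute)
        qed
        have split: "(\<Sum>j\<in>J. 1 / dist (a i) (a j)) \<le> 2 * e1"
        proof -
          let ?r = "\<lambda>j. 1 / dist (a i) (a j)"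
          have "sum ?r J
              = sum ?r (J \<inter> {..<N}) + sum ?r (J - {..<N})"
            by (rule sum.Int_Diff[OF finJ])
          moreover have "sum ?r (J \<inter> {..<N}) \<le> sum ?r {..<N}"
            by (rule sum_mono2) auto
          moreover have "sum ?r {..<N} = (\<Sum>j<N. 1 / dist (a j) (a i))"
            by (simp add: dist_commute)
          moreover have "sum ?r (J - {..<N}) \<le> e1"
          proof -
            have "J - {..<N} \<subseteq> {N..} - {i}" by (auto simp: J_def)
            then show ?thesis using N i finJ by simp
          qed
          ultimately show ?thesis using M[of i] i by simp
        qed
        have "sqrt (\<Sum>x\<in>S. (cmod (coord (h i) x))\<^sup>2) \<le> (\<Sum>x\<in>S. cmod (coord (h i) x))"
          using L2_set_le_sum[of S "\<lambda>x. cmod (coord (h i) x)"] by (simp add: L2_set_def)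
        also have "\<dots> = (\<Sum>x\<in>a ` J. cmod (coord (h i) x))"
        proof (rule sum.mono_neutral_right[OF S])
          show "\<forall>x\<in>S - a ` J. cmod (coord (h i) x) = 0"
          proof
            fix x assume "x \<in> S - a ` J"
            then have "x = a i \<or> w x = 0" using w_outside[of x] by (auto simp: J_def)
            then show "cmod (coord (h i) x) = 0"
              by (auto simp: h_def coord_restrict_to coord_multiply[OF w_bound])
          qed
        qed (auto simp: J_def)
        also have "\<dots> = (\<Sum>j\<in>J. cmod (coord (h i) (a j)))" by (simp add: sum.reindex[OF injJ])
        also have "\<dots> \<le> (\<Sum>j\<in>J. \<beta> * V * (1 / dist (a i) (a j)))" by (rule sum_mono[OF h_le])
        also have "\<dots> \<le> \<beta> * V * (2 * e1)"
          unfolding sum_distrib_left[symmetric] using V \<beta>_pos by (intro mult_left_mono split) auto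
        also have "\<dots> \<le> \<beta> * (V + 1) * (2 * e1)"
          using V \<beta>_pos e1 by (intro mult_right_mono mult_left_mono) auto
        also have "\<dots> = e / 2" using V \<beta>_pos by (simp add: e1_def)
        finally show "(\<Sum>x\<in>S. (cmod (coord (h i) x))\<^sup>2) \<le> (e / 2)\<^sup>2"
          by (rule sqrt_le_D)
      qed (use e in simp)
      then show ?thesis using e by simp
    qed
    then show "\<exists>M. \<forall>i\<ge>M. norm (norm (h i) - 0) < e" by (intro exI[of _ "max M N"]) simp
  qed
  define K where "K = variation tail + \<bar>l\<bar>"
  have lower: "1 \<le> K * norm (X i)" for i
  proof -
    have "1 = norm (multiplier tail (X i) - l *\<^sub>R X i)"
      unfolding X_def R_def resolvent_inverse(2)[OF reg] norm_delta ..
    also have "\<dots> \<le> norm (multiplier tail (X i)) + norm (l *\<^sub>R X i)" by (rule norm_triangle_ineq4)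
    also have "\<dots> \<le> K * norm (X i)"
      using norm_multiplier_le[OF bounded_variation_tail, of "X i"] by (simp add: K_def distrib_right)
    finally show ?thesis .
  qed
  have "0 \<le> K" using variation_nonneg[OF bounded_variation_tail] by (simp add: K_def)
  moreover have "K \<noteq> 0" using lower[of 0] by auto
  ultimately have K: "0 < K" by simp
  show ?thesis
  proof (rule H.Weyl_sequence_imp_Spec_ess[where X = "\<lambda>i. X (r i)" and c = "1 / K"])
    show "(\<lambda>i. coord (X (r i)) x) \<longlonglongrightarrow> 0" for x
      unfolding coord_X
      using tendsto_of_real[OF LIMSEQ_subseq_LIMSEQ[OF kernel_a_tendsto_0[OF bv, of x] r], where 'a = complex]
      by (simp add: o_def)
    show "1 / K \<le> norm (X (r i))" for i
      using lower[of "r i"] K by (simp add: pos_divide_le_eq mult.commute)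
    show "(\<lambda>i. hamiltonian (X (r i)) - l *\<^sub>R X (r i)) \<longlonglongrightarrow> 0"
    proof (rule Lim_null_comparison)
      show "\<forall>\<^sub>F i in sequentially. norm (hamiltonian (X (r i)) - l *\<^sub>R X (r i)) \<le> \<bar>1 - \<sigma> (r i) / s\<bar> + norm (h (r i))"
      proof (rule always_eventually, rule allI)
        fix i
        show "norm (hamiltonian (X (r i)) - l *\<^sub>R X (r i)) \<le> \<bar>1 - \<sigma> (r i) / s\<bar> + norm (h (r i))"
          unfolding residual
          using norm_triangle_ineq4[of "(1 - \<sigma> (r i) / s) *\<^sub>R delta (a (r i))" "h (r i)"] by (simp add: norm_delta)
      qed
      have "(\<lambda>i. \<bar>1 - \<sigma> (r i) / s\<bar>) \<longlonglongrightarrow> \<bar>1 - s / s\<bar>"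
        using lim s by (intro tendsto_intros) (auto simp: o_def)
      moreover have "(\<lambda>i. norm (h (r i))) \<longlonglongrightarrow> 0"
        using LIMSEQ_subseq_LIMSEQ[OF h_tendsto r] by (simp add: o_def)
      ultimately show "(\<lambda>i. \<bar>1 - \<sigma> (r i) / s\<bar> + norm (h (r i))) \<longlonglongrightarrow> 0"
        using s tendsto_add[of "\<lambda>i. \<bar>1 - \<sigma> (r i) / s\<bar>" 0 _ "\<lambda>i. norm (h (r i))" 0] by simp
    qed
  qed (use K in simp)
qed

text \<open>Otherwise every cell of level \<open>m\<close> inside a large ball around a well is hit. By sparseness at most \<open>1/(2 q)\<close> of the
points of the ball are wells of large index other than the centre, where \<open>q\<close> is the size of a cell; their cells cover at most half
of the ball, and finitely many further cells cannot cover the rest when the ball is large.\<close>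

lemma free_ball_exists:
  assumes F: "finite F"
  obtains x where "cball x (real (n m)) \<inter> (range a \<union> F) = {}"
proof (rule ccontr)
  assume contra: "\<not> thesis"
  have hit: "\<exists>t. t \<in> cball x (real (n m)) \<and> t \<in> range a \<union> F" for x
  proof (rule ccontr)
    assume "\<nexists>t. t \<in> cball x (real (n m)) \<and> t \<in> range a \<union> F"
    then have "cball x (real (n m)) \<inter> (range a \<union> F) = {}" by blast
    then show False using contra that by blast
  qed
  let ?q = "real (n m)"
  have q: "0 < ?q" using n_pos[of m] by simp
  have "0 < 1 / (2 * ?q)" using q by simp
  from sparse[OF this] obtain N where N: "\<forall>i\<ge>N. \<forall>J. finite J \<longrightarrow> J \<subseteq> {N..} - {i} \<longrightarrow>
      (\<Sum>j\<in>J. 1 / dist (a i) (a j)) \<le> 1 / (2 * ?q)" ..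
  have bound: "real (n k) \<le> 2 * (1 + real N + real (card F)) * ?q" if k: "m \<le> k" for k
  proof -
    let ?M = "real (n k)"
    have M: "0 < ?M" using n_pos[of k] by simp
    define ball where "ball = cball (a N) ?M"
    define J where "J = {j. N \<le> j \<and> j \<noteq> N \<and> a j \<in> ball}"
    have finJ: "finite J"
      by (rule finite_subset[OF _ finite_vimageI[OF finite_cball[of "a N" ?M] inj_a]]) (auto simp: J_def ball_def)
    have "real (card J) * (1 / ?M) = (\<Sum>j\<in>J. 1 / ?M)" by simp
    also have "\<dots> \<le> (\<Sum>j\<in>J. 1 / dist (a N) (a j))"
    proof (rule sum_mono)
      fix j assume "j \<in> J"
      then have "dist (a N) (a j) \<le> ?M" "a N \<noteq> a j" by (auto simp: J_def ball_def inj_eq[OF inj_a])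
      then show "1 / ?M \<le> 1 / dist (a N) (a j)" using M by (intro divide_left_mono) auto
    qed
    also have "\<dots> \<le> 1 / (2 * ?q)"
    proof -
      have "J \<subseteq> {N..} - {N}" by (auto simp: J_def)
      then show ?thesis using N finJ by blast
    qed
    finally have cardJ: "real (card J) * ?q \<le> ?M / 2" using M q by (simp add: field_simps)
    define T where "T = insert (a N) (a ` J) \<union> (a ` {..<N} \<union> F)"
    have finT: "finite T" using finJ F by (simp add: T_def)
    have cardT: "card T \<le> Suc (card J) + (N + card F)"
    proof -
      have "card T \<le> card (insert (a N) (a ` J)) + card (a ` {..<N} \<union> F)"
        unfolding T_def by (rule card_Un_le)
      also have "\<dots> \<le> Suc (card (a ` J)) + (card (a ` {..<N}) + card F)"
        by (intro add_mono card_Un_le card_insert_le_m1) (auto intro: card_insert_le_m1 simp: card_insert_if finJ)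
      also have "\<dots> \<le> Suc (card J) + (N + card F)"
        using card_image_le[OF finJ, of a] card_image_le[of "{..<N}" a] by simp
      finally show ?thesis .
    qed
    have "ball \<subseteq> (\<Union>t\<in>T. cball t ?q)"
    proof
      fix x assume x: "x \<in> ball"
      obtain t where t: "t \<in> cball x ?q" "t \<in> range a \<union> F" using hit[of x] by blast
      have "cball x ?q \<subseteq> cball x ?M" by (rule B_mono[OF k])
      also have "cball x ?M = ball" unfolding ball_def by (rule B_eq) (use x in \<open>simp add: ball_def\<close>)
      finally have "t \<in> ball" using t(1) by blast
      have "t \<in> T"
      proof (cases "t \<in> F")
        case False
        then obtain j where "t = a j" using t(2) by blast
        then show ?thesis using \<open>t \<in> ball\<close> by (cases "j < N"; cases "j = N") (auto simp: T_def J_def)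
      qed (simp add: T_def)
      then show "x \<in> (\<Union>t\<in>T. cball t ?q)" using t(1) by (auto simp: dist_commute)
    qed
    then have "card ball \<le> card (\<Union>t\<in>T. cball t ?q)"
      by (rule card_mono[rotated]) (simp add: finT finite_cball)
    also have "\<dots> \<le> (\<Sum>t\<in>T. card (cball t ?q))" by (rule card_UN_le[OF finT])
    also have "\<dots> = card T * n m" by (simp add: card_B)
    also have "\<dots> \<le> (Suc (card J) + (N + card F)) * n m" by (rule mult_right_mono[OF cardT]) simp
    finally have "n k \<le> (Suc (card J) + (N + card F)) * n m" by (simp only: ball_def card_B)
    then have "?M \<le> real ((Suc (card J) + (N + card F)) * n m)" by (simp only: of_nat_le_iff)
    also have "\<dots> = real (card J) * ?q + (1 + real N + real (card F)) * ?q" by (simp add: algebra_simps)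
    finally show ?thesis using cardJ by (simp add: algebra_simps)
  qed
  have "filterlim (\<lambda>k. real (n k)) at_top sequentially"
    by (rule filterlim_compose[OF filterlim_real_sequentially filterlim_subseq[OF strict_mono_n]])
  then have "\<forall>\<^sub>F k in sequentially. 2 * (1 + real N + real (card F)) * ?q < real (n k)"
    by (simp add: filterlim_at_top_dense)
  then obtain k0 where "\<forall>k\<ge>k0. 2 * (1 + real N + real (card F)) * ?q < real (n k)"
    by (auto simp only: eventually_sequentially)
  then show False using bound[of "max m k0"] by (meson max.cobounded1 max.cobounded2 not_le)
qed

lemma unit_eigenvector_exists:
  assumes F: "finite F"
  obtains f where "norm f = 1" "hamiltonian f = tail m *\<^sub>R f" "\<forall>x\<in>F. coord f x = 0"
proof -
  obtain x where x: "cball x (real (n (Suc m))) \<inter> (range a \<union> F) = {}" by (rule free_ball_exists[OF F])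
  have out: "coord (wave m x) y = 0" if "y \<in> range a \<union> F" for y
    by (rule coord_wave_outside) (use x that in blast)
  have "multiply w (wave m x) = 0"
  proof (rule ell2_eqI)
    fix y
    show "coord (multiply w (wave m x)) y = coord 0 y"
      using out[of y] w_outside[of y] by (cases "y \<in> range a") (auto simp: coord_multiply[OF w_bound] coord_zero)
  qed
  then have eig: "hamiltonian (wave m x) = tail m *\<^sub>R wave m x"
    by (simp add: hamiltonian_def wave_eigenvector)
  let ?f = "(1 / norm (wave m x)) *\<^sub>R wave m x"
  show ?thesis
  proof (rule that[of ?f])
    show "norm ?f = 1" using wave_nonzero[of m x] by simp
    show "hamiltonian ?f = tail m *\<^sub>R ?f" by (simp add: H.U.scaleR eig)
    show "\<forall>y\<in>F. coord ?f y = 0" using out by (simp add: coord_scaleR)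
  qed
qed

text \<open>Eigenfunctions of \<open>L\<close> on balls that avoid the wells and leave every finite set form a Weyl sequence.\<close>

lemma Spec_L_subset_Spec_ess_H:
  assumes "of_real l \<in> Spec L"
  shows "of_real l \<in> Spec_ess H"
proof -
  \<comment> \<open>An eigenvalue is approached by itself, the remaining point 0 by the eigenvalues.\<close>
  have "\<exists>\<mu>. (\<forall>k. \<mu> k \<in> range tail) \<and> \<mu> \<longlonglongrightarrow> l"
  proof (cases "l = 0")
    case True
    then show ?thesis using tail_tendsto_0 by (intro exI[of _ tail]) simp
  next
    case False
    then have "l \<in> range tail" using assms Spec_L_iff[of l] unfolding regular_def by blast
    then show ?thesis by (intro exI[of _ "\<lambda>_. l"]) simp
  qed
  then obtain \<mu> where \<mu>: "\<forall>k. \<mu> k \<in> range tail" "\<mu> \<longlonglongrightarrow> l" by blast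
  let ?P = "\<lambda>k f. norm f = 1 \<and> hamiltonian f = \<mu> k *\<^sub>R f \<and> (\<forall>x\<in>cball undefined (real k). coord f x = 0)"
  have "\<forall>k. \<exists>f. ?P k f"
  proof
    fix k :: nat
    obtain m where m: "\<mu> k = tail m" using \<mu>(1) by blast
    obtain f where "norm f = 1" "hamiltonian f = tail m *\<^sub>R f" "\<forall>x\<in>cball undefined (real k). coord f x = 0"
      by (rule unit_eigenvector_exists[where m = m, OF finite_cball[of undefined "real k"]])
    then show "\<exists>f. ?P k f"
      unfolding m by blast
  qed
  from choice[OF this] obtain X where X: "\<forall>k. ?P k (X k)" by blast
  show ?thesis
  proof (rule H.Weyl_sequence_imp_Spec_ess[where X = X and c = 1])
    show "(\<lambda>k. coord (X k) x) \<longlonglongrightarrow> 0" for x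
    proof (rule tendsto_eventually)
      obtain k0 where k0: "dist undefined x \<le> real k0" using real_arch_simple by blast
      have "coord (X k) x = 0" if "k0 \<le> k" for k
      proof -
        have "x \<in> cball undefined (real k)" using k0 that by simp
        then show ?thesis using X by blast
      qed
      then show "\<forall>\<^sub>F k in sequentially. coord (X k) x = 0" by (auto simp: eventually_sequentially)
    qed
    show "1 \<le> norm (X k)" for k using X by simp
    show "(\<lambda>k. hamiltonian (X k) - l *\<^sub>R X k) \<longlonglongrightarrow> 0"
    proof (rule Lim_null_comparison)
      have "hamiltonian (X k) - l *\<^sub>R X k = (\<mu> k - l) *\<^sub>R X k" for k using X by (simp add: scaleR_diff_left)
      then show "\<forall>\<^sub>F k in sequentially. norm (hamiltonian (X k) - l *\<^sub>R X k) \<le> \<bar>\<mu> k - l\<bar>" using X by simp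
      show "(\<lambda>k. \<bar>\<mu> k - l\<bar>) \<longlonglongrightarrow> 0" using \<mu>(2) by (intro tendsto_rabs_zero LIM_zero)
    qed
  qed simp
qed

lemma Spec_ess_H_subset:
  assumes z: "of_real l \<in> Spec_ess H" and reg: "regular l"
  shows "kernel (resolvent_symbol l) p p \<in> (\<lambda>s. 1 / s) ` limit_points \<sigma>"
proof -
  define \<rho> where "\<rho> = kernel (resolvent_symbol l) p p"
  have close: "\<exists>i\<ge>N. \<bar>1 / \<sigma> i - \<rho>\<bar> < \<eta>" if \<eta>: "0 < \<eta>" for N \<eta>
  proof (rule ccontr)
    assume "\<not> (\<exists>i\<ge>N. \<bar>1 / \<sigma> i - \<rho>\<bar> < \<eta>)"
    then have gap: "\<eta> \<le> \<bar>1 / \<sigma> i - kernel (resolvent_symbol l) p p\<bar>" if "N \<le> i" for i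
      using that unfolding \<rho>_def by (meson not_le)
    from resolvent_estimate[OF reg \<eta> gap] obtain F D where "finite F"
      "\<forall>f. norm f \<le> D * (norm (hamiltonian f - l *\<^sub>R f) + (\<Sum>x\<in>F. cmod (coord f x)))" by blast
    then have "of_real l \<in> Spec_disc H"
      by (intro H.finite_rank_estimate_imp_Spec_disc[of F D l]) (use z in \<open>auto simp: Spec_ess_def\<close>)
    then show False using z by (simp add: Spec_ess_def)
  qed
  have "\<exists>r. \<forall>k. \<bar>1 / \<sigma> (r k) - \<rho>\<bar> < 1 / real (Suc k) \<and> r k < r (Suc k)"
  proof (rule dependent_nat_choice)
    show "\<exists>i. \<bar>1 / \<sigma> i - \<rho>\<bar> < 1 / real (Suc 0)" using close[of 1 0] by auto
    show "\<exists>j. \<bar>1 / \<sigma> j - \<rho>\<bar> < 1 / real (Suc (Suc k)) \<and> i < j" for i k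
      using close[of "1 / real (Suc (Suc k))" "Suc i"] by (auto simp: Suc_le_eq)
  qed
  then obtain r where r: "\<And>k. \<bar>1 / \<sigma> (r k) - \<rho>\<bar> < 1 / real (Suc k)" "\<And>k. r k < r (Suc k)" by blast
  have mono: "strict_mono r" using r(2) by (simp add: strict_mono_Suc_iff)
  have "(\<lambda>k. 1 / \<sigma> (r k) - \<rho>) \<longlonglongrightarrow> 0"
    by (rule Lim_null_comparison[OF _ LIMSEQ_inverse_real_of_nat])
      (use r(1) in \<open>auto simp: inverse_eq_divide intro!: always_eventually less_imp_le\<close>)
  then have lim: "(\<lambda>k. 1 / \<sigma> (r k)) \<longlonglongrightarrow> \<rho>" by (rule LIM_zero_cancel)
  have "1 / \<beta> \<le> 1 / \<sigma> i" for i
    using \<sigma>_bounds(2)[of i] \<sigma>_pos[of i] by (intro divide_left_mono) auto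
  then have "1 / \<beta> \<le> \<rho>" by (intro LIMSEQ_le_const[OF lim]) auto
  then have \<rho>: "0 < \<rho>" using \<beta>_pos by (meson divide_pos_pos less_le_trans zero_less_one)
  have "(\<lambda>k. 1 / (1 / \<sigma> (r k))) \<longlonglongrightarrow> 1 / \<rho>" using \<rho> by (intro tendsto_divide tendsto_const lim) simp
  then have "1 / \<rho> \<in> limit_points \<sigma>" using mono by (auto simp: limit_points_def o_def)
  then show ?thesis unfolding \<rho>_def[symmetric] by (rule rev_image_eqI) simp
qed

end

section \<open>Balls of a homogeneous ultrametric space\<close>

text \<open>The point \<open>p\<close> is a base point, from which isometries carry statements to every other point.\<close>

locale homogeneous_ultrametric =
  fixes p :: "'a :: metric_space"
  assumes infinite_space: "infinite (UNIV :: 'a set)"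
    and ultrametric: "\<And>x y z :: 'a. dist x y \<le> max (dist x z) (dist z y)"
    and finite_cball: "\<And>(x :: 'a) r. finite (cball x r)"
    and transitive: "\<And>x y. \<exists>g :: 'a \<Rightarrow> 'a. bij g \<and> (\<forall>u v. dist (g u) (g v) = dist u v) \<and> g x = y"
    and normalized: "\<And>A :: 'a set. A \<in> balls \<Longrightarrow> card A \<noteq> 1 \<Longrightarrow> real (card A) = diameter A"
begin

lemma cball_subset_cball: "y \<in> cball x r \<Longrightarrow> cball y r \<subseteq> cball (x :: 'a) r"
proof
  fix z assume "y \<in> cball x r" "z \<in> cball y r"
  then show "z \<in> cball x r" using ultrametric[of x z y] by simp
qed

lemma cball_eq: "y \<in> cball x r \<Longrightarrow> cball y r = cball (x :: 'a) r"
  using cball_subset_cball[of y x r] cball_subset_cball[of x y r] by (auto simp: dist_commute)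

lemma card_cball_homogeneous: "card (cball (x :: 'a) r) = card (cball (y :: 'a) r)"
proof -
  obtain g where g: "bij g" "\<forall>u v. dist (g u) (g v) = dist u v" "g x = y"
    using transitive[of x y] by blast
  have "g ` cball x r = cball y r"
  proof (intro equalityI subsetI)
    fix z assume "z \<in> cball y r"
    moreover obtain u where "z = g u" using g(1) by (metis bij_pointE)
    ultimately show "z \<in> g ` cball x r" using g(2)[rule_format, of x u] g(3) by auto
  next
    fix z assume "z \<in> g ` cball x r"
    then show "z \<in> cball y r" using g(2) g(3) by auto
  qed
  then show ?thesis using card_image[of g "cball x r"] g(1) by (metis bij_is_inj inj_on_subset subset_UNIV)
qed

lemma cball_in_balls: "0 < r \<Longrightarrow> cball x r \<in> balls"
  by (auto simp: balls_def)

lemma diameter_cball_dist: "diameter (cball x (dist x y)) = dist x (y :: 'a)"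
proof (rule antisym)
  have "dist u v \<le> dist x y" if "u \<in> cball x (dist x y)" "v \<in> cball x (dist x y)" for u v
    using ultrametric[of u v x] that by (simp add: dist_commute)
  then have "(SUP (u, v)\<in>cball x (dist x y) \<times> cball x (dist x y). dist u v) \<le> dist x y"
    by (intro cSUP_least) auto
  then show "diameter (cball x (dist x y)) \<le> dist x y"
    by (simp add: diameter_def)
  show "dist x y \<le> diameter (cball x (dist x y))"
    by (rule diameter_bounded_bound) auto
qed

text \<open>The ball whose radius is the distance of two of its points has that distance as diameter, so the
normalisation identifies distances with ball sizes.\<close>

lemma dist_eq_card:
  assumes "x \<noteq> (y :: 'a)"
  shows "dist x y = real (card (cball x (dist x y)))" "2 \<le> dist x y"
proof -
  have "card {x, y} \<le> card (cball x (dist x y))" by (rule card_mono[OF finite_cball]) auto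
  then have two: "2 \<le> card (cball x (dist x y))" using assms by simp
  then show eq: "dist x y = real (card (cball x (dist x y)))"
    using normalized[OF cball_in_balls[of "dist x y" x]] assms diameter_cball_dist[of x y] by simp
  show "2 \<le> dist x y" using two by (subst eq) simp
qed

text \<open>The possible numbers of points of a ball. Distinct points have distance at least 2, so 1, as a radius and as a
size, represents singletons, and a ball of size \<open>k\<close> is the closed ball of radius \<open>k\<close> about its points.\<close>

definition sizes :: "nat set" where
  "sizes = insert 1 {k. 1 \<le> k \<and> (\<exists>y. dist p y = real k)}"

lemma dist_in_sizes:
  assumes "x \<noteq> (y :: 'a)"
  obtains k where "k \<in> sizes" "dist x y = real k"
proof -
  obtain g where g: "bij g" "\<forall>u v. dist (g u) (g v) = dist u v" "g x = p"
    using transitive[of x p] by blast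
  let ?k = "card (cball x (dist x y))"
  have "dist x y = real ?k" by (rule dist_eq_card(1)[OF assms])
  moreover have "2 \<le> real ?k" using dist_eq_card[OF assms] by simp
  moreover have "dist p (g y) = real ?k" using g(2)[rule_format, of x y] g(3) dist_eq_card(1)[OF assms] by simp
  ultimately have "?k \<in> sizes" unfolding sizes_def by auto
  then show ?thesis using that dist_eq_card(1)[OF assms] by blast
qed

lemma infinite_sizes: "infinite sizes"
proof
  assume "finite sizes"
  then obtain M where M: "\<And>k. k \<in> sizes \<Longrightarrow> k \<le> M" using finite_nat_set_iff_bounded_le by metis
  have "UNIV \<subseteq> cball p (real M)"
  proof
    fix y
    show "y \<in> cball p (real M)"
    proof (cases "y = p")
      case False
      then obtain k where "k \<in> sizes" "dist p y = real k" using dist_in_sizes[of p y] by metis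
      then show ?thesis using M[of k] by simp
    qed simp
  qed
  then show False using infinite_space finite_cball finite_subset by blast
qed

definition size_seq :: "nat \<Rightarrow> nat" where
  "size_seq = enumerate sizes"

abbreviation cell :: "nat \<Rightarrow> 'a \<Rightarrow> 'a set" where
  "cell k x \<equiv> cball x (real (size_seq k))"

lemma strict_mono_size_seq: "strict_mono size_seq"
  unfolding size_seq_def by (rule strict_mono_enumerate[OF infinite_sizes])

lemma range_size_seq: "range size_seq = sizes"
  unfolding size_seq_def by (rule range_enumerate[OF infinite_sizes])

lemma size_seq_0: "size_seq 0 = 1"
  unfolding size_seq_def enumerate_0
  by (rule Least_equality) (auto simp: sizes_def)

lemma cball_1: "cball x 1 = {x :: 'a}"
  using dist_eq_card(2)[of x] by force

lemma card_cball_size_seq: "card (cell k (x :: 'a)) = size_seq k"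
proof (cases "size_seq k = 1")
  case True
  then show ?thesis by (simp add: cball_1)
next
  case False
  then obtain y where y: "dist p y = real (size_seq k)" "1 \<le> size_seq k"
    using range_size_seq unfolding sizes_def by blast
  then have "p \<noteq> y" by auto
  then have "size_seq k = card (cell k p)"
    using dist_eq_card(1)[of p y] y(1) by simp
  then show ?thesis using card_cball_homogeneous[of x _ p] by simp
qed

sublocale homogeneous_partitions cell size_seq
proof
  show "cell k y = cell k x" if "y \<in> cell k x" for y x :: 'a and k
    by (rule cball_eq[OF that])
  show "cell j x \<subseteq> cell k x" if "j \<le> k" for j k and x :: 'a
    using strict_mono_less_eq[OF strict_mono_size_seq, of j k] that by (intro subset_cball) simp
qed (simp_all add: finite_cball size_seq_0 cball_1 card_cball_size_seq strict_mono_size_seq)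

lemma balls_at: "bij_betw (\<lambda>k. cell k x) UNIV {A \<in> balls. (x :: 'a) \<in> A}"
proof (rule bij_betw_imageI)
  show "inj (\<lambda>k. cell k x)"
  proof (rule injI)
    fix j k assume "cell j x = cell k x"
    then have "size_seq j = size_seq k" by (metis card_cball_size_seq)
    then show "j = k" by (rule strict_mono_eq[OF strict_mono_size_seq, THEN iffD1])
  qed
  show "range (\<lambda>k. cell k x) = {A \<in> balls. x \<in> A}"
  proof (intro equalityI subsetI)
    fix A assume "A \<in> range (\<lambda>k. cell k x)"
    then show "A \<in> {A \<in> balls. x \<in> A}" using n_pos by (auto intro: cball_in_balls)
  next
    fix A assume "A \<in> {A \<in> balls. x \<in> A}"
    then obtain y s where s: "0 < s" "A = cball y s" "x \<in> cball y s" by (auto simp: balls_def)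
    then have A: "A = cball x s" using cball_eq by blast
    \<comment> \<open>A radius below 1 is smaller than every size; its ball is a singleton, of level 0.\<close>
    define J where "J = insert 0 {j. real (size_seq j) \<le> s}"
    have "finite {j. real (size_seq j) \<le> s}"
    proof (rule finite_subset)
      show "{j. real (size_seq j) \<le> s} \<subseteq> {..nat \<lfloor>s\<rfloor>}"
      proof
        fix j assume "j \<in> {j. real (size_seq j) \<le> s}"
        then have "size_seq j \<le> nat \<lfloor>s\<rfloor>" by (simp add: le_nat_floor)
        moreover have "j \<le> size_seq j" by (rule strict_mono_imp_increasing[OF strict_mono_size_seq])
        ultimately show "j \<in> {..nat \<lfloor>s\<rfloor>}" by simp
      qed
    qed simp
    then have J: "finite J" "J \<noteq> {}" by (simp_all add: J_def)
    define k where "k = Max J"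
    have "cball x s = cell k x"
    proof (intro equalityI subsetI)
      fix z assume z: "z \<in> cball x s"
      show "z \<in> cell k x"
      proof (cases "z = x")
        case False
        then obtain i where i: "i \<in> sizes" "dist x z = real i" using dist_in_sizes[of x z] by metis
        then obtain j where j: "i = size_seq j" using range_size_seq by blast
        then have "j \<in> J" using z i by (simp add: J_def)
        then have "j \<le> k" unfolding k_def using J by simp
        then have "size_seq j \<le> size_seq k" using strict_mono_less_eq[OF strict_mono_size_seq] by blast
        then show ?thesis using i j by simp
      qed simp
    next
      fix z assume z: "z \<in> cell k x"
      have "k \<in> J" unfolding k_def by (rule Max_in[OF J])
      then consider "real (size_seq k) \<le> s" | "k = 0" by (auto simp: J_def)
      then show "z \<in> cball x s"
      proof cases
        case 1
        then show ?thesis using z by simp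
      next
        case 2
        then have "z = x" using z by (simp add: size_seq_0 cball_1[unfolded set_eq_iff, simplified])
        then show ?thesis using s by simp
      qed
    qed
    then show "A \<in> range (\<lambda>k. cell k x)" unfolding A by (rule range_eqI)
  qed
qed

lemma diameter_cball_size_seq:
  "diameter (cell k (x :: 'a)) = diameter (cell k p)"
proof (cases "size_seq k = 1")
  case True
  then show ?thesis by (simp add: cball_1)
next
  case False
  then have "real (size_seq k) = diameter (cell k y)" for y :: 'a
    using normalized[OF cball_in_balls, of "real (size_seq k)" y] n_pos[of k] by (simp add: card_cball_size_seq)
  then show ?thesis by metis
qed

end

locale homogeneous_laplacian = homogeneous_ultrametric p for p :: "'a :: metric_space" +
  fixes C :: "'a :: metric_space set \<Rightarrow> real"
  assumes choice_function: "homogeneous_choice_function C"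
begin

definition level_weight :: "nat \<Rightarrow> real" where
  "level_weight k = C (cell k p)"

lemma cball_size_seq_in_balls: "cell k (x :: 'a) \<in> balls"
  by (rule cball_in_balls) (simp add: n_pos)

lemma C_cball: "C (cell k x) = level_weight k"
  using choice_function cball_size_seq_in_balls diameter_cball_size_seq
  unfolding level_weight_def homogeneous_choice_function_def by blast

sublocale hierarchical_symbol cell size_seq level_weight
proof
  show "0 < level_weight k" for k
    using choice_function cball_size_seq_in_balls
    unfolding level_weight_def homogeneous_choice_function_def by blast
  have "C summable_on {T \<in> balls. cell 0 p \<subseteq> T}"
    using choice_function cball_size_seq_in_balls unfolding homogeneous_choice_function_def by blast
  then have "C summable_on {T \<in> balls. p \<in> T}" by (simp add: size_seq_0 cball_1)
  then have "(\<lambda>k. C (cell k p)) summable_on UNIV"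
    using summable_on_reindex_bij_betw[OF balls_at[of p], of C] by simp
  then show "summable level_weight"
    unfolding level_weight_def[abs_def] by (rule summable_on_imp_summable)
qed

lemma coord_laplacian: "coord (multiplier tail f) = hierarchical_laplacian C (coord f)"
proof
  fix x
  let ?t = "\<lambda>k. level_weight k *\<^sub>R (coord f x - coord (average k f) x)"
  have "summable (\<lambda>k. norm (?t k))"
  proof (rule summable_comparison_test)
    show "summable (\<lambda>k. level_weight k * (2 * norm f))" by (rule summable_mult2[OF summable_c])
    have "norm (?t k) \<le> level_weight k * (2 * norm f)" for k
    proof -
      have "cmod (coord f x - coord (average k f) x) \<le> cmod (coord f x) + cmod (coord (average k f) x)"
        by (rule norm_triangle_ineq4)
      also have "\<dots> \<le> norm f + norm f"
        by (intro add_mono cmod_coord_le order_trans[OF cmod_coord_le norm_average_le])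
      finally show ?thesis using c_pos[of k] by (simp add: mult_left_mono)
    qed
    then show "\<exists>N. \<forall>k\<ge>N. norm (norm (?t k)) \<le> level_weight k * (2 * norm f)" by simp
  qed
  from norm_summable_imp_has_sum[OF this laplacian_sums]
  have "(?t has_sum coord (multiplier tail f) x) UNIV" .
  moreover define G where "G A = of_real (C A) * (coord f x - (\<Sum>y\<in>A. coord f y) / of_nat (card A))" for A
  have "?t k = G (cell k x)" for k
    by (simp add: G_def C_cball coord_average card_cball_size_seq scaleR_conv_of_real)
  ultimately have "((\<lambda>k. G (cell k x)) has_sum coord (multiplier tail f) x) UNIV"
    by (simp only:)
  then have "(G has_sum coord (multiplier tail f) x) {A \<in> balls. x \<in> A}"
    by (rule has_sum_reindex_bij_betw[OF balls_at, THEN iffD1])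
  from infsumI[OF this] show "coord (multiplier tail f) x = hierarchical_laplacian C (coord f) x"
    unfolding hierarchical_laplacian_def G_def[abs_def] by (rule sym)
qed

end

lemma sparse_finite_sums:
  fixes a :: "nat \<Rightarrow> 'a::metric_space"
  assumes sparse: "(\<lambda>N. SUP i\<in>{N..}. \<Sum>\<^sub>\<infinity>j\<in>{N..} - {i}. ennreal (1 / dist (a i) (a j))) \<longlonglongrightarrow> 0"
    and \<epsilon>: "0 < \<epsilon>"
  shows "\<exists>N. \<forall>i\<ge>N. \<forall>J. finite J \<longrightarrow> J \<subseteq> {N..} - {i} \<longrightarrow> (\<Sum>j\<in>J. 1 / dist (a i) (a j)) \<le> \<epsilon>"
proof -
  let ?s = "\<lambda>N i. \<Sum>\<^sub>\<infinity>j\<in>{N..} - {i}. ennreal (1 / dist (a i) (a j))"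
  have "\<forall>\<^sub>F N in sequentially. (SUP i\<in>{N..}. ?s N i) < ennreal \<epsilon>"
    by (rule order_tendstoD(2)[OF sparse]) (use \<epsilon> in simp)
  then obtain N where N: "(SUP i\<in>{N..}. ?s N i) < ennreal \<epsilon>"
    unfolding eventually_sequentially by blast
  have "(\<Sum>j\<in>J. 1 / dist (a i) (a j)) \<le> \<epsilon>" if "N \<le> i" "finite J" "J \<subseteq> {N..} - {i}" for i J
  proof -
    have "ennreal (\<Sum>j\<in>J. 1 / dist (a i) (a j)) = (\<Sum>j\<in>J. ennreal (1 / dist (a i) (a j)))"
      by (rule sum_ennreal[symmetric]) simp
    also have "\<dots> \<le> ?s N i"
      unfolding infsum_finite[OF that(2), symmetric]
      by (rule infsum_mono_neutral) (use that in \<open>auto intro!: nonneg_summable_on_complete\<close>)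
    also have "\<dots> \<le> (SUP i\<in>{N..}. ?s N i)"
      by (rule SUP_upper) (use that in simp)
    also note N
    finally show ?thesis using \<epsilon> by (simp add: ennreal_less_iff sum_nonneg)
  qed
  then show ?thesis by blast
qed

section \<open>The essential spectrum\<close>

theorem theorem6p5:
  fixes C :: "'a::metric_space set \<Rightarrow> real"
    and a :: "nat \<Rightarrow> 'a"
    and \<sigma> :: "nat \<Rightarrow> real"
    and \<alpha> \<beta> :: real
    and p :: 'a
    and V :: "'a \<Rightarrow> real"
    and L H :: "('a \<Rightarrow> complex) \<Rightarrow> 'a \<Rightarrow> complex"
  assumes countable: "countable (UNIV :: 'a set)"
    and infinite: "infinite (UNIV :: 'a set)"
    and ultrametric: "\<And>x y z :: 'a. dist x y \<le> max (dist x z) (dist z y)"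
    and finite_balls: "\<And>(x::'a) r. finite (cball x r)"
    and transitive: "\<And>x y. \<exists>g :: 'a \<Rightarrow> 'a. bij g \<and> (\<forall>u v. dist (g u) (g v) = dist u v) \<and> g x = y"
    and normalized: "\<And>B :: 'a set. B \<in> balls \<Longrightarrow> card B \<noteq> 1 \<Longrightarrow> real (card B) = diameter B"
    and choice_function: "homogeneous_choice_function C"
    and L_def: "L = hierarchical_laplacian C"
    and distinct: "inj a"
    and pos: "0 < \<alpha>" "0 < \<beta>"
    and bounds: "\<And>i. \<alpha> < \<sigma> i \<and> \<sigma> i < \<beta>"
    and V_def: "V = (\<lambda>x. - (\<Sum>i. \<sigma> i * indicator {a i} x))"
    and H_def: "H = (\<lambda>f x. L f x + of_real (V x) * f x)"
    and sparse: "(\<lambda>N. SUP i\<in>{N..}. \<Sum>\<^sub>\<infinity>j\<in>{N..} - {i}. ennreal (1 / dist (a i) (a j))) \<longlonglongrightarrow> 0"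
  shows "Spec_ess H =
    Spec L \<union> {of_real l | l :: real. of_real l \<notin> Spec L \<and>
                 integral_kernel (resolvent L (of_real l)) p p \<in> (\<lambda>s. of_real (1 / s)) ` limit_points \<sigma>}"
proof -
  interpret X: homogeneous_laplacian p C
    by unfold_locales (fact infinite ultrametric finite_balls transitive normalized choice_function)+
  have V_a: "- V (a i) = \<sigma> i" for i
  proof -
    have "(\<lambda>j. \<sigma> j * indicator {a j} (a i)) = (\<lambda>j. if j = i then \<sigma> j else 0)"
      by (auto simp: indicator_def inj_eq[OF distinct])
    then show ?thesis using sums_unique[OF sums_single[of i \<sigma>]] by (simp add: V_def)
  qed
  have V_outside: "- V x = 0" if "x \<notin> range a" for x
  proof -
    have "x \<noteq> a j" for j using that by blast
    then have "(\<lambda>j. \<sigma> j * indicator {a j} x) = (\<lambda>j. 0)" by simp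
    then show ?thesis by (simp add: V_def)
  qed
  interpret X: sparse_wells X.size_seq X.level_weight L a \<sigma> \<alpha> \<beta> "\<lambda>x. - V x" H
    apply unfold_locales
    subgoal by (simp add: X.coord_laplacian L_def)
    subgoal by (rule finite_balls)
    subgoal by (rule distinct)
    subgoal by (rule pos)
    subgoal using bounds by blast
    subgoal using bounds by blast
    subgoal by (rule V_a)
    subgoal by (rule V_outside)
    subgoal by (simp add: H_def)
    subgoal by (rule sparse_finite_sums[OF sparse])
    done
  have kernel_iff: "integral_kernel (resolvent L (of_real l)) p p \<in> (\<lambda>s. of_real (1 / s)) ` limit_points \<sigma>
      \<longleftrightarrow> X.kernel (X.resolvent_symbol l) p p \<in> (\<lambda>s. 1 / s) ` limit_points \<sigma>" if "X.regular l" for l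
    unfolding X.integral_kernel_resolvent[OF that] image_iff of_real_eq_iff ..
  let ?R = "Spec L \<union> {of_real l | l. of_real l \<notin> Spec L \<and>
        integral_kernel (resolvent L (of_real l)) p p \<in> (\<lambda>s. of_real (1 / s)) ` limit_points \<sigma>}"
  show ?thesis
  proof (intro equalityI subsetI)
    fix z assume z: "z \<in> Spec_ess H"
    then have "z = of_real (Re z)" by (intro X.H.Spec_real) (simp add: Spec_ess_def)
    then obtain l where l: "z = of_real l" by blast
    show "z \<in> ?R"
    proof (cases "X.regular l")
      case True
      then show ?thesis
        using X.Spec_ess_H_subset[of l p] z kernel_iff[OF True] X.Spec_L_iff[of l] unfolding l by blast
    next
      case False
      then show ?thesis using X.Spec_L_iff[of l] unfolding l by blast
    qed
  next
    fix z assume "z \<in> ?R"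
    then consider "z \<in> Spec L" | l where "z = of_real l" "X.regular l"
        "integral_kernel (resolvent L (of_real l)) p p \<in> (\<lambda>s. of_real (1 / s)) ` limit_points \<sigma>"
      using X.Spec_L_iff by blast
    then show "z \<in> Spec_ess H"
    proof cases
      case 1
      then show ?thesis using X.L.Spec_real[OF 1] X.Spec_L_subset_Spec_ess_H[of "Re z"] by simp
    next
      case 2
      then obtain s where s: "s \<in> limit_points \<sigma>" "X.kernel (X.resolvent_symbol l) p p = 1 / s"
        using kernel_iff by blast
      then obtain r where "strict_mono r" "(\<sigma> \<circ> r) \<longlonglongrightarrow> s" by (auto simp: limit_points_def)
      then show ?thesis unfolding 2(1) using X.resonance_imp_Spec_ess[OF 2(2)] s(2) by blast
    qed
  qed
qed

end
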